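(* Let $\rightarrow$ denote the scattering relation on $\hat{\mathbb{E}}$. For all $A,A'\in\hat{\mathbb{E}}$: (i) (energy conservation) $A\rightarrow A'\implies\|A\|=\|A'\|$. (ii) (reflexivity) $A\rightarrow A$. (iii) (time symmetry) $A\rightarrow A'\iff -A'\rightarrow -A$. (iv) (dilation) For any $k>0$, $A\rightarrow A'\iff kA\rightarrow kA'$. (v) (rotation) For any $R\in O(d)$ acting diagonally, $A\rightarrow A'\iff RA\rightarrow RA'$. (vi) (reversibility) $A\rightarrow A'\iff A'\rightarrow A$. (vii) (openness) For generic $A\in\hat{\mathbb{E}}$ the image $\mathcal{HS}(A)=\{A':A\rightarrow A'\}$ contains a nonempty open subset of the sphere $\hat S(\|A\|)=\{A'\in\hat{\mathbb{E}}:\|A'\|=\|A\|\}$ whose closure contains $A$. Here "for generic $A$" means: for all $A$ in some open dense subset of $\hat{\mathbb{E}}$ which contains every $A\in\hat{\mathbb{E}}$ that is planar (all bodies $A_i\in\mathbb{R}^d$ lie in one plane) but not collinear.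
   Context: Fix $n\ge 2$, $d\ge 2$ and masses $m_1,\dots,m_n>0$. Let $\mathbb{E}=\{q=(q_1,\dots,q_n)\in(\mathbb{R}^d)^n:\sum_i m_iq_i=0\}$, with mass inner product $\langle\!\langle v,w\rangle\!\rangle=\sum_i m_i\, v_i\cdot w_i$ and norm $\|\cdot\|$. Let $\Delta=\{q: q_i=q_j\text{ for some }i\neq j\}$, $\hat{\mathbb{E}}=\mathbb{E}\setminus\Delta$, $S=\{s\in\mathbb{E}:\|s\|=1\}$, $\hat S=S\setminus\Delta$. Let $U(q)=\sum_{i<j}\frac{m_im_j}{|q_i-q_j|}$, let $\nabla U$ be its gradient with respect to the mass inner product, and let $\tilde\nabla U(s)=\nabla U(s)+U(s)s$ for $s\in\hat S$. Extended phase space: the set of $(\rho,s,v,w)$ with $\rho\ge 0$, $s\in\hat S$, $v\in\mathbb{R}$, $w\in\mathbb{E}$, $\langle\!\langle s,w\rangle\!\rangle=0$ and positive energy $h=\frac12v^2+\frac12\|w\|^2-\rho U(s)>0$, with the flow $\phi_\tau$ (possibly incomplete) of $$\rho'=-v\rho,\quad s'=w,\quad v'=\|w\|^2-\rho U(s),\quad w'=\rho\tilde\nabla U(s)-vw-\|w\|^2s,\qquad {}'=d/d\tau .$$ For $\rho>0$ this is Newton's equation $\ddot q=\nabla U(q)$ on $\hat{\mathbb{E}}$ with $q=s/\rho$, $\dot q=vs+w$, $dt=\rho^{-1}d\tau$. Collision-free equilibria at infinity: $\hat{\mathcal{E}}_\pm=\{(0,s,v,0): s\in\hat S,\ \pm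 v>0\}$; write $(s,v)$ for $(0,s,v,0)$. Let $\mathcal{H}_+$ (resp. $\mathcal{H}_-$) be the set of points $x$ for which $\phi_\tau(x)$ converges to a point $\pi_+(x)\in\hat{\mathcal{E}}_+$ as $\tau\to+\infty$ (resp. to a point $\pi_-(x)\in\hat{\mathcal{E}}_-$ as $\tau\to-\infty$), and $\mathcal{H}=\mathcal{H}_+\cap\mathcal{H}_-$. For $p\in\hat{\mathcal{E}}_-$, $q\in\hat{\mathcal{E}}_+$ write $p\rightarrow q$ if there is $x\in\mathcal{H}$ with $\pi_-(x)=p$, $\pi_+(x)=q$. For $A,A'\in\hat{\mathbb{E}}$ write $A\rightarrow A'$ if $(-A/\|A\|,-\|A\|)\rightarrow(A'/\|A'\|,\|A'\|)$. *)

theory Defs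
  imports "HOL-Analysis.Analysis"
begin

text \<open>
  Scattering relation of the Newtonian \<open>n\<close>-body problem in \<open>\<real>\<^sup>d\<close> at positive energy.
  The bodies are indexed by a finite linearly ordered type \<open>'n\<close>, so that sums over \<open>i < j\<close>
  make sense, and \<open>n = CARD('n)\<close>, \<open>d = CARD('d)\<close>; \<open>m i\<close> is the mass of body \<open>i\<close>.
\<close>

type_synonym ('d, 'n) config = "(real, 'd) vec ^ 'n"

text \<open>States are quadruples \<open>(\<rho>, s, v, w)\<close>.\<close>

type_synonym ('d, 'n) state =
  "real \<times> ('d, 'n) config \<times> real \<times> ('d, 'n) config"

subsection \<open>Configurations\<close>

definition minner :: "('n::finite \<Rightarrow> real) \<Rightarrow> ('d::finite, 'n) config \<Rightarrow> ('d, 'n) config \<Rightarrow> real"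
  where "minner m v w = (\<Sum>i\<in>UNIV. m i * (v $ i \<bullet> w $ i))"

definition mnorm :: "('n::finite \<Rightarrow> real) \<Rightarrow> ('d::finite, 'n) config \<Rightarrow> real"
  where "mnorm m v = sqrt (minner m v v)"

definition EE :: "('n::finite \<Rightarrow> real) \<Rightarrow> ('d::finite, 'n) config set"
  where "EE m = {q. (\<Sum>i\<in>UNIV. m i *\<^sub>R q $ i) = 0}"

definition Coll :: "('d::finite, 'n::finite) config set"
  where "Coll = {q. \<exists>i j. i \<noteq> j \<and> q $ i = q $ j}"

definition Ehat :: "('n::finite \<Rightarrow> real) \<Rightarrow> ('d::finite, 'n) config set"
  where "Ehat m = EE m - Coll"

text \<open>The collision-free sphere of radius \<open>r\<close>; \<open>Shat m 1\<close> is the unit sphere without collisions.\<close>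

definition Shat :: "('n::finite \<Rightarrow> real) \<Rightarrow> real \<Rightarrow> ('d::finite, 'n) config set"
  where "Shat m r = {s \<in> Ehat m. mnorm m s = r}"

subsection \<open>Potential\<close>

definition pot :: "('n::{finite,linorder} \<Rightarrow> real) \<Rightarrow> ('d::finite, 'n) config \<Rightarrow> real"
  where "pot m q = (\<Sum>(i, j) | i < j. m i * m j / norm (q $ i - q $ j))"

text \<open>
  The gradient with respect to the mass inner product of the potential as a function on the
  Euclidean space \<open>EE m\<close>: the derivative is taken within \<open>EE m\<close>, which determines the
  representing vector uniquely once the vector is required to lie in \<open>EE m\<close>.
\<close>

definition grad_pot ::
    "('n::{finite,linorder} \<Rightarrow> real) \<Rightarrow> ('d::finite, 'n) config \<Rightarrow> ('d, 'n) config"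
  where "grad_pot m q =
    (THE g. g \<in> EE m \<and> (pot m has_derivative (\<lambda>u. minner m g u)) (at q within EE m))"

definition tgrad_pot ::
    "('n::{finite,linorder} \<Rightarrow> real) \<Rightarrow> ('d::finite, 'n) config \<Rightarrow> ('d, 'n) config"
  where "tgrad_pot m s = grad_pot m s + pot m s *\<^sub>R s"

subsection \<open>Extended phase space and flow\<close>

definition phase :: "('n::{finite,linorder} \<Rightarrow> real) \<Rightarrow> ('d::finite, 'n) state set"
  where "phase m = {(\<rho>, s, v, w).
    \<rho> \<ge> 0 \<and> s \<in> Shat m 1 \<and> w \<in> EE m \<and> minner m s w = 0 \<and>
    v\<^sup>2 / 2 + (mnorm m w)\<^sup>2 / 2 - \<rho> * pot m s > 0}"

fun vfield :: "('n::{finite,linorder} \<Rightarrow> real) \<Rightarrow> ('d::finite, 'n) state \<Rightarrow> ('d, 'n) state"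
  where "vfield m (\<rho>, s, v, w) =
    (- v * \<rho>,
     w,
     (mnorm m w)\<^sup>2 - \<rho> * pot m s,
     \<rho> *\<^sub>R tgrad_pot m s - v *\<^sub>R w - (mnorm m w)\<^sup>2 *\<^sub>R s)"

definition is_solution ::
    "('n::{finite,linorder} \<Rightarrow> real) \<Rightarrow> (real \<Rightarrow> ('d::finite, 'n) state) \<Rightarrow> real set \<Rightarrow> bool"
  where "is_solution m \<gamma> I \<longleftrightarrow>
    (\<forall>\<tau>\<in>I. \<gamma> \<tau> \<in> phase m \<and> (\<gamma> has_vector_derivative vfield m (\<gamma> \<tau>)) (at \<tau> within I))"

text \<open>
  The flow is only partially defined: \<open>flow_dom m x\<close> is the maximal interval of existence of the
  solution through \<open>x\<close>, and \<open>flow m \<tau> x\<close> is meaningful only for \<open>\<tau>\<close> in it. Note that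
  \<open>closed_segment 0 \<tau>\<close> is the interval between \<open>0\<close> and \<open>\<tau>\<close> for either sign of \<open>\<tau>\<close>.
\<close>

definition flow_dom ::
    "('n::{finite,linorder} \<Rightarrow> real) \<Rightarrow> ('d::finite, 'n) state \<Rightarrow> real set"
  where "flow_dom m x = {\<tau>. \<exists>\<gamma>. is_solution m \<gamma> (closed_segment 0 \<tau>) \<and> \<gamma> 0 = x}"

definition flow ::
    "('n::{finite,linorder} \<Rightarrow> real) \<Rightarrow> real \<Rightarrow> ('d::finite, 'n) state \<Rightarrow> ('d, 'n) state"
  where "flow m \<tau> x =
    (THE y. \<exists>\<gamma>. is_solution m \<gamma> (closed_segment 0 \<tau>) \<and> \<gamma> 0 = x \<and> \<gamma> \<tau> = y)"

subsection \<open>Equilibria at infinity and the scattering relation\<close>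

definition equil_plus :: "('n::finite \<Rightarrow> real) \<Rightarrow> ('d::finite, 'n) state set"
  where "equil_plus m = {(0, s, v, 0) | s v. s \<in> Shat m 1 \<and> v > 0}"

definition equil_minus :: "('n::finite \<Rightarrow> real) \<Rightarrow> ('d::finite, 'n) state set"
  where "equil_minus m = {(0, s, v, 0) | s v. s \<in> Shat m 1 \<and> v < 0}"

definition H_plus :: "('n::{finite,linorder} \<Rightarrow> real) \<Rightarrow> ('d::finite, 'n) state set"
  where "H_plus m = {x \<in> phase m. {0..} \<subseteq> flow_dom m x \<and>
    (\<exists>q\<in>equil_plus m. ((\<lambda>\<tau>. flow m \<tau> x) \<longlongrightarrow> q) at_top)}"

definition H_minus :: "('n::{finite,linorder} \<Rightarrow> real) \<Rightarrow> ('d::finite, 'n) state set"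
  where "H_minus m = {x \<in> phase m. {..0} \<subseteq> flow_dom m x \<and>
    (\<exists>p\<in>equil_minus m. ((\<lambda>\<tau>. flow m \<tau> x) \<longlongrightarrow> p) at_bot)}"

definition pi_plus ::
    "('n::{finite,linorder} \<Rightarrow> real) \<Rightarrow> ('d::finite, 'n) state \<Rightarrow> ('d, 'n) state"
  where "pi_plus m x = Lim at_top (\<lambda>\<tau>. flow m \<tau> x)"

definition pi_minus ::
    "('n::{finite,linorder} \<Rightarrow> real) \<Rightarrow> ('d::finite, 'n) state \<Rightarrow> ('d, 'n) state"
  where "pi_minus m x = Lim at_bot (\<lambda>\<tau>. flow m \<tau> x)"

definition connects ::
    "('n::{finite,linorder} \<Rightarrow> real) \<Rightarrow> ('d::finite, 'n) state \<Rightarrow> ('d, 'n) state \<Rightarrow> bool"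
  where "connects m p q \<longleftrightarrow> (\<exists>x \<in> H_plus m \<inter> H_minus m. pi_minus m x = p \<and> pi_plus m x = q)"

definition scatters ::
    "('n::{finite,linorder} \<Rightarrow> real) \<Rightarrow> ('d::finite, 'n) config \<Rightarrow> ('d, 'n) config \<Rightarrow> bool"
  where "scatters m A A' \<longleftrightarrow>
    connects m (0, - (A /\<^sub>R mnorm m A), - mnorm m A, 0) (0, A' /\<^sub>R mnorm m A', mnorm m A', 0)"

definition HS ::
    "('n::{finite,linorder} \<Rightarrow> real) \<Rightarrow> ('d::finite, 'n) config \<Rightarrow> ('d, 'n) config set"
  where "HS m A = {A' \<in> Ehat m. scatters m A A'}"

subsection \<open>Diagonal rotations and planar configurations\<close>

definition rotate_config :: "real ^ 'd ^ 'd \<Rightarrow> ('d::finite, 'n::finite) config \<Rightarrow> ('d, 'n) config"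
  where "rotate_config R A = (\<chi> i. R *v (A $ i))"

definition planar_noncollinear :: "('d::finite, 'n::finite) config \<Rightarrow> bool"
  where "planar_noncollinear A \<longleftrightarrow>
    coplanar (range (\<lambda>i. A $ i)) \<and> \<not> collinear (range (\<lambda>i. A $ i))"

end

theory Submission
  imports Defs
begin

text \<open>
  The algebraic parts of the theorem are symmetries of the blown-up vector field. Time reversal
  \<open>(\<rho>, s, v, w) \<mapsto> (\<rho>, s, - v, - w)\<close>, the dilation \<open>(k\<^sup>2
  \<rho>, s, k v, k w)\<close> with time rescaled by \<open>k\<close>, and rotations all map
  solutions to solutions, and conservation of the energy forces the two asymptotic speeds to agree.
  Reversibility is time reversal composed with the rotation \<open>- 1\<close>. Since the flow is
  given by a description operator, all of this is first translated into statements about global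
  solution curves (\<open>connects_iff\<close>, \<open>scatters_iff\<close>), which needs uniqueness
  of solutions (\<open>is_solution_unique\<close>).

  Both remaining parts come from one bridge, \<open>newton_scatters\<close>: if \<open>q'' =
  \<epsilon> \<nabla>U(q)\<close> with \<open>\<epsilon> \<ge> 0\<close>, and the collision-free
  motion \<open>q\<close> of positive energy has asymptotic velocities \<open>A\<close> and
  \<open>A'\<close>, then \<open>A\<close> scatters to \<open>A'\<close>. Here \<open>\<rho> =
  \<epsilon> / \<parallel>q\<parallel>\<close>, so that \<open>\<epsilon> = 0\<close> covers the
  orbits inside infinity. Reflexivity is the case of the straight line \<open>t A + B\<close> whose
  offset \<open>B\<close> avoids all collisions.

  For openness, \<open>\<epsilon>\<close> is a small parameter: it is the inverse of the size of the
  impact parameter. An orbit with incoming velocity \<open>A\<close> and position \<open>B\<close>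
  at time \<open>0\<close> leaves with velocity \<open>A + \<epsilon> G(B) +
  O(\<epsilon>\<^sup>2)\<close>, where \<open>G(B)\<close> is the integral of the force along the
  line, that is, the gradient of the function that assigns to \<open>B\<close> the regularised
  integral of \<open>U\<close> along \<open>t A + B\<close>. The orbit is constructed by a
  contraction on the space of bounded continuous velocity corrections
  (\<open>perturbed_orbits\<close>), which gives a uniform \<open>O(\<epsilon>)\<close> bound on the
  error and continuity in \<open>B\<close>. If the derivative of \<open>G\<close> at one offset
  \<open>B\<close> is invertible on the orthogonal complement of \<open>A\<close>, Brouwer's theorem
  shows that the outgoing velocities cover a ball of radius proportional to
  \<open>\<epsilon>\<close>, for every small \<open>\<epsilon>\<close>
  (\<open>scattering_near_free_line\<close>). The union of these balls over
  \<open>\<epsilon>\<close> is the open set that has \<open>A\<close> in its closure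
  (\<open>scattering_image_open\<close>).

  It remains to find offsets at which the derivative is invertible. The integral is explicit: a pair
  with relative velocity \<open>a\<close> and relative offset \<open>b\<close> contributes \<open>2
  b\<^sup>\<bottom> / (\<bar>a\<bar> \<bar>b\<^sup>\<bottom>\<bar>\<^sup>2)\<close>, the gradient of
  a logarithm. Invertibility is an open condition (\<open>scattering_regular_open\<close>). For a
  planar \<open>A\<close> that is not collinear, let \<open>B\<close> be \<open>A\<close> turned by
  a right angle in its plane; testing the derivative against the reflection in the plane turns it
  into a sum of squares (\<open>planar_scattering_regular\<close>). For a dense set of
  \<open>A\<close>, let \<open>B\<close> nearly collide all bodies with one root body; the nearly
  colliding pairs control the components transverse to the relative velocities, and the other pairs
  are definite on what is left (\<open>star_scattering_regular\<close>).
\<close>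

section \<open>The Newtonian force as the mass gradient of the potential\<close>

definition kern :: "'a::real_inner \<Rightarrow> 'a"
  where "kern x = x /\<^sub>R norm x ^ 3"

text \<open>
  The derivative of the potential restricted to \<open>EE m\<close>, in closed form. The summand
  \<open>j = i\<close> vanishes because \<open>kern 0 = 0\<close>.
\<close>

definition force :: "('n::finite \<Rightarrow> real) \<Rightarrow> ('d::finite, 'n) config \<Rightarrow> ('d, 'n) config"
  where "force m q = (\<chi> i. \<Sum>j\<in>UNIV. m j *\<^sub>R kern (q $ j - q $ i))"

lemma kern_zero [simp]: "kern 0 = 0"
  by (simp add: kern_def)

lemma kern_minus: "kern (- x) = - kern x"
  by (simp add: kern_def)

lemma kern_scaleR: "c > 0 \<Longrightarrow> kern (c *\<^sub>R x) = kern x /\<^sub>R c\<^sup>2"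
  by (simp add: kern_def power3_eq_cube power2_eq_square field_simps)

lemma norm_kern_le:
  assumes "d > 0" "norm x \<ge> d"
  shows "norm (kern x) \<le> 1 / d\<^sup>2"
proof -
  have "norm (kern x) = 1 / (norm x)\<^sup>2"
    using assms by (simp add: kern_def power3_eq_cube power2_eq_square field_simps)
  also have "\<dots> \<le> 1 / d\<^sup>2"
    using assms by (intro divide_left_mono power_mono mult_pos_pos) auto
  finally show ?thesis .
qed

text \<open>
  Only the norms of the two points enter, not the segment between them, so the bound can be applied
  to two curves that are each only known to stay away from collisions.
\<close>

lemma kern_lipschitz:
  assumes d: "d > 0" and x: "norm x \<ge> d" and y: "norm y \<ge> d"
  shows "norm (kern x - kern y) \<le> 4 / d ^ 3 * norm (x - y)"
proof -
  define a b where "a = norm x" and "b = norm y"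
  have pos: "a > 0" "b > 0" and ad: "a \<ge> d" "b \<ge> d" using assms by (auto simp: a_def b_def)
  have ab: "\<bar>a - b\<bar> \<le> norm (x - y)" unfolding a_def b_def by (rule norm_triangle_ineq3)
  have "kern x - kern y = (x - y) /\<^sub>R a ^ 3 + (inverse (a ^ 3) - inverse (b ^ 3)) *\<^sub>R y"
    by (simp add: kern_def a_def b_def algebra_simps)
  then have "norm (kern x - kern y) \<le> norm (x - y) / a ^ 3 + \<bar>inverse (a ^ 3) - inverse (b ^ 3)\<bar> * b"
    using pos by (metis (no_types, lifting) abs_inverse abs_of_pos b_def divide_inverse mult.commute norm_scaleR
        norm_triangle_ineq zero_less_power)
  also have "\<bar>inverse (a ^ 3) - inverse (b ^ 3)\<bar> * b = \<bar>b - a\<bar> * (1 / (a * b\<^sup>2) + 1 / (a\<^sup>2 * b) + 1 / a ^ 3)"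
  proof -
    have "inverse (a ^ 3) - inverse (b ^ 3) = (b - a) * (a\<^sup>2 + a * b + b\<^sup>2) / (a ^ 3 * b ^ 3)"
      using pos by (simp add: field_simps power3_eq_cube power2_eq_square)
    then have "\<bar>inverse (a ^ 3) - inverse (b ^ 3)\<bar> = \<bar>b - a\<bar> * ((a\<^sup>2 + a * b + b\<^sup>2) / (a ^ 3 * b ^ 3))"
      using pos by (simp add: abs_mult)
    then show ?thesis
      using pos by (simp add: field_simps power3_eq_cube power2_eq_square)
  qed
  also have "\<dots> \<le> norm (x - y) * (1 / d ^ 3 + 1 / d ^ 3 + 1 / d ^ 3)"
  proof (intro mult_mono add_mono)
    have "d * d\<^sup>2 \<le> a * b\<^sup>2" "d\<^sup>2 * d \<le> a\<^sup>2 * b" "d ^ 3 \<le> a ^ 3"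
      using ad d by (intro mult_mono power_mono; simp)+
    then show "1 / (a * b\<^sup>2) \<le> 1 / d ^ 3" "1 / (a\<^sup>2 * b) \<le> 1 / d ^ 3" "1 / a ^ 3 \<le> 1 / d ^ 3"
      using pos d by (auto intro!: divide_left_mono simp: power3_eq_cube power2_eq_square mult.assoc)
  qed (use ab pos in auto)
  also have "norm (x - y) / a ^ 3 \<le> norm (x - y) / d ^ 3"
    using ad d by (intro divide_left_mono power_mono) auto
  finally show ?thesis by (simp add: algebra_simps)
qed

lemma continuous_on_kern [continuous_intros]:
  assumes "continuous_on S f" "\<And>x. x \<in> S \<Longrightarrow> f x \<noteq> 0"
  shows "continuous_on S (\<lambda>x. kern (f x))"
  unfolding kern_def using assms by (intro continuous_intros) auto

text \<open>
  Passes between sums over ordered pairs, in which the equations of motion are written, and the sum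
  over \<open>i < j\<close> that defines the potential.
\<close>

lemma sum_swap_pairs:
  fixes F :: "'n::{finite,linorder} \<Rightarrow> 'n \<Rightarrow> 'a::comm_monoid_add"
  assumes "\<And>i. F i i = 0"
  shows "(\<Sum>i\<in>UNIV. \<Sum>j\<in>UNIV. F i j) = (\<Sum>(i, j) | i < j. F i j + F j i)"
proof -
  let ?L = "{p::'n \<times> 'n. fst p < snd p}" and ?G = "{p::'n \<times> 'n. snd p < fst p}"
    and ?D = "{p::'n \<times> 'n. fst p = snd p}"
  have "(\<Sum>i\<in>UNIV. \<Sum>j\<in>UNIV. F i j) = (\<Sum>p\<in>UNIV. F (fst p) (snd p))"
    by (simp add: sum.cartesian_product case_prod_beta)
  also have "UNIV = (?L \<union> ?G) \<union> ?D" by force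
  also have "(\<Sum>p\<in>\<dots>. F (fst p) (snd p)) = (\<Sum>p\<in>?L \<union> ?G. F (fst p) (snd p)) + (\<Sum>p\<in>?D. F (fst p) (snd p))"
    by (rule sum.union_disjoint) auto
  also have "(\<Sum>p\<in>?D. F (fst p) (snd p)) = 0"
    using assms by (intro sum.neutral) auto
  also have "(\<Sum>p\<in>?L \<union> ?G. F (fst p) (snd p)) = (\<Sum>p\<in>?L. F (fst p) (snd p)) + (\<Sum>p\<in>?G. F (fst p) (snd p))"
    by (rule sum.union_disjoint) auto
  also have "(\<Sum>p\<in>?G. F (fst p) (snd p)) = (\<Sum>p\<in>?L. F (snd p) (fst p))"
    by (rule sum.reindex_bij_witness[where i = prod.swap and j = prod.swap]) auto
  also have "?L = {(i, j). i < j}" by auto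
  finally show ?thesis
    by (simp add: sum.distrib case_prod_beta)
qed

lemma bounded_bilinear_minner:
  "bounded_bilinear (minner m :: ('d::finite, 'n::finite) config \<Rightarrow> _)"
  unfolding bilinear_conv_bounded_bilinear [symmetric] bilinear_def
  by (auto simp: linear_iff minner_def inner_simps sum.distrib algebra_simps sum_distrib_left)

interpretation minner: bounded_bilinear "minner m :: ('d::finite, 'n::finite) config \<Rightarrow> _"
  for m by (rule bounded_bilinear_minner)

lemma minner_commute: "minner m v w = minner m w v"
  by (simp add: minner_def inner_commute)

lemma subspace_EE: "subspace (EE m)"
proof -
  have lin: "linear (\<lambda>q. \<Sum>i\<in>UNIV. m i *\<^sub>R q $ i)"
    by (auto intro!: linearI simp: algebra_simps sum.distrib scaleR_sum_right)
  show ?thesis using linear_subspace_kernel[OF lin] by (simp add: EE_def)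
qed

lemma EE_closed:
  "v \<in> EE m \<Longrightarrow> w \<in> EE m \<Longrightarrow> v + w \<in> EE m"
  "v \<in> EE m \<Longrightarrow> w \<in> EE m \<Longrightarrow> v - w \<in> EE m"
  "v \<in> EE m \<Longrightarrow> c *\<^sub>R v \<in> EE m"
  "v \<in> EE m \<Longrightarrow> - v \<in> EE m"
  using subspace_add[OF subspace_EE] subspace_diff[OF subspace_EE] subspace_scale[OF subspace_EE]
    subspace_neg[OF subspace_EE] by blast+

lemma minner_force:
  fixes q :: "('d::finite, 'n::{finite,linorder}) config"
  shows
  "minner m (force m q) u = (\<Sum>(i, j) | i < j. - (m i * m j * (kern (q $ i - q $ j) \<bullet> (u $ i - u $ j))))"
proof -
  have "minner m (force m q) u = (\<Sum>i\<in>UNIV. \<Sum>j\<in>UNIV. m i * m j * (kern (q $ j - q $ i) \<bullet> u $ i))"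
    by (simp add: minner_def force_def inner_sum_left sum_distrib_left mult.assoc)
  also have "\<dots> = (\<Sum>(i, j) | i < j. m i * m j * (kern (q $ j - q $ i) \<bullet> u $ i)
      + m j * m i * (kern (q $ i - q $ j) \<bullet> u $ j))"
    using sum_swap_pairs[of "\<lambda>i j. m i * m j * (kern (q $ j - q $ i) \<bullet> u $ i)"] by simp
  also have "\<dots> = (\<Sum>(i, j) | i < j. - (m i * m j * (kern (q $ i - q $ j) \<bullet> (u $ i - u $ j))))"
  proof (intro sum.cong refl, clarify)
    fix i j
    have "kern (q $ j - q $ i) = - kern (q $ i - q $ j)"
      by (metis kern_minus minus_diff_eq)
    then show "m i * m j * (kern (q $ j - q $ i) \<bullet> u $ i) + m j * m i * (kern (q $ i - q $ j) \<bullet> u $ j)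
        = - (m i * m j * (kern (q $ i - q $ j) \<bullet> (u $ i - u $ j)))"
      by (simp add: inner_diff_right algebra_simps)
  qed
  finally show ?thesis .
qed

text \<open>
  The common form of the force, of the first-order deflection and of its derivative: each is a sum
  over pairs of a kernel that changes sign when the two bodies are exchanged. Such sums are
  orthogonal to translations, and they can be tested against a configuration \<open>D\<close>
  through the differences \<open>D $ j - D $ i\<close> alone.
\<close>

definition pair_sum :: "('n::finite \<Rightarrow> real) \<Rightarrow> ('n \<Rightarrow> 'n \<Rightarrow> real ^ 'd::finite) \<Rightarrow> ('d, 'n) config"
  where "pair_sum m f = (\<chi> i. \<Sum>j\<in>UNIV. m j *\<^sub>R f i j)"

lemma pair_sum_0 [simp]: "pair_sum m (\<lambda>i j. 0) = 0"
  by (simp add: pair_sum_def vec_eq_iff)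

lemma force_eq_pair_sum: "force m q = pair_sum m (\<lambda>i j. kern (q $ j - q $ i))"
  by (simp add: force_def pair_sum_def)

lemma minner_pair_sum:
  assumes anti: "\<And>i j. f j i = - f i j"
  shows "2 * minner m D (pair_sum m f) = - (\<Sum>i\<in>UNIV. \<Sum>j\<in>UNIV. m i * m j * ((D $ j - D $ i) \<bullet> f i j))"
proof -
  have 1: "minner m D (pair_sum m f) = (\<Sum>i\<in>UNIV. \<Sum>j\<in>UNIV. m i * m j * (D $ i \<bullet> f i j))"
    by (simp add: minner_def pair_sum_def inner_sum_right sum_distrib_left mult.assoc)
  also have "\<dots> = (\<Sum>i\<in>UNIV. \<Sum>j\<in>UNIV. m j * m i * (D $ j \<bullet> f j i))" by (rule sum.swap)
  also have "\<dots> = (\<Sum>i\<in>UNIV. \<Sum>j\<in>UNIV. - (m i * m j * (D $ j \<bullet> f i j)))"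
    by (intro sum.cong refl, subst anti) (simp add: mult.commute)
  finally have 2: "minner m D (pair_sum m f) = \<dots>" .
  have "2 * minner m D (pair_sum m f) = (\<Sum>i\<in>UNIV. \<Sum>j\<in>UNIV. m i * m j * (D $ i \<bullet> f i j))
     + (\<Sum>i\<in>UNIV. \<Sum>j\<in>UNIV. - (m i * m j * (D $ j \<bullet> f i j)))"
    using 1 2 by simp
  also have "\<dots> = (\<Sum>i\<in>UNIV. \<Sum>j\<in>UNIV. - (m i * m j * ((D $ j - D $ i) \<bullet> f i j)))"
    unfolding sum.distrib [symmetric] by (intro sum.cong refl) (simp add: inner_diff_left algebra_simps)
  finally show ?thesis by (simp add: sum_negf)
qed

text \<open>
  Action equals reaction: test against the constant configurations, whose differences vanish.
\<close>

lemma pair_sum_in_EE: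
  fixes f :: "'n::finite \<Rightarrow> 'n \<Rightarrow> real ^ 'd::finite"
  assumes anti: "\<And>i j. f j i = - f i j"
  shows "pair_sum m f \<in> EE m"
proof -
  let ?S = "\<Sum>i\<in>UNIV. m i *\<^sub>R pair_sum m f $ i"
  have "?S \<bullet> x = 0" for x
  proof -
    have "?S \<bullet> x = minner m (\<chi> i. x) (pair_sum m f)"
      by (simp add: minner_def inner_sum_left) (simp add: inner_commute)
    also have "\<dots> = 0" using minner_pair_sum[of f m "\<chi> i. x", OF anti] by simp
    finally show ?thesis .
  qed
  from this[of ?S] show ?thesis by (simp add: EE_def)
qed

lemma force_in_EE: "force m q \<in> EE m"
proof -
  have "kern (q $ i - q $ j) = - kern (q $ j - q $ i)" for i j
    by (metis kern_minus minus_diff_eq)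
  then show ?thesis unfolding force_eq_pair_sum by (intro pair_sum_in_EE)
qed

lemma has_derivative_inverse_norm:
  fixes x :: "'a::real_inner"
  assumes "x \<noteq> 0"
  shows "((\<lambda>x. inverse (norm x)) has_derivative (\<lambda>h. - (kern x \<bullet> h))) (at x within S)"
proof -
  have "((\<lambda>x. inverse (norm x)) has_derivative (\<lambda>h. - (inverse (norm x) * (h \<bullet> sgn x) * inverse (norm x)))) (at x within S)"
    using assms by (auto intro!: derivative_eq_intros has_derivative_at_withinI[OF has_derivative_norm] simp: inner_commute)
  also have "(\<lambda>h. - (inverse (norm x) * (h \<bullet> sgn x) * inverse (norm x))) = (\<lambda>h. - (kern x \<bullet> h))"
    using assms by (simp add: sgn_div_norm kern_def power3_eq_cube inner_commute mult_ac)
  finally show ?thesis .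
qed

lemma pot_has_derivative:
  fixes q :: "('d::finite, 'n::{finite,linorder}) config"
  assumes "q \<notin> Coll"
  shows "(pot m has_derivative minner m (force m q)) (at q within S)"
proof -
  have ne: "q $ i - q $ j \<noteq> 0" if "i \<noteq> j" for i j
    using assms that by (auto simp: Coll_def)
  have "((\<lambda>q. \<Sum>(i, j) | i < j. m i * m j * inverse (norm (q $ i - q $ j))) has_derivative
     (\<lambda>u. \<Sum>(i, j) | i < j. - (m i * m j * (kern (q $ i - q $ j) \<bullet> (u $ i - u $ j))))) (at q within S)"
    unfolding case_prod_beta
  proof (intro has_derivative_sum)
    fix p :: "'n \<times> 'n" assume "p \<in> {p. fst p < snd p}"
    then have nz: "q $ fst p - q $ snd p \<noteq> 0" using ne by auto
    have "((\<lambda>q. q $ fst p - q $ snd p) has_derivative (\<lambda>u. u $ fst p - u $ snd p)) (at q within S)"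
      by (intro derivative_intros bounded_linear_imp_has_derivative bounded_linear_vec_nth)
    from has_derivative_compose[OF this has_derivative_inverse_norm[OF nz, of UNIV]]
    have "((\<lambda>q. inverse (norm (q $ fst p - q $ snd p))) has_derivative
       (\<lambda>u. - (kern (q $ fst p - q $ snd p) \<bullet> (u $ fst p - u $ snd p)))) (at q within S)"
      by simp
    from has_derivative_mult_right[OF this, of "m (fst p) * m (snd p)"]
    show "((\<lambda>q. m (fst p) * m (snd p) * inverse (norm (q $ fst p - q $ snd p))) has_derivative
       (\<lambda>u. - (m (fst p) * m (snd p) * (kern (q $ fst p - q $ snd p) \<bullet> (u $ fst p - u $ snd p)))))
       (at q within S)" by simp
  qed
  then show ?thesis
    unfolding minner_force pot_def[abs_def] divide_inverse by (simp add: case_prod_beta)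
qed

lemma two_elements:
  assumes "CARD('a::finite) \<ge> 2" shows "\<exists>x y :: 'a. x \<noteq> y"
proof (rule ccontr)
  assume "\<not> ?thesis"
  then have "CARD('a) \<le> Suc 0" by (simp add: card_le_Suc0_iff_eq)
  with assms show False by simp
qed

locale masses =
  fixes m :: "'n::{finite,linorder} \<Rightarrow> real"
  assumes mass_pos: "m i > 0"
    and two_bodies: "CARD('n) \<ge> 2"
begin

lemma minner_nonneg: "minner m v v \<ge> 0"
  by (simp add: minner_def sum_nonneg mass_pos less_imp_le)

lemma minner_eq_0_iff [simp]: "minner m v v = 0 \<longleftrightarrow> v = 0"
proof
  assume "minner m v v = 0"
  then have "\<forall>i. m i * (v $ i \<bullet> v $ i) = 0"
    unfolding minner_def by (subst (asm) sum_nonneg_eq_0_iff) (auto simp: mass_pos less_imp_le)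
  then show "v = 0" using mass_pos by (auto simp: vec_eq_iff) (metis less_irrefl)
qed (simp add: minner.zero_left)

lemma minner_pos: "v \<noteq> 0 \<Longrightarrow> minner m v v > 0"
  using minner_nonneg[of v] minner_eq_0_iff[of v] by linarith

lemma mnorm_pos_iff [simp]: "mnorm m v > 0 \<longleftrightarrow> v \<noteq> 0"
  using minner_pos[of v] by (auto simp: mnorm_def minner.zero_left)

lemma mnorm_nonneg [simp]: "mnorm m v \<ge> 0"
  by (simp add: mnorm_def minner_nonneg)

lemma mnorm_eq_0_iff [simp]: "mnorm m v = 0 \<longleftrightarrow> v = 0"
  by (simp add: mnorm_def)

lemma mnorm_sq: "(mnorm m v)\<^sup>2 = minner m v v"
  by (simp add: mnorm_def minner_nonneg)

lemma mnorm_scaleR: "mnorm m (c *\<^sub>R v) = \<bar>c\<bar> * mnorm m v"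
  by (simp add: mnorm_def minner.scaleR_left minner.scaleR_right real_sqrt_mult
      flip: mult.assoc power2_eq_square)

lemma mnorm_minus [simp]: "mnorm m (- v) = mnorm m v"
  using mnorm_scaleR[of "-1" v] by simp

text \<open>
  Uniqueness of the gradient: if \<open>g\<close> also represents the derivative, restrict to the
  line through \<open>q\<close> in the direction \<open>g - force m q\<close>, which stays in
  \<open>EE m\<close>.
\<close>

lemma grad_pot_eq_force:
  assumes q: "q \<in> Ehat m"
  shows "grad_pot m q = force m q"
  unfolding grad_pot_def
proof (rule the_equality)
  show "force m q \<in> EE m \<and> (pot m has_derivative minner m (force m q)) (at q within EE m)"
    using q by (auto simp: force_in_EE Ehat_def intro: pot_has_derivative)
next
  fix g assume g: "g \<in> EE m \<and> (pot m has_derivative minner m g) (at q within EE m)"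
  define u where "u = g - force m q"
  have u: "u \<in> EE m" and qE: "q \<in> EE m" using g q by (auto simp: u_def EE_closed force_in_EE Ehat_def)
  have img: "(\<lambda>t. q + t *\<^sub>R u) ` UNIV \<subseteq> EE m" using u qE by (auto intro: EE_closed)
  have line: "((\<lambda>t. q + t *\<^sub>R u) has_derivative (\<lambda>t. t *\<^sub>R u)) (at 0)"
    by (auto intro!: derivative_eq_intros)
  have "((\<lambda>t. pot m (q + t *\<^sub>R u)) has_derivative (\<lambda>t. minner m h (t *\<^sub>R u))) (at 0)"
    if h: "(pot m has_derivative minner m h) (at q within EE m)" for h
  proof -
    have "(pot m has_derivative minner m h) (at (q + 0 *\<^sub>R u) within range (\<lambda>t. q + t *\<^sub>R u))"
      using has_derivative_subset[OF h img] by simp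
    from diff_chain_within[OF line this] show ?thesis by (simp add: o_def)
  qed
  then have "(\<lambda>t. minner m g (t *\<^sub>R u)) = (\<lambda>t. minner m (force m q) (t *\<^sub>R u))"
    using g q pot_has_derivative[of q m "EE m"] by (intro has_derivative_unique) (auto simp: Ehat_def)
  then have "minner m g u = minner m (force m q) u" by (metis scaleR_one)
  then have "minner m u u = 0" by (simp add: u_def minner.diff_left)
  then show "g = force m q" by (simp add: u_def)
qed

end

section \<open>Uniqueness of solutions and the flow\<close>

text \<open>
  Boundedness is part of the notion to make it stable under products, so that the vector field can
  be treated by following its syntax.
\<close>

definition bdd_lip_on :: "'a::metric_space set \<Rightarrow> ('a \<Rightarrow> 'b::real_normed_vector) \<Rightarrow> bool"
  where "bdd_lip_on K f \<longleftrightarrow> (\<exists>M\<ge>0. \<exists>L\<ge>0. \<forall>x\<in>K. norm (f x) \<le> M \<and> (\<forall>y\<in>K. norm (f x - f y) \<le> L * dist x y))"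

lemma bdd_lip_onI:
  assumes "M \<ge> 0" "L \<ge> 0" "\<And>x. x \<in> K \<Longrightarrow> norm (f x) \<le> M"
    "\<And>x y. x \<in> K \<Longrightarrow> y \<in> K \<Longrightarrow> norm (f x - f y) \<le> L * dist x y"
  shows "bdd_lip_on K f"
  using assms unfolding bdd_lip_on_def by blast

lemma bdd_lip_onE:
  assumes "bdd_lip_on K f"
  obtains M L where "M \<ge> 0" "L \<ge> 0" "\<And>x. x \<in> K \<Longrightarrow> norm (f x) \<le> M"
    "\<And>x y. x \<in> K \<Longrightarrow> y \<in> K \<Longrightarrow> norm (f x - f y) \<le> L * dist x y"
  using assms unfolding bdd_lip_on_def by blast

lemma bdd_lip_on_cong: "(\<And>x. x \<in> K \<Longrightarrow> f x = g x) \<Longrightarrow> bdd_lip_on K f \<longleftrightarrow> bdd_lip_on K g"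
  unfolding bdd_lip_on_def by (auto cong: ball_cong)

lemma bdd_lip_on_linear:
  fixes f :: "'a::real_normed_vector \<Rightarrow> 'b::real_normed_vector"
  assumes "bounded K" "bounded_linear f"
  shows "bdd_lip_on K f"
proof -
  obtain R where R: "\<And>x. x \<in> K \<Longrightarrow> norm x \<le> R" using assms(1) bounded_iff by blast
  interpret bounded_linear f by fact
  obtain L where L: "L > 0" "\<And>x. norm (f x) \<le> norm x * L" using pos_bounded by blast
  show ?thesis
  proof (rule bdd_lip_onI[of "\<bar>R\<bar> * L" L])
    fix x assume "x \<in> K"
    then have "norm x * L \<le> \<bar>R\<bar> * L" using R[of x] L(1) by (intro mult_right_mono) auto
    then show "norm (f x) \<le> \<bar>R\<bar> * L" using L(2)[of x] by linarith
  next
    fix x y show "norm (f x - f y) \<le> L * dist x y"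
      using L(2)[of "x - y"] by (simp add: diff dist_norm mult.commute)
  qed (use L in auto)
qed

lemma bdd_lip_on_add:
  assumes "bdd_lip_on K f" "bdd_lip_on K g"
  shows "bdd_lip_on K (\<lambda>x. f x + g x)"
proof -
  obtain M L where f: "M \<ge> 0" "L \<ge> 0" "\<And>x. x \<in> K \<Longrightarrow> norm (f x) \<le> M"
    "\<And>x y. x \<in> K \<Longrightarrow> y \<in> K \<Longrightarrow> norm (f x - f y) \<le> L * dist x y" using assms(1) bdd_lip_onE by blast
  obtain M' L' where g: "M' \<ge> 0" "L' \<ge> 0" "\<And>x. x \<in> K \<Longrightarrow> norm (g x) \<le> M'"
    "\<And>x y. x \<in> K \<Longrightarrow> y \<in> K \<Longrightarrow> norm (g x - g y) \<le> L' * dist x y" using assms(2) bdd_lip_onE by blast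
  show ?thesis
  proof (rule bdd_lip_onI[of "M + M'" "L + L'"])
    fix x assume "x \<in> K" then show "norm (f x + g x) \<le> M + M'"
      using f(3)[of x] g(3)[of x] norm_triangle_mono by blast
  next
    fix x y assume "x \<in> K" "y \<in> K"
    have "f x + g x - (f y + g y) = (f x - f y) + (g x - g y)" by simp
    also have "norm \<dots> \<le> L * dist x y + L' * dist x y"
      using f(4) g(4) \<open>x \<in> K\<close> \<open>y \<in> K\<close> by (intro norm_triangle_mono) auto
    finally show "norm (f x + g x - (f y + g y)) \<le> (L + L') * dist x y" by (simp add: algebra_simps)
  qed (use f g in auto)
qed

lemma bdd_lip_on_const: "bdd_lip_on K (\<lambda>x. c)"
  by (rule bdd_lip_onI[of "norm c" 0]) auto

lemma bdd_lip_on_minus: "bdd_lip_on K f \<Longrightarrow> bdd_lip_on K (\<lambda>x. - f x)"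
  unfolding bdd_lip_on_def by (simp add: norm_minus_commute)

lemma bdd_lip_on_diff: "bdd_lip_on K f \<Longrightarrow> bdd_lip_on K g \<Longrightarrow> bdd_lip_on K (\<lambda>x. f x - g x)"
  using bdd_lip_on_add[OF _ bdd_lip_on_minus] by fastforce

lemma bdd_lip_on_sum: "(\<And>i. i \<in> I \<Longrightarrow> bdd_lip_on K (f i)) \<Longrightarrow> bdd_lip_on K (\<lambda>x. \<Sum>i\<in>I. f i x)"
  by (induction I rule: infinite_finite_induct) (auto intro: bdd_lip_on_add bdd_lip_on_const)

lemma bdd_lip_on_bilinear:
  assumes "bounded_bilinear p" "bdd_lip_on K f" "bdd_lip_on K g"
  shows "bdd_lip_on K (\<lambda>x. p (f x) (g x))"
proof -
  obtain M L where f: "M \<ge> 0" "L \<ge> 0" "\<And>x. x \<in> K \<Longrightarrow> norm (f x) \<le> M"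
    "\<And>x y. x \<in> K \<Longrightarrow> y \<in> K \<Longrightarrow> norm (f x - f y) \<le> L * dist x y" using assms(2) bdd_lip_onE by blast
  obtain M' L' where g: "M' \<ge> 0" "L' \<ge> 0" "\<And>x. x \<in> K \<Longrightarrow> norm (g x) \<le> M'"
    "\<And>x y. x \<in> K \<Longrightarrow> y \<in> K \<Longrightarrow> norm (g x - g y) \<le> L' * dist x y" using assms(3) bdd_lip_onE by blast
  interpret p: bounded_bilinear p by fact
  obtain C where C: "C > 0" "\<And>a b. norm (p a b) \<le> norm a * norm b * C" using p.pos_bounded by blast
  have bound: "norm (p a b) \<le> A * B * C" if "norm a \<le> A" "norm b \<le> B" for a b A B
  proof -
    have "norm a * norm b * C \<le> A * B * C"
      using that C(1) norm_ge_zero[of a] norm_ge_zero[of b]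
      by (intro mult_right_mono mult_mono) linarith+
    with C(2)[of a b] show ?thesis by linarith
  qed
  show ?thesis
  proof (rule bdd_lip_onI[of "M * M' * C" "(L * M' + M * L') * C"])
    fix x assume "x \<in> K" then show "norm (p (f x) (g x)) \<le> M * M' * C"
      using f(3) g(3) by (intro bound) auto
  next
    fix x y assume xy: "x \<in> K" "y \<in> K"
    have "p (f x) (g x) - p (f y) (g y) = p (f x - f y) (g x) + p (f y) (g x - g y)"
      by (simp add: p.diff_left p.diff_right)
    also have "norm \<dots> \<le> (L * dist x y) * M' * C + M * (L' * dist x y) * C"
      using f(3,4) g(3,4) xy by (intro norm_triangle_mono bound) auto
    finally show "norm (p (f x) (g x) - p (f y) (g y)) \<le> (L * M' + M * L') * C * dist x y"
      by (simp add: algebra_simps)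
  qed (use f g C in auto)
qed

lemma bdd_lip_on_Pair:
  assumes "bdd_lip_on K f" "bdd_lip_on K g"
  shows "bdd_lip_on K (\<lambda>x. (f x, g x))"
proof -
  have "bdd_lip_on K (\<lambda>x. (f x, 0) + (0, g x))"
    using assms unfolding bdd_lip_on_def by (intro bdd_lip_on_add[unfolded bdd_lip_on_def]) (simp_all add: norm_Pair)
  then show ?thesis by simp
qed

lemma bdd_lip_on_vec:
  fixes f :: "'i::finite \<Rightarrow> 'a::metric_space \<Rightarrow> 'b::real_normed_vector"
  assumes "\<And>i. bdd_lip_on K (f i)"
  shows "bdd_lip_on K (\<lambda>x. \<chi> i. f i x)"
proof -
  have "\<forall>i. \<exists>M L. M \<ge> 0 \<and> L \<ge> 0 \<and> (\<forall>x\<in>K. norm (f i x) \<le> M \<and> (\<forall>y\<in>K. norm (f i x - f i y) \<le> L * dist x y))"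
    using assms unfolding bdd_lip_on_def by blast
  then obtain M L where bnd: "\<And>i. M i \<ge> 0" "\<And>i. L i \<ge> 0" "\<And>i x. x \<in> K \<Longrightarrow> norm (f i x) \<le> M i"
    "\<And>i x y. x \<in> K \<Longrightarrow> y \<in> K \<Longrightarrow> norm (f i x - f i y) \<le> L i * dist x y" by metis
  have nv: "norm v \<le> (\<Sum>i\<in>UNIV. norm (v $ i))" for v :: "'b ^ 'i"
    unfolding norm_vec_def by (rule L2_set_le_sum) simp
  show ?thesis
  proof (rule bdd_lip_onI[of "\<Sum>i\<in>UNIV. M i" "\<Sum>i\<in>UNIV. L i"])
    fix x assume "x \<in> K"
    then show "norm (\<chi> i. f i x) \<le> (\<Sum>i\<in>UNIV. M i)"
      using bnd(3) by (intro order_trans[OF nv]) (simp add: sum_mono)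
  next
    fix x y assume "x \<in> K" "y \<in> K"
    then show "norm ((\<chi> i. f i x) - (\<chi> i. f i y)) \<le> (\<Sum>i\<in>UNIV. L i) * dist x y"
      using bnd(4) by (intro order_trans[OF nv]) (simp add: sum_mono sum_distrib_right)
  qed (use bnd in \<open>auto intro: sum_nonneg\<close>)
qed

lemma bdd_lip_on_imp_continuous_on: "bdd_lip_on K f \<Longrightarrow> continuous_on K f"
proof (erule bdd_lip_onE)
  fix M L :: real
  assume "L \<ge> 0" and L: "\<And>x y. x \<in> K \<Longrightarrow> y \<in> K \<Longrightarrow> norm (f x - f y) \<le> L * dist x y"
  have "L-lipschitz_on K f" using \<open>L \<ge> 0\<close> L by (auto intro!: lipschitz_onI simp: dist_norm[symmetric])
  then show ?thesis by (rule lipschitz_on_continuous_on)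
qed

lemma compact_norm_bounded_below:
  fixes f :: "'a::metric_space \<Rightarrow> 'b::real_normed_vector"
  assumes K: "compact K" and f: "continuous_on K f" and nz: "0 \<notin> f ` K"
  shows "\<exists>d>0. \<forall>x\<in>K. norm (f x) \<ge> d"
proof (cases "K = {}")
  case False
  have "continuous_on K (\<lambda>x. norm (f x))" using f by (intro continuous_intros)
  from continuous_attains_inf[OF K False this] obtain x where "x \<in> K" "\<forall>y\<in>K. norm (f x) \<le> norm (f y)"
    by blast
  then show ?thesis using nz by (intro exI[of _ "norm (f x)"]) force
qed (auto intro: exI[of _ 1])

lemma bdd_lip_on_kern:
  assumes "compact K" "bdd_lip_on K f" "0 \<notin> f ` K"
  shows "bdd_lip_on K (\<lambda>x. kern (f x))"
proof -
  obtain d where d: "d > 0" "\<And>x. x \<in> K \<Longrightarrow> norm (f x) \<ge> d"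
    using compact_norm_bounded_below[OF assms(1) bdd_lip_on_imp_continuous_on[OF assms(2)] assms(3)] by blast
  obtain M L where M: "M \<ge> 0" and f: "L \<ge> 0" and "\<And>x. x \<in> K \<Longrightarrow> norm (f x) \<le> M"
    "\<And>x y. x \<in> K \<Longrightarrow> y \<in> K \<Longrightarrow> norm (f x - f y) \<le> L * dist x y"
    using assms(2) bdd_lip_onE by blast
  note f = f this(4)
  show ?thesis
  proof (rule bdd_lip_onI[of "1 / d\<^sup>2" "4 / d ^ 3 * L"])
    fix x y assume xy: "x \<in> K" "y \<in> K"
    have "norm (kern (f x) - kern (f y)) \<le> 4 / d ^ 3 * norm (f x - f y)"
      using d xy by (intro kern_lipschitz) auto
    also have "\<dots> \<le> 4 / d ^ 3 * (L * dist x y)"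
      using d f(2)[OF xy] by (intro mult_left_mono) auto
    finally show "norm (kern (f x) - kern (f y)) \<le> 4 / d ^ 3 * L * dist x y" by (simp add: mult.assoc)
  qed (use d f in \<open>auto intro: norm_kern_le\<close>)
qed

lemma bdd_lip_on_inverse_norm:
  assumes "compact K" "bdd_lip_on K f" "0 \<notin> f ` K"
  shows "bdd_lip_on K (\<lambda>x. inverse (norm (f x)))"
proof -
  obtain d where d: "d > 0" "\<And>x. x \<in> K \<Longrightarrow> norm (f x) \<ge> d"
    using compact_norm_bounded_below[OF assms(1) bdd_lip_on_imp_continuous_on[OF assms(2)] assms(3)] by blast
  obtain M L where M: "M \<ge> 0" and f: "L \<ge> 0" and "\<And>x. x \<in> K \<Longrightarrow> norm (f x) \<le> M"
    "\<And>x y. x \<in> K \<Longrightarrow> y \<in> K \<Longrightarrow> norm (f x - f y) \<le> L * dist x y"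
    using assms(2) bdd_lip_onE by blast
  note f = f this(4)
  show ?thesis
  proof (rule bdd_lip_onI[of "1 / d" "1 / (d * d) * L"])
    fix x assume "x \<in> K" then show "norm (inverse (norm (f x))) \<le> 1 / d"
      using d(1) d(2)[of x] by (simp add: divide_simps)
  next
    fix x y assume xy: "x \<in> K" "y \<in> K"
    let ?a = "norm (f x)" and ?b = "norm (f y)"
    have ab: "?a \<ge> d" "?b \<ge> d" "?a > 0" "?b > 0"
      using d(1) d(2)[OF xy(1)] d(2)[OF xy(2)] by linarith+
    then have "inverse ?a - inverse ?b = (?b - ?a) / (?a * ?b)"
      by (simp add: divide_simps)
    then have "norm (inverse ?a - inverse ?b) = \<bar>?b - ?a\<bar> / (?a * ?b)"
      by (simp add: abs_mult)
    also have "\<dots> \<le> (L * dist x y) / (d * d)"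
    proof (intro frac_le mult_mono)
      show "\<bar>?b - ?a\<bar> \<le> L * dist x y"
        using f(2)[OF xy] norm_triangle_ineq3[of "f y" "f x"] by (simp add: norm_minus_commute)
    qed (use ab d f in auto)
    finally show "norm (inverse ?a - inverse ?b) \<le> 1 / (d * d) * L * dist x y" by simp
  qed (use d f in auto)
qed

text \<open>
  Gronwall's argument: \<open>\<bar>d\<bar>\<^sup>2 exp (- 2 L t)\<close> does not increase and
  starts at \<open>0\<close>.
\<close>

lemma gronwall_zero:
  fixes d :: "real \<Rightarrow> 'a::real_inner"
  assumes der: "\<And>t. t \<in> {0..T} \<Longrightarrow> (d has_vector_derivative d' t) (at t within {0..T})"
    and bound: "\<And>t. t \<in> {0..T} \<Longrightarrow> norm (d' t) \<le> L * norm (d t)"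
    and zero: "d 0 = 0" and t: "t \<in> {0..T}"
  shows "d t = 0"
proof -
  define g where "g s = (d s \<bullet> d s) * exp (- (2 * L * s))" for s
  have dcont: "continuous_on {0..T} d"
    using der by (meson has_vector_derivative_continuous continuous_on_eq_continuous_within)
  have "g t \<le> g 0"
  proof (rule DERIV_nonpos_imp_decreasing_open[where f = g])
    show "0 \<le> t" using t by simp
    show "continuous_on {0..t} g"
    proof -
      have "continuous_on {0..t} d" by (rule continuous_on_subset[OF dcont]) (use t in auto)
      moreover have "continuous_on {0..t} (\<lambda>s. exp (- (2 * L * s)))" by (intro continuous_intros)
      ultimately show ?thesis unfolding g_def by (intro continuous_on_mult continuous_on_inner)
    qed
    fix s assume s: "0 < s" "s < t"
    have "(d has_vector_derivative d' s) (at s)"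
      using der[of s] s t at_within_Icc_at[of 0 s T] by simp
    then have "((\<lambda>s. d s \<bullet> d s) has_vector_derivative (d s \<bullet> d' s + d' s \<bullet> d s)) (at s)"
      using bounded_bilinear.has_vector_derivative[OF bounded_bilinear_inner] by blast
    then have dd: "((\<lambda>s. d s \<bullet> d s) has_real_derivative 2 * (d s \<bullet> d' s)) (at s)"
      by (simp add: has_real_derivative_iff_has_vector_derivative inner_commute)
    have "(g has_real_derivative 2 * (d s \<bullet> d' s) * exp (- (2 * L * s)) - (d s \<bullet> d s) * (2 * L * exp (- (2 * L * s)))) (at s)"
      unfolding g_def by (auto intro!: derivative_eq_intros dd)
    moreover have "2 * (d s \<bullet> d' s) * exp (- (2 * L * s)) - (d s \<bullet> d s) * (2 * L * exp (- (2 * L * s))) \<le> 0"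
    proof -
      have "d s \<bullet> d' s \<le> norm (d s) * norm (d' s)" by (rule norm_cauchy_schwarz)
      also have "\<dots> \<le> norm (d s) * (L * norm (d s))" using bound[of s] s t by (intro mult_left_mono) auto
      also have "\<dots> = L * (d s \<bullet> d s)" by (simp add: power2_norm_eq_inner[symmetric] power2_eq_square)
      finally have "(d s \<bullet> d' s - L * (d s \<bullet> d s)) * exp (- (2 * L * s)) \<le> 0"
        by (simp add: mult_nonpos_nonneg)
      then show ?thesis by (simp add: algebra_simps)
    qed
    ultimately show "\<exists>y. (g has_real_derivative y) (at s) \<and> y \<le> 0" by blast
  qed
  then have "(d t \<bullet> d t) * exp (- (2 * L * t)) \<le> 0" by (simp add: g_def zero)
  then have "d t \<bullet> d t \<le> 0" by (simp add: mult_le_0_iff)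
  then show ?thesis using inner_ge_zero[of "d t"] by (metis antisym inner_eq_zero_iff)
qed

lemma vfield_bdd_lip_on:
  fixes K :: "('d::finite, 'n::{finite,linorder}) state set"
  assumes K: "compact K" and nc: "\<And>\<rho> s v w. (\<rho>, s, v, w) \<in> K \<Longrightarrow> s \<notin> Coll"
  shows "bdd_lip_on K (\<lambda>(\<rho>, s, v, w). (- v * \<rho>, w, (minner m w w) - \<rho> * pot m s,
     \<rho> *\<^sub>R (force m s + pot m s *\<^sub>R s) - v *\<^sub>R w - (minner m w w) *\<^sub>R s))"
proof -
  have lin: "bdd_lip_on K f" if "bounded_linear f" for f :: "('d, 'n) state \<Rightarrow> 'x::real_normed_vector"
    using that K bdd_lip_on_linear compact_imp_bounded by blast
  let ?r = "\<lambda>x::('d, 'n) state. fst x" and ?s = "\<lambda>x::('d, 'n) state. fst (snd x)"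
    and ?v = "\<lambda>x::('d, 'n) state. fst (snd (snd x))" and ?w = "\<lambda>x::('d, 'n) state. snd (snd (snd x))"
  have comp: "bdd_lip_on K ?r" "bdd_lip_on K ?s" "bdd_lip_on K ?v" "bdd_lip_on K ?w"
    by (intro lin bounded_linear_intros)+
  have diffs: "bdd_lip_on K (\<lambda>x. ?s x $ i - ?s x $ j)" for i j
    by (intro bdd_lip_on_diff lin bounded_linear_compose[OF bounded_linear_vec_nth] bounded_linear_intros)
  have ne: "0 \<notin> (\<lambda>x. ?s x $ i - ?s x $ j) ` K" if "i \<noteq> j" for i j
    using nc that by (fastforce simp: Coll_def)
  have frc: "bdd_lip_on K (\<lambda>x. force m (?s x))"
    unfolding force_def
  proof (intro bdd_lip_on_vec bdd_lip_on_sum)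
    fix i j
    show "bdd_lip_on K (\<lambda>x. m j *\<^sub>R kern (?s x $ j - ?s x $ i))"
    proof (cases "i = j")
      case False
      then show ?thesis
        by (intro bdd_lip_on_bilinear[OF bounded_bilinear_scaleR bdd_lip_on_const] bdd_lip_on_kern K diffs ne) auto
    qed (simp add: bdd_lip_on_const)
  qed
  have pt: "bdd_lip_on K (\<lambda>x. pot m (?s x))"
    unfolding pot_def case_prod_beta divide_inverse
  proof (intro bdd_lip_on_sum bdd_lip_on_bilinear[OF bounded_bilinear_mult] bdd_lip_on_const bdd_lip_on_inverse_norm K diffs)
    fix p :: "'n \<times> 'n" assume "p \<in> {p. fst p < snd p}"
    then show "0 \<notin> (\<lambda>x. ?s x $ fst p - ?s x $ snd p) ` K" using ne[of "fst p" "snd p"] by auto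
  qed
  note b = bdd_lip_on_bilinear[OF bounded_bilinear_scaleR] bdd_lip_on_bilinear[OF bounded_bilinear_mult]
     bdd_lip_on_bilinear[OF bounded_bilinear_minner]
  have "bdd_lip_on K (\<lambda>x. (- ?v x * ?r x, ?w x, minner m (?w x) (?w x) - ?r x * pot m (?s x),
     ?r x *\<^sub>R (force m (?s x) + pot m (?s x) *\<^sub>R ?s x) - ?v x *\<^sub>R ?w x - (minner m (?w x) (?w x)) *\<^sub>R ?s x))"
    by (intro bdd_lip_on_Pair bdd_lip_on_diff bdd_lip_on_add b bdd_lip_on_minus comp frc pt)
  then show ?thesis by (simp add: case_prod_unfold)
qed

definition reverse_state :: "('d::finite, 'n::finite) state \<Rightarrow> ('d, 'n) state"
  where "reverse_state = (\<lambda>(\<rho>, s, v, w). (\<rho>, s, - v, - w))"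

lemma bounded_linear_reverse_state: "bounded_linear reverse_state"
  unfolding reverse_state_def case_prod_unfold
  by (intro bounded_linear_intros bounded_linear_minus)

text \<open>
  Every symmetry of the problem is an instance of this lemma: \<open>c = - 1\<close> for time
  reversal, \<open>c = k\<close> for dilations and \<open>c = 1\<close> for rotations.
\<close>

lemma is_solution_transport:
  assumes T: "bounded_linear T" and ph: "\<And>x. x \<in> phase m \<Longrightarrow> T x \<in> phase m"
    and vf: "\<And>x. x \<in> phase m \<Longrightarrow> vfield m (T x) = c *\<^sub>R T (vfield m x)"
    and sol: "is_solution m \<gamma> I"
  shows "is_solution m (\<lambda>\<tau>. T (\<gamma> (c * \<tau>))) {\<tau>. c * \<tau> \<in> I}"
  unfolding is_solution_def
proof (intro ballI conjI)
  fix \<tau> assume "\<tau> \<in> {\<tau>. c * \<tau> \<in> I}"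
  then have \<tau>: "c * \<tau> \<in> I" by simp
  then have g: "\<gamma> (c * \<tau>) \<in> phase m" "(\<gamma> has_vector_derivative vfield m (\<gamma> (c * \<tau>))) (at (c * \<tau>) within I)"
    using sol by (auto simp: is_solution_def)
  show "T (\<gamma> (c * \<tau>)) \<in> phase m" using ph g by blast
  have "((\<lambda>\<tau>. c * \<tau>) has_vector_derivative c) (at \<tau> within {\<tau>. c * \<tau> \<in> I})"
    by (auto intro!: derivative_eq_intros)
  moreover have "(\<gamma> has_vector_derivative vfield m (\<gamma> (c * \<tau>))) (at (c * \<tau>) within (\<lambda>\<tau>. c * \<tau>) ` {\<tau>. c * \<tau> \<in> I})"
    by (rule has_vector_derivative_within_subset[OF g(2)]) auto
  ultimately have "((\<lambda>\<tau>. \<gamma> (c * \<tau>)) has_vector_derivative c *\<^sub>R vfield m (\<gamma> (c * \<tau>))) (at \<tau> within {\<tau>. c * \<tau> \<in> I})"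
    using vector_diff_chain_within[of "\<lambda>\<tau>. c * \<tau>" c \<tau> _ \<gamma>] by (simp add: o_def)
  from bounded_linear.has_vector_derivative[OF T this]
  show "((\<lambda>\<tau>. T (\<gamma> (c * \<tau>))) has_vector_derivative vfield m (T (\<gamma> (c * \<tau>)))) (at \<tau> within {\<tau>. c * \<tau> \<in> I})"
    using vf[OF g(1)] by (simp add: linear_simps(5)[OF T])
qed

lemma has_vector_derivative_Un:
  "(f has_vector_derivative D) (at x within S) \<Longrightarrow> (f has_vector_derivative D) (at x within T)
    \<Longrightarrow> (f has_vector_derivative D) (at x within (S \<union> T))"
  unfolding has_vector_derivative_def has_derivative_within by (blast intro: Lim_Un)

lemma is_solution_subset: "is_solution m \<gamma> I \<Longrightarrow> J \<subseteq> I \<Longrightarrow> is_solution m \<gamma> J"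
  unfolding is_solution_def by (meson has_vector_derivative_within_subset subsetD)

context masses begin

text \<open>
  On the phase space the vector field agrees with a formula that makes sense and is locally
  Lipschitz off the collisions, without reference to the derivative that defines
  \<open>grad_pot\<close>.
\<close>

lemma vfield_phase:
  assumes "x \<in> phase m"
  shows "vfield m x = (\<lambda>(\<rho>, s, v, w). (- v * \<rho>, w, (minner m w w) - \<rho> * pot m s,
     \<rho> *\<^sub>R (force m s + pot m s *\<^sub>R s) - v *\<^sub>R w - (minner m w w) *\<^sub>R s)) x"
  using assms by (auto simp: phase_def tgrad_pot_def mnorm_sq grad_pot_eq_force Shat_def)

lemma phase_not_Coll: "(\<rho>, s, v, w) \<in> phase m \<Longrightarrow> s \<notin> Coll"
  by (auto simp: phase_def Shat_def Ehat_def)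

text \<open>
  The images of the two curves form a compact set without collisions, on which the vector field is
  Lipschitz.
\<close>

lemma is_solution_unique_forward:
  assumes 1: "is_solution m \<gamma>1 {0..T}" and 2: "is_solution m \<gamma>2 {0..T}"
    and init: "\<gamma>1 0 = \<gamma>2 0" and t: "t \<in> {0..T}"
  shows "\<gamma>1 t = \<gamma>2 t"
proof -
  define K where "K = \<gamma>1 ` {0..T} \<union> \<gamma>2 ` {0..T}"
  have cont: "continuous_on {0..T} \<gamma>" if "is_solution m \<gamma> {0..T}" for \<gamma>
    using that unfolding is_solution_def
    by (meson has_vector_derivative_continuous continuous_on_eq_continuous_within)
  have K: "compact K" unfolding K_def
    by (intro compact_Un compact_continuous_image cont 1 2) auto
  have ph: "x \<in> phase m" if "x \<in> K" for x using that 1 2 by (auto simp: K_def is_solution_def)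
  have "bdd_lip_on K (\<lambda>(\<rho>, s, v, w). (- v * \<rho>, w, (minner m w w) - \<rho> * pot m s,
     \<rho> *\<^sub>R (force m s + pot m s *\<^sub>R s) - v *\<^sub>R w - (minner m w w) *\<^sub>R s))"
    by (rule vfield_bdd_lip_on[OF K]) (use ph phase_not_Coll in blast)
  then have "bdd_lip_on K (vfield m)"
    using bdd_lip_on_cong[of K "vfield m", OF vfield_phase[OF ph]] by blast
  then obtain L where L: "\<And>x y. x \<in> K \<Longrightarrow> y \<in> K \<Longrightarrow> norm (vfield m x - vfield m y) \<le> L * dist x y"
    unfolding bdd_lip_on_def by blast
  have "\<gamma>1 t - \<gamma>2 t = 0"
  proof (rule gronwall_zero[where d = "\<lambda>t. \<gamma>1 t - \<gamma>2 t" and L = L, OF _ _ _ t])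
    fix s assume s: "s \<in> {0..T}"
    show "((\<lambda>t. \<gamma>1 t - \<gamma>2 t) has_vector_derivative vfield m (\<gamma>1 s) - vfield m (\<gamma>2 s)) (at s within {0..T})"
      using 1 2 s by (intro has_vector_derivative_diff) (auto simp: is_solution_def)
    show "norm (vfield m (\<gamma>1 s) - vfield m (\<gamma>2 s)) \<le> L * norm (\<gamma>1 s - \<gamma>2 s)"
      using L[of "\<gamma>1 s" "\<gamma>2 s"] s by (simp add: K_def dist_norm)
  qed (simp add: init)
  then show ?thesis by simp
qed

lemma reverse_state_phase: "x \<in> phase m \<Longrightarrow> reverse_state x \<in> phase m"
  by (auto simp: phase_def reverse_state_def minner.minus_right EE_closed)

lemma reverse_state_vfield: "vfield m (reverse_state x) = (-1) *\<^sub>R reverse_state (vfield m x)"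
  by (cases x) (auto simp: reverse_state_def)

lemma is_solution_reverse:
  "is_solution m \<gamma> I \<Longrightarrow> is_solution m (\<lambda>\<tau>. reverse_state (\<gamma> (- \<tau>))) {\<tau>. - \<tau> \<in> I}"
  using is_solution_transport[OF bounded_linear_reverse_state reverse_state_phase reverse_state_vfield]
  by simp

lemma reverse_reverse [simp]: "reverse_state (reverse_state x) = x"
  by (cases x) (simp add: reverse_state_def)

lemma is_solution_unique:
  assumes 1: "is_solution m \<gamma>1 (closed_segment 0 T)" and 2: "is_solution m \<gamma>2 (closed_segment 0 T)"
    and init: "\<gamma>1 0 = \<gamma>2 0" and t: "t \<in> closed_segment 0 T"
  shows "\<gamma>1 t = \<gamma>2 t"
proof (cases "T \<ge> 0")
  case True
  then show ?thesis
    using is_solution_unique_forward[of \<gamma>1 T \<gamma>2 t] assms by (simp add: closed_segment_eq_real_ivl)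
next
  case False
  have eq: "{\<tau>. - \<tau> \<in> closed_segment 0 T} = {0..-T}" using False by (auto simp: closed_segment_eq_real_ivl)
  have "reverse_state (\<gamma>1 (- (- t))) = reverse_state (\<gamma>2 (- (- t)))"
    using is_solution_unique_forward[OF is_solution_reverse[OF 1, unfolded eq] is_solution_reverse[OF 2, unfolded eq], of "- t"]
      init t False by (simp add: closed_segment_eq_real_ivl)
  then show ?thesis by (metis minus_minus reverse_reverse)
qed

lemma flow_eq:
  assumes "is_solution m \<gamma> (closed_segment 0 T)" and "\<gamma> 0 = x"
  shows "flow m T x = \<gamma> T"
  unfolding flow_def
proof (rule the_equality)
  show "\<exists>\<gamma>'. is_solution m \<gamma>' (closed_segment 0 T) \<and> \<gamma>' 0 = x \<and> \<gamma>' T = \<gamma> T"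
    using assms by blast
  show "y = \<gamma> T" if "\<exists>\<gamma>'. is_solution m \<gamma>' (closed_segment 0 T) \<and> \<gamma>' 0 = x \<and> \<gamma>' T = y" for y
    using that is_solution_unique[OF _ assms(1), of _ T] assms(2) by auto
qed

text \<open>
  The curves that witness membership in \<open>flow_dom\<close> live on different segments; by
  uniqueness they are restrictions of a single curve. The time \<open>0\<close> is special because
  every segment ends there.
\<close>

lemma flow_global_solution:
  assumes dom: "flow_dom m x = UNIV"
  shows "is_solution m (\<lambda>\<tau>. flow m \<tau> x) UNIV"
proof -
  have ex: "\<exists>\<gamma>. is_solution m \<gamma> (closed_segment 0 T) \<and> (\<forall>t\<in>closed_segment 0 T. flow m t x = \<gamma> t)" for T
  proof -
    have "T \<in> flow_dom m x" using dom by simp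
    then obtain \<gamma> where \<gamma>: "is_solution m \<gamma> (closed_segment 0 T)" "\<gamma> 0 = x"
      by (auto simp: flow_dom_def)
    have "flow m t x = \<gamma> t" if "t \<in> closed_segment 0 T" for t
    proof (rule flow_eq[OF is_solution_subset[OF \<gamma>(1)] \<gamma>(2)])
      show "closed_segment 0 t \<subseteq> closed_segment 0 T"
        using that by (simp add: subset_closed_segment)
    qed
    with \<gamma> show ?thesis by blast
  qed
  have seg: "flow m t x \<in> phase m \<and> ((\<lambda>\<tau>. flow m \<tau> x) has_vector_derivative vfield m (flow m t x)) (at t within closed_segment 0 T)"
    if "t \<in> closed_segment 0 T" for t T
  proof -
    obtain \<gamma> where \<gamma>: "is_solution m \<gamma> (closed_segment 0 T)" "\<And>t. t \<in> closed_segment 0 T \<Longrightarrow> flow m t x = \<gamma> t"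
      using ex by blast
    have "(\<gamma> has_vector_derivative vfield m (\<gamma> t)) (at t within closed_segment 0 T)" "\<gamma> t \<in> phase m"
      using \<gamma>(1) that by (auto simp: is_solution_def)
    then show ?thesis using \<gamma>(2) that
      by (auto intro: has_vector_derivative_transform[OF that])
  qed
  have "flow m t x \<in> phase m \<and> ((\<lambda>\<tau>. flow m \<tau> x) has_vector_derivative vfield m (flow m t x)) (at t)" for t
  proof -
    consider "t > 0" | "t < 0" | "t = 0" by linarith
    then show ?thesis
    proof cases
      case 1 then show ?thesis using seg[of t "t + 1"]
        using at_within_Icc_at[of 0 t "t + 1"] 1 by (auto simp: closed_segment_eq_real_ivl)
    next
      case 2 then show ?thesis using seg[of t "t - 1"]
        using at_within_Icc_at[of "t - 1" t 0] 2 by (auto simp: closed_segment_eq_real_ivl)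
    next
      case 3
      have "((\<lambda>\<tau>. flow m \<tau> x) has_vector_derivative vfield m (flow m t x)) (at t within closed_segment 0 1 \<union> closed_segment 0 (-1))"
        using seg[of 0 1] seg[of 0 "-1"] 3 by (intro has_vector_derivative_Un) auto
      moreover have "closed_segment 0 1 \<union> closed_segment 0 (-1) = {-1..1::real}"
        by (auto simp: closed_segment_eq_real_ivl)
      ultimately show ?thesis using seg[of 0 1] 3 at_within_Icc_at[of "-1" "0::real" 1] by (simp only: simp_thms) simp
    qed
  qed
  then show ?thesis by (simp add: is_solution_def)
qed

lemma flow_of_global_solution:
  assumes "is_solution m \<gamma> UNIV"
  shows "flow m \<tau> (\<gamma> 0) = \<gamma> \<tau>" "flow_dom m (\<gamma> 0) = UNIV"
proof -
  have seg: "is_solution m \<gamma> (closed_segment 0 T)" for T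
    using is_solution_subset[OF assms] by blast
  show "flow m \<tau> (\<gamma> 0) = \<gamma> \<tau>" by (rule flow_eq[OF seg refl])
  show "flow_dom m (\<gamma> 0) = UNIV" using seg by (auto simp: flow_dom_def)
qed

text \<open>
  A global solution with the prescribed limits can be transformed and constructed directly, so that
  the flow need not be mentioned again.
\<close>

lemma connects_iff:
  assumes p: "p \<in> equil_minus m" and q: "q \<in> equil_plus m"
  shows "connects m p q \<longleftrightarrow> (\<exists>\<gamma>. is_solution m \<gamma> UNIV \<and> (\<gamma> \<longlongrightarrow> p) at_bot \<and> (\<gamma> \<longlongrightarrow> q) at_top)"
proof
  assume "connects m p q"
  then obtain x where x: "x \<in> H_plus m" "x \<in> H_minus m" "pi_minus m x = p" "pi_plus m x = q"
    by (auto simp: connects_def)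
  have "{0..} \<union> {..0} \<subseteq> flow_dom m x" using x by (auto simp: H_plus_def H_minus_def)
  moreover have "{0..} \<union> {..0} = (UNIV :: real set)" by auto
  ultimately have "flow_dom m x = UNIV" by auto
  moreover obtain p' q' where "((\<lambda>\<tau>. flow m \<tau> x) \<longlongrightarrow> p') at_bot" "((\<lambda>\<tau>. flow m \<tau> x) \<longlongrightarrow> q') at_top"
    using x unfolding H_plus_def H_minus_def by blast
  moreover from this have "p' = p" "q' = q"
    using x(3,4) tendsto_Lim[OF trivial_limit_at_bot_linorder] tendsto_Lim[OF trivial_limit_at_top_linorder]
    unfolding pi_minus_def pi_plus_def by blast+
  ultimately show "\<exists>\<gamma>. is_solution m \<gamma> UNIV \<and> (\<gamma> \<longlongrightarrow> p) at_bot \<and> (\<gamma> \<longlongrightarrow> q) at_top"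
    using flow_global_solution by blast
next
  assume "\<exists>\<gamma>. is_solution m \<gamma> UNIV \<and> (\<gamma> \<longlongrightarrow> p) at_bot \<and> (\<gamma> \<longlongrightarrow> q) at_top"
  then obtain \<gamma> where \<gamma>: "is_solution m \<gamma> UNIV" "(\<gamma> \<longlongrightarrow> p) at_bot" "(\<gamma> \<longlongrightarrow> q) at_top" by blast
  have "\<gamma> 0 \<in> phase m" using \<gamma>(1) by (auto simp: is_solution_def)
  moreover have "pi_minus m (\<gamma> 0) = p" "pi_plus m (\<gamma> 0) = q"
    using \<gamma> flow_of_global_solution[OF \<gamma>(1)] unfolding pi_minus_def pi_plus_def
    by (auto intro!: tendsto_Lim)
  ultimately show "connects m p q"
    using p q \<gamma> flow_of_global_solution[OF \<gamma>(1)] unfolding connects_def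
    by (intro bexI[of _ "\<gamma> 0"]) (auto simp: H_plus_def H_minus_def)
qed

section \<open>Conserved energy and symmetries of scattering\<close>

lemma pot_has_real_derivative:
  assumes "(q has_vector_derivative q') (at t)" "q t \<notin> Coll"
  shows "((\<lambda>t. pot m (q t)) has_real_derivative minner m (force m (q t)) q') (at t)"
proof -
  have "((\<lambda>t. pot m (q t)) has_derivative (\<lambda>h. minner m (force m (q t)) (h *\<^sub>R q'))) (at t)"
    using has_derivative_compose[OF assms(1)[unfolded has_vector_derivative_def] pot_has_derivative[OF assms(2), of m UNIV]] .
  then show ?thesis
    by (simp add: has_field_derivative_def minner.scaleR_right mult_commute_abs)
qed

lemma pot_tendsto:
  assumes "(f \<longlongrightarrow> q) F" "q \<notin> Coll"
  shows "((\<lambda>x. pot m (f x)) \<longlongrightarrow> pot m q) F"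
proof -
  have "isCont (pot m) q"
    using pot_has_derivative[OF assms(2), of m UNIV] by (metis has_derivative_continuous)
  then show ?thesis using assms(1) by (rule isCont_tendsto_compose)
qed

fun energy :: "('d::finite, 'n) state \<Rightarrow> real"
  where "energy (\<rho>, s, v, w) = v\<^sup>2 / 2 + minner m w w / 2 - \<rho> * pot m s"

lemma energy_eq: "energy x = (fst (snd (snd x)))\<^sup>2 / 2 + minner m (snd (snd (snd x))) (snd (snd (snd x))) / 2
    - fst x * pot m (fst (snd x))"
  by (cases x) simp

text \<open>
  The energy is the total energy of the underlying Newtonian motion; on \<open>\<rho> = 0\<close> it
  is the kinetic energy.
\<close>

lemma energy_const:
  assumes sol: "is_solution m \<gamma> UNIV"
  shows "energy (\<gamma> t) = energy (\<gamma> t')"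
proof -
  have der: "((\<lambda>t. energy (\<gamma> t)) has_real_derivative 0) (at t)" for t
  proof -
    obtain r s v w where g: "\<gamma> t = (r, s, v, w)" by (cases "\<gamma> t")
    let ?r = "\<lambda>t. fst (\<gamma> t)" and ?s = "\<lambda>t. fst (snd (\<gamma> t))" and ?v = "\<lambda>t. fst (snd (snd (\<gamma> t)))"
      and ?w = "\<lambda>t. snd (snd (snd (\<gamma> t)))"
    have ph: "\<gamma> t \<in> phase m" and d: "(\<gamma> has_vector_derivative vfield m (\<gamma> t)) (at t)"
      using sol by (auto simp: is_solution_def)
    have vf: "vfield m (\<gamma> t) = (- v * r, w, minner m w w - r * pot m s,
       r *\<^sub>R (force m s + pot m s *\<^sub>R s) - v *\<^sub>R w - minner m w w *\<^sub>R s)"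
      by (simp only: vfield_phase[OF ph]) (simp add: g)
    have sw: "minner m w s = 0" "s \<notin> Coll"
      using ph g phase_not_Coll[of r s v w] by (auto simp: phase_def minner_commute)
    have comp: "((\<lambda>t. L (\<gamma> t)) has_vector_derivative L (vfield m (\<gamma> t))) (at t)" if "bounded_linear L" for L :: "_ \<Rightarrow> 'x::real_normed_vector"
      using bounded_linear.has_vector_derivative[OF that d] .
    have 1: "(?r has_real_derivative - v * r) (at t)"
      using comp[of fst] by (simp add: vf has_real_derivative_iff_has_vector_derivative bounded_linear_fst)
    have 2: "(?s has_vector_derivative w) (at t)"
      using comp[of "\<lambda>x. fst (snd x)"] by (simp add: vf bounded_linear_intros)
    have 3: "(?v has_real_derivative minner m w w - r * pot m s) (at t)"
      using comp[of "\<lambda>x. fst (snd (snd x))"]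
      by (simp add: vf has_real_derivative_iff_has_vector_derivative bounded_linear_intros)
    have 4: "(?w has_vector_derivative (r *\<^sub>R (force m s + pot m s *\<^sub>R s) - v *\<^sub>R w - minner m w w *\<^sub>R s)) (at t)"
      using comp[of "\<lambda>x. snd (snd (snd x))"] by (simp add: vf bounded_linear_intros)
    have 5: "((\<lambda>t. pot m (?s t)) has_real_derivative minner m (force m s) w) (at t)"
      using pot_has_real_derivative[OF 2] sw by (simp add: g)
    have 6: "((\<lambda>t. minner m (?w t) (?w t)) has_real_derivative
       2 * minner m w (r *\<^sub>R (force m s + pot m s *\<^sub>R s) - v *\<^sub>R w - minner m w w *\<^sub>R s)) (at t)"
      using minner.has_vector_derivative[OF 4 4, of m] unfolding has_real_derivative_iff_has_vector_derivative
      by (simp add: g minner_commute)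
    have "((\<lambda>t. (?v t)\<^sup>2 / 2 + minner m (?w t) (?w t) / 2 - ?r t * pot m (?s t)) has_real_derivative
      (v * (minner m w w - r * pot m s) + minner m w (r *\<^sub>R (force m s + pot m s *\<^sub>R s) - v *\<^sub>R w - minner m w w *\<^sub>R s)
        - (- v * r * pot m s + r * minner m (force m s) w))) (at t)"
      by (auto intro!: derivative_eq_intros 1 3 5 6 simp: g)
    moreover have "v * (minner m w w - r * pot m s) + minner m w (r *\<^sub>R (force m s + pot m s *\<^sub>R s) - v *\<^sub>R w - minner m w w *\<^sub>R s)
        - (- v * r * pot m s + r * minner m (force m s) w) = 0"
      using sw by (simp add: minner.diff_right minner.add_right minner.scaleR_right algebra_simps)
        (simp add: minner_commute)
    moreover have "(\<lambda>t. energy (\<gamma> t)) = (\<lambda>t. (?v t)\<^sup>2 / 2 + minner m (?w t) (?w t) / 2 - ?r t * pot m (?s t))"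
      by (rule ext, unfold energy_eq) (rule refl)
    ultimately show ?thesis by simp
  qed
  show ?thesis by (rule DERIV_isconst_all) (use der in blast)
qed

text \<open>
  At an equilibrium the potential term is switched off by \<open>\<rho> = 0\<close>, as
  \<open>s\<close> is not a collision.
\<close>

lemma energy_tendsto:
  fixes s :: "('d::finite, 'n) config"
  assumes "(\<gamma> \<longlongrightarrow> (0, s, v, 0)) F" "s \<notin> Coll"
  shows "((\<lambda>t. energy (\<gamma> t)) \<longlongrightarrow> v\<^sup>2 / 2) F"
proof -
  have r: "((\<lambda>t. fst (\<gamma> t)) \<longlongrightarrow> 0) F" and s: "((\<lambda>t. fst (snd (\<gamma> t))) \<longlongrightarrow> s) F"
    and v: "((\<lambda>t. fst (snd (snd (\<gamma> t)))) \<longlongrightarrow> v) F" and w: "((\<lambda>t. snd (snd (snd (\<gamma> t)))) \<longlongrightarrow> 0) F"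
    using tendsto_fst[OF assms(1)] tendsto_fst[OF tendsto_snd[OF assms(1)]]
      tendsto_fst[OF tendsto_snd[OF tendsto_snd[OF assms(1)]]]
      tendsto_snd[OF tendsto_snd[OF tendsto_snd[OF assms(1)]]] by simp_all
  have "((\<lambda>t. (fst (snd (snd (\<gamma> t))))\<^sup>2 / 2 + minner m (snd (snd (snd (\<gamma> t)))) (snd (snd (snd (\<gamma> t)))) / 2
      - fst (\<gamma> t) * pot m (fst (snd (\<gamma> t)))) \<longlongrightarrow> v\<^sup>2 / 2 + minner m 0 (0 :: ('d, 'n) config) / 2 - 0 * pot m s) F"
    by (intro tendsto_intros minner.tendsto[OF w w] r v pot_tendsto[OF s] assms(2)) auto
  moreover have "(\<lambda>t. energy (\<gamma> t)) = (\<lambda>t. (fst (snd (snd (\<gamma> t))))\<^sup>2 / 2 + minner m (snd (snd (snd (\<gamma> t)))) (snd (snd (snd (\<gamma> t)))) / 2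
      - fst (\<gamma> t) * pot m (fst (snd (\<gamma> t))))"
    by (rule ext, unfold energy_eq) (rule refl)
  ultimately show ?thesis by (simp add: minner.zero_left)
qed

lemma Ehat_nonzero: "A \<in> Ehat m \<Longrightarrow> A \<noteq> 0"
proof
  assume A: "A \<in> Ehat m" "A = 0"
  obtain i j :: 'n where "i \<noteq> j" using two_elements[OF two_bodies] by blast
  then show False using A by (auto simp: Ehat_def Coll_def)
qed

definition minus_infinity :: "('d::finite, 'n) config \<Rightarrow> ('d, 'n) state"
  where "minus_infinity A = (0, - (A /\<^sub>R mnorm m A), - mnorm m A, 0)"

definition plus_infinity :: "('d::finite, 'n) config \<Rightarrow> ('d, 'n) state"
  where "plus_infinity A = (0, A /\<^sub>R mnorm m A, mnorm m A, 0)"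

lemma Coll_scaleR: "c \<noteq> 0 \<Longrightarrow> c *\<^sub>R s \<in> Coll \<longleftrightarrow> s \<in> Coll"
  by (auto simp: Coll_def)

lemma Ehat_scaleR: "c \<noteq> 0 \<Longrightarrow> s \<in> Ehat m \<Longrightarrow> c *\<^sub>R s \<in> Ehat m"
  by (simp add: Ehat_def Coll_scaleR EE_closed)

lemma unit_in_Shat: "A \<in> Ehat m \<Longrightarrow> A /\<^sub>R mnorm m A \<in> Shat m 1"
  using Ehat_nonzero[of A] by (auto simp: Shat_def mnorm_scaleR intro!: Ehat_scaleR)

lemma Shat_minus: "s \<in> Shat m r \<Longrightarrow> - s \<in> Shat m r"
  using Ehat_scaleR[of "-1" s] by (auto simp: Shat_def)

lemma scatters_iff:
  assumes A: "A \<in> Ehat m" and A': "A' \<in> Ehat m"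
  shows "scatters m A A' \<longleftrightarrow> (\<exists>\<gamma>. is_solution m \<gamma> UNIV \<and> (\<gamma> \<longlongrightarrow> minus_infinity A) at_bot \<and> (\<gamma> \<longlongrightarrow> plus_infinity A') at_top)"
proof -
  have "minus_infinity A \<in> equil_minus m" "plus_infinity A' \<in> equil_plus m"
    using A A' unit_in_Shat[OF A'] Shat_minus[OF unit_in_Shat[OF A]] Ehat_nonzero
    unfolding minus_infinity_def plus_infinity_def equil_minus_def equil_plus_def by auto
  from connects_iff[OF this] show ?thesis
    by (simp add: scatters_def minus_infinity_def plus_infinity_def)
qed

lemma scatters_energy:
  assumes A: "A \<in> Ehat m" and A': "A' \<in> Ehat m" and sc: "scatters m A A'"
  shows "mnorm m A = mnorm m A'"
proof -
  obtain \<gamma> where \<gamma>: "is_solution m \<gamma> UNIV" "(\<gamma> \<longlongrightarrow> minus_infinity A) at_bot" "(\<gamma> \<longlongrightarrow> plus_infinity A') at_top"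
    using sc scatters_iff[OF A A'] by blast
  have nc: "- (A /\<^sub>R mnorm m A) \<notin> Coll" "A' /\<^sub>R mnorm m A' \<notin> Coll"
    using unit_in_Shat[OF A'] Shat_minus[OF unit_in_Shat[OF A]] by (auto simp: Shat_def Ehat_def)
  have const: "(\<lambda>t. energy (\<gamma> t)) = (\<lambda>t. energy (\<gamma> 0))" using energy_const[OF \<gamma>(1)] by blast
  have "((\<lambda>t. energy (\<gamma> 0)) \<longlongrightarrow> (- mnorm m A)\<^sup>2 / 2) (at_bot :: real filter)"
    "((\<lambda>t. energy (\<gamma> 0)) \<longlongrightarrow> (mnorm m A')\<^sup>2 / 2) (at_top :: real filter)"
    using energy_tendsto[OF \<gamma>(2)[unfolded minus_infinity_def] nc(1)]
      energy_tendsto[OF \<gamma>(3)[unfolded plus_infinity_def] nc(2)] unfolding const by blast+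
  then have "(- mnorm m A)\<^sup>2 / 2 = energy (\<gamma> 0)" "(mnorm m A')\<^sup>2 / 2 = energy (\<gamma> 0)"
    by (auto simp: tendsto_const_iff)
  then have "(mnorm m A)\<^sup>2 = (mnorm m A')\<^sup>2" by simp
  then show ?thesis by (simp add: power2_eq_iff_nonneg)
qed

text \<open>
  The rescaling factor must be positive to keep the two ends of time apart; time reversal is
  therefore treated separately.
\<close>

lemma scatters_transport:
  assumes A: "A \<in> Ehat m" "A' \<in> Ehat m" and B: "B \<in> Ehat m" "B' \<in> Ehat m"
    and T: "bounded_linear T" and ph: "\<And>x. x \<in> phase m \<Longrightarrow> T x \<in> phase m"
    and vf: "\<And>x. x \<in> phase m \<Longrightarrow> vfield m (T x) = c *\<^sub>R T (vfield m x)"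
    and c: "c > 0"
    and TA: "T (minus_infinity A) = minus_infinity B" "T (plus_infinity A') = plus_infinity B'"
    and sc: "scatters m A A'"
  shows "scatters m B B'"
proof -
  obtain \<gamma> where \<gamma>: "is_solution m \<gamma> UNIV" "(\<gamma> \<longlongrightarrow> minus_infinity A) at_bot" "(\<gamma> \<longlongrightarrow> plus_infinity A') at_top"
    using sc scatters_iff[OF A] by blast
  have "is_solution m (\<lambda>\<tau>. T (\<gamma> (c * \<tau>))) UNIV"
    using is_solution_transport[OF T ph vf \<gamma>(1)] by simp
  moreover have "filterlim (\<lambda>\<tau>. c * \<tau>) at_top at_top" "filterlim (\<lambda>\<tau>. c * \<tau>) at_bot at_bot"
    using c by (auto intro!: filterlim_tendsto_pos_mult_at_top filterlim_tendsto_pos_mult_at_bot filterlim_ident tendsto_const)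
  then have "((\<lambda>\<tau>. T (\<gamma> (c * \<tau>))) \<longlongrightarrow> T (minus_infinity A)) at_bot" "((\<lambda>\<tau>. T (\<gamma> (c * \<tau>))) \<longlongrightarrow> T (plus_infinity A')) at_top"
    by (auto intro!: bounded_linear.tendsto[OF T] filterlim_compose[OF \<gamma>(2)] filterlim_compose[OF \<gamma>(3)])
  ultimately show ?thesis using scatters_iff[OF B] TA by auto
qed

lemma scatters_reverse:
  assumes A: "A \<in> Ehat m" and A': "A' \<in> Ehat m" and sc: "scatters m A A'"
  shows "scatters m (- A') (- A)"
proof -
  obtain \<gamma> where \<gamma>: "is_solution m \<gamma> UNIV" "(\<gamma> \<longlongrightarrow> minus_infinity A) at_bot" "(\<gamma> \<longlongrightarrow> plus_infinity A') at_top"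
    using sc scatters_iff[OF A A'] by blast
  have E: "- A \<in> Ehat m" "- A' \<in> Ehat m" using Ehat_scaleR[of "-1"] A A' by auto
  have "is_solution m (\<lambda>\<tau>. reverse_state (\<gamma> (- \<tau>))) UNIV"
    using is_solution_reverse[OF \<gamma>(1)] by simp
  moreover have "((\<lambda>\<tau>. reverse_state (\<gamma> (- \<tau>))) \<longlongrightarrow> reverse_state (minus_infinity A)) at_top"
    by (intro bounded_linear.tendsto[OF bounded_linear_reverse_state] filterlim_compose[OF \<gamma>(2)]
        filterlim_uminus_at_bot_at_top)
  moreover have "((\<lambda>\<tau>. reverse_state (\<gamma> (- \<tau>))) \<longlongrightarrow> reverse_state (plus_infinity A')) at_bot"
    by (intro bounded_linear.tendsto[OF bounded_linear_reverse_state] filterlim_compose[OF \<gamma>(3)]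
        filterlim_uminus_at_top_at_bot)
  moreover have "reverse_state (minus_infinity A) = plus_infinity (- A)" "reverse_state (plus_infinity A') = minus_infinity (- A')"
    by (auto simp: reverse_state_def minus_infinity_def plus_infinity_def)
  ultimately show ?thesis using scatters_iff[OF E(2,1)] by auto
qed

text \<open>
  For \<open>\<rho> > 0\<close> the map is the scaling symmetry of Newton's equation, with lengths
  multiplied by \<open>1 / k\<^sup>2\<close> and velocities by \<open>k\<close>.
\<close>

lemma scatters_dilate:
  assumes A: "A \<in> Ehat m" "A' \<in> Ehat m" and sc: "scatters m A A'" and k: "k > 0"
  shows "scatters m (k *\<^sub>R A) (k *\<^sub>R A')"
proof (rule scatters_transport[where T = "\<lambda>(\<rho>, s, v, w). (k\<^sup>2 * \<rho>, s, k * v, k *\<^sub>R w)" and c = k, OF A _ _ _ _ _ k _ _ sc])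
  show "bounded_linear (\<lambda>(\<rho>, s, v, w). (k\<^sup>2 * \<rho>, s, k * v, k *\<^sub>R w))"
    unfolding case_prod_unfold
    by (intro bounded_linear_intros bounded_linear_compose[OF bounded_linear_mult_right])
  fix x :: "('a, 'n) state" assume x: "x \<in> phase m"
  obtain \<rho> s v w where [simp]: "x = (\<rho>, s, v, w)" by (cases x)
  have scaled: "(k * v)\<^sup>2 / 2 + (mnorm m (k *\<^sub>R w))\<^sup>2 / 2 - k\<^sup>2 * \<rho> * pot m s = k\<^sup>2 * (v\<^sup>2 / 2 + (mnorm m w)\<^sup>2 / 2 - \<rho> * pot m s)"
    by (simp add: mnorm_scaleR power_mult_distrib algebra_simps)
  then show "(\<lambda>(\<rho>, s, v, w). (k\<^sup>2 * \<rho>, s, k * v, k *\<^sub>R w)) x \<in> phase m"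
  proof -
    have "k\<^sup>2 * (v\<^sup>2 / 2 + (mnorm m w)\<^sup>2 / 2 - \<rho> * pot m s) > 0"
      using x k by (auto simp: phase_def intro!: mult_pos_pos)
    with scaled have "k\<^sup>2 * \<rho> * pot m s < (k * v)\<^sup>2 / 2 + (mnorm m (k *\<^sub>R w))\<^sup>2 / 2"
      by linarith
    with x k show ?thesis by (auto simp: phase_def minner.scaleR_right EE_closed)
  qed
  show "vfield m ((\<lambda>(\<rho>, s, v, w). (k\<^sup>2 * \<rho>, s, k * v, k *\<^sub>R w)) x) =
    k *\<^sub>R ((\<lambda>(\<rho>, s, v, w). (k\<^sup>2 * \<rho>, s, k * v, k *\<^sub>R w)) (vfield m x))"
    by (simp add: mnorm_scaleR power_mult_distrib algebra_simps power2_eq_square)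
qed (use A k in \<open>auto intro!: Ehat_scaleR simp: minus_infinity_def plus_infinity_def mnorm_scaleR\<close>)

lemma rotate_config_properties:
  fixes R :: "real ^ 'd ^ 'd" and v w :: "('d, 'n) config"
  assumes R: "orthogonal_matrix R"
  shows rotate_norm: "norm (R *v x) = norm x"
    and rotate_diff: "rotate_config R v $ i - rotate_config R v $ j = R *v (v $ i - v $ j)"
    and minner_rotate: "minner m (rotate_config R v) (rotate_config R w) = minner m v w"
    and mnorm_rotate: "mnorm m (rotate_config R v) = mnorm m v"
    and rotate_in_EE: "v \<in> EE m \<Longrightarrow> rotate_config R v \<in> EE m"
    and rotate_in_Ehat: "v \<in> Ehat m \<Longrightarrow> rotate_config R v \<in> Ehat m"
proof -
  have "orthogonal_transformation ((*v) R)"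
    using R by (simp add: orthogonal_transformation_matrix)
  then have inner: "(R *v x) \<bullet> (R *v y) = x \<bullet> y" and norm: "norm (R *v x) = norm x" for x y
    by (auto simp: orthogonal_transformation_def norm_eq_sqrt_inner)
  show "norm (R *v x) = norm x" by (rule norm)
  show diff: "rotate_config R v $ i - rotate_config R v $ j = R *v (v $ i - v $ j)" for i j
    by (simp add: rotate_config_def matrix_vector_mult_diff_distrib)
  show mi: "minner m (rotate_config R v) (rotate_config R w) = minner m v w" for v w :: "('d, 'n) config"
    by (simp add: minner_def rotate_config_def inner)
  show "mnorm m (rotate_config R v) = mnorm m v"
    by (simp add: mnorm_def mi)
  show EE: "rotate_config R v \<in> EE m" if "v \<in> EE m"
  proof -
    have "(\<Sum>i\<in>UNIV. m i *\<^sub>R rotate_config R v $ i) = R *v (\<Sum>i\<in>UNIV. m i *\<^sub>R v $ i)"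
      by (simp add: rotate_config_def matrix_vector_mult_scaleR linear_sum[OF matrix_vector_mul_linear])
    then show ?thesis using that by (simp add: EE_def)
  qed
  have "rotate_config R v $ i = rotate_config R v $ j \<longleftrightarrow> v $ i = v $ j" for i j
    using norm[of "v $ i - v $ j"] by (metis diff eq_iff_diff_eq_0 norm_eq_zero)
  then have "rotate_config R v \<in> Coll \<longleftrightarrow> v \<in> Coll" by (simp add: Coll_def)
  then show "rotate_config R v \<in> Ehat m" if "v \<in> Ehat m" using that by (simp add: Ehat_def EE)
qed

lemma scatters_rotate:
  fixes R :: "real ^ 'd ^ 'd"
  assumes R: "orthogonal_matrix R" and A: "A \<in> Ehat m" "A' \<in> Ehat m" and sc: "scatters m A A'"
  shows "scatters m (rotate_config R A) (rotate_config R A')"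
proof -
  note norm = rotate_norm[OF R] and diff = rotate_diff[OF R] and mi = minner_rotate[OF R]
    and mn = mnorm_rotate[OF R] and EE = rotate_in_EE[OF R] and Eh = rotate_in_Ehat[OF R]
  have lin: "bounded_linear (rotate_config R :: ('d, 'n) config \<Rightarrow> _)"
    unfolding linear_conv_bounded_linear [symmetric] rotate_config_def
    by (auto intro!: linearI simp: vec_eq_iff matrix_vector_right_distrib matrix_vector_mult_scaleR)
  interpret r: bounded_linear "rotate_config R :: ('d, 'n) config \<Rightarrow> _" by (rule lin)
  have Sh: "rotate_config R v \<in> Shat m 1" if "v \<in> Shat m 1" for v :: "('d, 'n) config"
    using that by (simp add: Shat_def Eh mn)
  have kern: "kern (R *v x) = R *v kern x" for x
    by (simp add: kern_def norm matrix_vector_mult_scaleR)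
  have force: "force m (rotate_config R q) = rotate_config R (force m q)" for q :: "('d, 'n) config"
  proof -
    have "force m (rotate_config R q) $ i = rotate_config R (force m q) $ i" for i
      by (simp add: force_def diff kern) (simp add: rotate_config_def force_def matrix_vector_mult_scaleR linear_sum[OF matrix_vector_mul_linear])
    then show ?thesis by (simp add: vec_eq_iff)
  qed
  have pot: "pot m (rotate_config R q) = pot m q" for q :: "('d, 'n) config"
    by (simp add: pot_def diff norm)
  let ?T = "\<lambda>(\<rho>, s, v, w). (\<rho>, rotate_config R s, v, rotate_config R w) :: ('d, 'n) state"
  show "scatters m (rotate_config R A) (rotate_config R A')"
  proof (rule scatters_transport[where T = ?T and c = 1, OF A Eh[OF A(1)] Eh[OF A(2)] _ _ _ _ _ _ sc])
    show "bounded_linear ?T"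
      unfolding case_prod_unfold
      by (intro bounded_linear_intros bounded_linear_compose[OF lin])
    fix x :: "('d, 'n) state" assume x: "x \<in> phase m"
    obtain \<rho> s v w where [simp]: "x = (\<rho>, s, v, w)" by (cases x)
    show Tx: "?T x \<in> phase m"
      using x by (auto simp: phase_def mi mn pot Sh EE)
    show "vfield m (?T x) = 1 *\<^sub>R ?T (vfield m x)"
      by (simp only: vfield_phase[OF x] vfield_phase[OF Tx])
        (simp add: mi pot force r.add r.diff r.scaleR)
  qed (simp_all add: minus_infinity_def plus_infinity_def mn r.scaleR r.neg r.zero)
qed

end

section \<open>From Newton's equation to scattering orbits\<close>

text \<open>
  Comparison with \<open>ln t / C\<close>.
\<close>

lemma filterlim_at_top_of_log_derivative:
  fixes \<sigma> :: "real \<Rightarrow> real"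
  assumes der: "\<And>t. (\<sigma> has_real_derivative 1 / r t) (at t)" and pos: "\<And>t. r t > 0"
    and bound: "eventually (\<lambda>t. r t \<le> C * t) at_top"
  shows "filterlim \<sigma> at_top at_top"
proof -
  obtain T where "\<And>t. t \<ge> T \<Longrightarrow> r t \<le> C * t" using bound by (auto simp: eventually_at_top_linorder)
  then obtain T where T: "\<And>t. t \<ge> T \<Longrightarrow> r t \<le> C * t" "T \<ge> 1"
    by (meson max.cobounded1 max.cobounded2 order_trans)
  have "0 < r T" "r T \<le> C * T" using T pos by auto
  then have C: "C > 0" using T(2) by (smt (verit) mult_nonpos_nonneg)
  have mono: "\<sigma> T - ln T / C \<le> \<sigma> t - ln t / C" if "t \<ge> T" for t
  proof (rule DERIV_nonneg_imp_nondecreasing[OF that])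
    fix s assume s: "T \<le> s" "s \<le> t"
    have "((\<lambda>t. \<sigma> t - ln t / C) has_real_derivative 1 / r s - 1 / s / C) (at s)"
      using s T(2) C by (auto intro!: derivative_eq_intros der)
    moreover have "1 / s / C \<le> 1 / r s"
    proof -
      have "1 / (C * s) \<le> 1 / r s"
        using T(1)[of s] s pos[of s] T(2) C by (intro divide_left_mono mult_pos_pos) auto
      then show ?thesis by (simp add: mult.commute)
    qed
    ultimately show "\<exists>y. ((\<lambda>t. \<sigma> t - ln t / C) has_real_derivative y) (at s) \<and> 0 \<le> y"
      by (intro exI[of _ "1 / r s - 1 / s / C"]) simp
  qed
  have "filterlim (\<lambda>t. (\<sigma> T - ln T / C) + (1 / C) * ln t) at_top at_top"
    using C by (intro filterlim_tendsto_add_at_top[OF tendsto_const]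
        filterlim_tendsto_pos_mult_at_top[OF tendsto_const] ln_at_top) auto
  then show ?thesis
    by (rule filterlim_at_top_mono) (use mono in \<open>auto simp: eventually_at_top_linorder field_simps intro!: exI[of _ T]\<close>)
qed

text \<open>
  The blown-up time \<open>\<tau>\<close> satisfies \<open>d\<tau> = dt / r\<close>. As
  \<open>r\<close> grows at most linearly, \<open>\<tau>\<close> runs through all of the real line,
  and \<open>\<theta>\<close> is the Newtonian time as a function of \<open>\<tau>\<close>.
\<close>

lemma time_change:
  fixes r :: "real \<Rightarrow> real"
  assumes cont: "continuous_on UNIV r" and pos: "\<And>t. r t > 0"
    and top: "eventually (\<lambda>t. r t \<le> C * t) at_top" and bot: "eventually (\<lambda>t. r t \<le> C' * (- t)) at_bot"
  obtains \<theta> where "\<And>\<tau>. (\<theta> has_real_derivative r (\<theta> \<tau>)) (at \<tau>)"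
    "filterlim \<theta> at_top at_top" "filterlim \<theta> at_bot at_bot"
proof -
  have "isCont (\<lambda>t. 1 / r t) t" for t
    using cont pos[of t] by (auto intro!: continuous_intros simp: continuous_on_eq_continuous_at)
  then obtain \<sigma> where "\<And>t. (\<sigma> has_vector_derivative 1 / r t) (at t)"
    using einterval_antiderivative[of "-\<infinity>" \<infinity> "\<lambda>t. 1 / r t"] by auto
  then have \<sigma>: "(\<sigma> has_real_derivative 1 / r t) (at t)" for t
    by (simp add: has_real_derivative_iff_has_vector_derivative)
  have up: "filterlim \<sigma> at_top at_top"
    by (rule filterlim_at_top_of_log_derivative[OF \<sigma> pos top])
  have \<sigma>m: "((\<lambda>t. - \<sigma> (- t)) has_real_derivative 1 / r (- t)) (at t)" for t
  proof -
    have "((\<lambda>t. \<sigma> (- t)) has_real_derivative (1 / r (- t)) * (-1)) (at t)"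
      by (rule DERIV_chain2[of \<sigma> _ uminus]) (auto intro!: derivative_eq_intros \<sigma>)
    from DERIV_minus[OF this] show ?thesis by simp
  qed
  have "filterlim (\<lambda>t. - \<sigma> (- t)) at_top at_top"
    using bot unfolding at_bot_mirror eventually_filtermap
    by (intro filterlim_at_top_of_log_derivative[OF \<sigma>m pos]) simp
  then have down: "filterlim \<sigma> at_bot at_bot"
    unfolding filterlim_uminus_at_top [symmetric] filterlim_at_bot_mirror filterlim_uminus_at_bot by simp
  have smono: "\<sigma> x < \<sigma> y" if "x < y" for x y
    by (rule DERIV_pos_imp_increasing[OF that]) (use \<sigma> pos in \<open>auto intro!: exI[of _ "1 / r _"]\<close>)
  then have inj: "inj \<sigma>" by (metis injI linorder_less_linear less_irrefl)
  have contS: "continuous_on UNIV \<sigma>" using \<sigma> by (metis DERIV_isCont continuous_at_imp_continuous_on)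
  have surj: "\<exists>t. \<sigma> t = y" for y
  proof -
    obtain b where b: "y \<le> \<sigma> b" using up by (metis eventually_at_top_linorder filterlim_at_top order_refl)
    obtain a where a: "\<sigma> a \<le> y" using down by (metis eventually_at_bot_linorder filterlim_at_bot order_refl)
    have ab: "a \<le> b" using smono[of b a] a b by linarith
    show ?thesis using IVT'[OF a b ab] continuous_on_subset[OF contS] by blast
  qed
  define \<theta> where "\<theta> = inv \<sigma>"
  have \<theta>\<sigma>: "\<theta> (\<sigma> t) = t" for t unfolding \<theta>_def using inj by simp
  have \<sigma>\<theta>: "\<sigma> (\<theta> \<tau>) = \<tau>" for \<tau> unfolding \<theta>_def using surj[of \<tau>] by (metis f_inv_into_f rangeI)
  show ?thesis
  proof (rule that[of \<theta>])
    fix \<tau>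
    have "(\<theta> has_derivative (*) (r (\<theta> \<tau>))) (at (\<sigma> (\<theta> \<tau>)))"
    proof (rule has_derivative_inverse_strong[OF open_UNIV UNIV_I contS \<theta>\<sigma>])
      show "(\<sigma> has_derivative (*) (1 / r (\<theta> \<tau>))) (at (\<theta> \<tau>))"
        using \<sigma>[of "\<theta> \<tau>"] by (simp only: has_field_derivative_def)
      show "(*) (1 / r (\<theta> \<tau>)) \<circ> (*) (r (\<theta> \<tau>)) = id" using pos[of "\<theta> \<tau>"] by (auto simp: fun_eq_iff)
    qed
    then show "(\<theta> has_real_derivative r (\<theta> \<tau>)) (at \<tau>)" by (simp add: has_field_derivative_def \<sigma>\<theta>)
  next
    have mono: "\<theta> x \<le> \<theta> y" if "x \<le> y" for x y
      using smono[of "\<theta> y" "\<theta> x"] that \<sigma>\<theta> by (metis linorder_not_le)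
    show "filterlim \<theta> at_top at_top" unfolding filterlim_at_top eventually_at_top_linorder
      using mono \<theta>\<sigma> by metis
    show "filterlim \<theta> at_bot at_bot" unfolding filterlim_at_bot eventually_at_bot_linorder
      using mono \<theta>\<sigma> by metis
  qed
qed

text \<open>
  After a time \<open>T\<close> the velocity differs from \<open>A\<close> by at most \<open>e /
  2\<close>, and what happened before \<open>T\<close> does not matter after division by
  \<open>t\<close>.
\<close>

lemma mean_velocity_limit_at_top:
  fixes q :: "real \<Rightarrow> 'a::real_normed_vector"
  assumes der: "\<And>t. (q has_vector_derivative p t) (at t)" and lim: "(p \<longlongrightarrow> A) at_top"
  shows "((\<lambda>t. q t /\<^sub>R t) \<longlongrightarrow> A) at_top"
proof (rule tendstoI)
  fix e :: real assume e: "e > 0"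
  obtain T where T: "\<And>t. t \<ge> T \<Longrightarrow> dist (p t) A < e / 2"
    using tendstoD[OF lim, of "e / 2"] e by (auto simp: eventually_at_top_linorder)
  define D where "D = norm (q T - T *\<^sub>R A) + \<bar>T\<bar> * e"
  have dq: "((\<lambda>t. q t - t *\<^sub>R A) has_vector_derivative (p t - A)) (at t)" for t
    by (auto intro!: derivative_eq_intros der)
  have bound: "norm (q t - t *\<^sub>R A) \<le> D + e / 2 * t" if "t > T" for t
  proof -
    have "norm ((q t - t *\<^sub>R A) - (q T - T *\<^sub>R A)) \<le> e / 2 * t - e / 2 * T"
    proof (rule differentiable_bound_general[OF that, where f' = "\<lambda>t. p t - A" and \<phi>' = "\<lambda>_. e / 2"])
      show "continuous_on {T..t} (\<lambda>t. q t - t *\<^sub>R A)"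
        using dq by (meson continuous_at_imp_continuous_on has_vector_derivative_continuous)
      show "norm (p x - A) \<le> e / 2" if "T < x" for x using T[of x] that by (simp add: dist_norm)
    qed (auto intro!: continuous_intros derivative_eq_intros dq simp: has_real_derivative_iff_has_vector_derivative[symmetric])
    then have "norm (q t - t *\<^sub>R A) \<le> norm (q T - T *\<^sub>R A) + (e / 2 * t - e / 2 * T)"
      by (smt (verit) norm_triangle_ineq2)
    moreover have "- (e / 2 * T) \<le> \<bar>T\<bar> * e"
    proof -
      have "e * (- T) \<le> e * \<bar>T\<bar>" using e by (intro mult_left_mono) auto
      moreover have "0 \<le> e * \<bar>T\<bar>" using e by simp
      moreover have "- (e / 2 * T) = e * (- T) / 2" "\<bar>T\<bar> * e = e * \<bar>T\<bar>" by simp_all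
      ultimately show ?thesis by linarith
    qed
    ultimately show ?thesis by (simp add: D_def)
  qed
  have D: "D \<ge> 0" using e by (simp add: D_def)
  show "eventually (\<lambda>t. dist (q t /\<^sub>R t) A < e) at_top"
    using eventually_gt_at_top[of T] eventually_gt_at_top[of "2 * D / e"] eventually_gt_at_top[of 0]
  proof eventually_elim
    case (elim t)
    have "q t /\<^sub>R t - A = (q t - t *\<^sub>R A) /\<^sub>R t" using elim by (simp add: scaleR_diff_right)
    then have "dist (q t /\<^sub>R t) A = norm (q t - t *\<^sub>R A) / t"
      using elim by (simp add: dist_norm divide_inverse mult.commute)
    also have "\<dots> \<le> (D + e / 2 * t) / t" using bound elim by (intro divide_right_mono) auto
    also have "\<dots> < e" using elim e by (simp add: field_simps)
    finally show ?case .
  qed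
qed

lemma mean_velocity_limit_at_bot:
  fixes q :: "real \<Rightarrow> 'a::real_normed_vector"
  assumes der: "\<And>t. (q has_vector_derivative p t) (at t)" and lim: "(p \<longlongrightarrow> A) at_bot"
  shows "((\<lambda>t. q t /\<^sub>R t) \<longlongrightarrow> A) at_bot"
proof -
  have d: "((\<lambda>t. q (- t)) has_vector_derivative - p (- t)) (at t)" for t
  proof -
    have "((\<lambda>t::real. - t) has_vector_derivative -1) (at t)" by (auto intro!: derivative_eq_intros)
    from vector_diff_chain_at[OF this der] show ?thesis by (simp add: o_def)
  qed
  have l: "((\<lambda>t. - p (- t)) \<longlongrightarrow> - A) at_top"
    by (intro tendsto_minus filterlim_compose[OF lim] filterlim_uminus_at_bot_at_top)
  have "((\<lambda>t. q (- t) /\<^sub>R t) \<longlongrightarrow> - A) at_top" by (rule mean_velocity_limit_at_top[OF d l])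
  then have "((\<lambda>t. - (q (- t) /\<^sub>R t)) \<longlongrightarrow> A) at_top" using tendsto_minus by fastforce
  then show ?thesis unfolding filterlim_at_bot_mirror by simp
qed

lemma has_vector_derivative_zero_UNIV:
  fixes f :: "real \<Rightarrow> 'a::real_normed_vector"
  assumes "\<And>t. (f has_vector_derivative 0) (at t)"
  shows "f t = f s"
  using has_vector_derivative_zero_constant[of UNIV f] assms by (metis UNIV_I convex_UNIV)

lemma force_scaleR:
  assumes "c > 0" shows "force m (c *\<^sub>R q) = force m q /\<^sub>R c\<^sup>2"
proof -
  have "force m (c *\<^sub>R q) $ i = (force m q /\<^sub>R c\<^sup>2) $ i" for i
    using assms by (simp add: force_def kern_scaleR scaleR_diff_right[symmetric] scaleR_sum_right
        mult.commute del: scaleR_diff_right)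
  then show ?thesis by (simp add: vec_eq_iff)
qed

lemma pot_scaleR:
  assumes "c > 0" shows "pot m (c *\<^sub>R q) = pot m q / c"
  using assms by (simp add: pot_def scaleR_diff_right[symmetric] sum_divide_distrib case_prod_beta
      mult.commute del: scaleR_diff_right)

lemma kern_inner_self: "kern x \<bullet> x = 1 / norm x"
  by (cases "x = 0")
    (simp_all add: kern_def power2_norm_eq_inner[symmetric] power3_eq_cube power2_eq_square divide_simps)

text \<open>
  Euler's identity for the potential, which is homogeneous of degree \<open>- 1\<close>.
\<close>

lemma minner_force_self: "minner m (force m q) q = - pot m q"
  unfolding minner_force pot_def by (simp add: sum_negf case_prod_beta kern_inner_self)

context masses begin

lemma tendsto_mnorm:
  "(f \<longlongrightarrow> l) F \<Longrightarrow> ((\<lambda>x. mnorm m (f x)) \<longlongrightarrow> mnorm m l) F"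
  unfolding mnorm_def by (intro tendsto_intros minner.tendsto)

text \<open>
  The total force vanishes, so the momentum is constant, and its value is read off at \<open>-
  \<infinity>\<close>.
\<close>

lemma newton_in_EE:
  fixes q :: "real \<Rightarrow> ('d::finite, 'n) config"
  assumes q: "\<And>t. (q has_vector_derivative p t) (at t)"
    and p: "\<And>t. (p has_vector_derivative \<epsilon> *\<^sub>R force m (q t)) (at t)"
    and lim: "(p \<longlongrightarrow> A) at_bot" and A: "A \<in> EE m" and q0: "q 0 \<in> EE m"
  shows "p t \<in> EE m" "q t \<in> EE m"
proof -
  let ?\<sigma> = "\<lambda>x :: ('d, 'n) config. \<Sum>i\<in>UNIV. m i *\<^sub>R x $ i"
  have lin: "bounded_linear ?\<sigma>"
    unfolding linear_conv_bounded_linear [symmetric]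
    by (auto intro!: linearI simp: algebra_simps sum.distrib scaleR_sum_right)
  have EE: "x \<in> EE m \<longleftrightarrow> ?\<sigma> x = 0" for x by (simp add: EE_def)
  have "((\<lambda>t. ?\<sigma> (p t)) has_vector_derivative 0) (at t)" for t
  proof -
    have "?\<sigma> (\<epsilon> *\<^sub>R force m (q t)) = 0" using EE_closed(3)[OF force_in_EE] EE by blast
    with bounded_linear.has_vector_derivative[OF lin p[of t]] show ?thesis by (simp only:)
  qed
  then have "(\<lambda>s. ?\<sigma> (p s)) = (\<lambda>s. ?\<sigma> (p t))" for t
    using has_vector_derivative_zero_UNIV[of "\<lambda>t. ?\<sigma> (p t)"] by blast
  moreover have "((\<lambda>s. ?\<sigma> (p s)) \<longlongrightarrow> ?\<sigma> A) at_bot" by (rule bounded_linear.tendsto[OF lin lim])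
  ultimately have "((\<lambda>s. ?\<sigma> (p t)) \<longlongrightarrow> ?\<sigma> A) (at_bot :: real filter)" for t by (simp only:)
  then have p0: "?\<sigma> (p t) = 0" for t using A by (simp add: tendsto_const_iff EE)
  then show "p t \<in> EE m" by (simp only: EE)
  have "((\<lambda>t. ?\<sigma> (q t)) has_vector_derivative 0) (at t)" for t
    using bounded_linear.has_vector_derivative[OF lin q[of t]] p0[of t] by (simp only:)
  then have "?\<sigma> (q t) = ?\<sigma> (q 0)"
    by (rule has_vector_derivative_zero_UNIV)
  then show "q t \<in> EE m" using q0 by (simp add: EE)
qed

text \<open>
  The change of variables from position and velocity to \<open>(\<rho>, s, v, w)\<close>. If
  \<open>q'' = \<epsilon> \<nabla>U(q)\<close>, then \<open>q / \<epsilon>\<close> in the time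
  \<open>t / \<epsilon>\<close> solves Newton's equation with \<open>\<epsilon> = 1\<close>, which
  is why \<open>\<rho>\<close> is \<open>\<epsilon> / \<parallel>q\<parallel>\<close>; for
  \<open>\<epsilon> = 0\<close> the formula still makes sense and describes free motion.
\<close>

definition blow_up :: "real \<Rightarrow> ('d::finite, 'n) config \<Rightarrow> ('d, 'n) config \<Rightarrow> ('d, 'n) state"
  where "blow_up \<epsilon> q p = (\<epsilon> / mnorm m q, q /\<^sub>R mnorm m q, minner m q p / mnorm m q,
     p - (minner m q p / mnorm m q) *\<^sub>R (q /\<^sub>R mnorm m q))"

lemma blow_up_phase:
  assumes q: "q \<in> Ehat m" and p: "p \<in> EE m" and \<epsilon>: "\<epsilon> \<ge> 0"
    and en: "minner m p p / 2 - \<epsilon> * pot m q > 0"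
  shows "blow_up \<epsilon> q p \<in> phase m"
proof -
  define r s v w where "r = mnorm m q" and "s = q /\<^sub>R r" and "v = minner m q p / r" and "w = p - v *\<^sub>R s"
  have r: "r > 0" using Ehat_nonzero[OF q] by (simp add: r_def)
  have s: "s \<in> Shat m 1" unfolding s_def r_def by (rule unit_in_Shat[OF q])
  have ss: "minner m s s = 1" using s mnorm_sq[of s] by (simp add: Shat_def)
  have sp: "minner m s p = v" by (simp add: s_def v_def minner.scaleR_left divide_inverse mult.commute)
  have sw: "minner m s w = 0" by (simp add: w_def minner.diff_right minner.scaleR_right ss sp)
  have "minner m p p = minner m (w + v *\<^sub>R s) (w + v *\<^sub>R s)" by (simp add: w_def)
  also have "\<dots> = minner m w w + v\<^sup>2"
    using sw by (simp add: minner.add_left minner.add_right minner.scaleR_left minner.scaleR_right ss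
        minner_commute[of m w s] power2_eq_square)
  finally have pp: "minner m p p = minner m w w + v\<^sup>2" .
  have "pot m q = pot m (r *\<^sub>R s)" using r by (simp add: s_def)
  then have "\<epsilon> / r * pot m s = \<epsilon> * pot m q" using r by (simp add: pot_scaleR)
  then have "v\<^sup>2 / 2 + (mnorm m w)\<^sup>2 / 2 - \<epsilon> / r * pot m s > 0" using en pp by (simp add: mnorm_sq)
  moreover have "w \<in> EE m" using p s by (auto simp: w_def Shat_def Ehat_def intro!: EE_closed)
  ultimately have "(\<epsilon> / r, s, v, w) \<in> phase m" using s sw \<epsilon> r by (simp add: phase_def)
  then show ?thesis by (simp add: blow_up_def r_def s_def v_def w_def)
qed

lemma mnorm_has_real_derivative:
  assumes "(q has_vector_derivative p) (at t)" "q t \<noteq> 0"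
  shows "((\<lambda>t. mnorm m (q t)) has_real_derivative minner m (q t) p / mnorm m (q t)) (at t)"
proof -
  have "((\<lambda>t. minner m (q t) (q t)) has_real_derivative 2 * minner m (q t) p) (at t)"
    using minner.has_vector_derivative[OF assms(1) assms(1), of m]
    by (simp add: has_real_derivative_iff_has_vector_derivative minner_commute)
  then show ?thesis unfolding mnorm_def
    using minner_pos[OF assms(2)] by (auto intro!: derivative_eq_intros simp: field_simps)
qed

lemma blow_up_derivative:
  assumes q: "(q has_vector_derivative p t) (at t)"
    and p: "(p has_vector_derivative \<epsilon> *\<^sub>R force m (q t)) (at t)"
    and E: "q t \<in> Ehat m" and ph: "blow_up \<epsilon> (q t) (p t) \<in> phase m"
  shows "((\<lambda>t. blow_up \<epsilon> (q t) (p t)) has_vector_derivative vfield m (blow_up \<epsilon> (q t) (p t)) /\<^sub>R mnorm m (q t)) (at t)"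
proof -
  define r s v w where "r = (\<lambda>t. mnorm m (q t))" and "s = (\<lambda>t. q t /\<^sub>R r t)"
    and "v = (\<lambda>t. minner m (q t) (p t) / r t)" and "w = (\<lambda>t. p t - v t *\<^sub>R s t)"
  have r0: "r t > 0" using Ehat_nonzero[OF E] by (simp add: r_def)
  have qt: "q t = r t *\<^sub>R s t" using r0 by (simp add: s_def)
  have ss: "minner m (s t) (s t) = 1"
    using unit_in_Shat[OF E] mnorm_sq[of "s t"] by (simp add: Shat_def s_def r_def)
  have sp: "minner m (s t) (p t) = v t"
    by (simp add: s_def v_def minner.scaleR_left divide_inverse mult.commute)
  have sw: "minner m (s t) (w t) = 0" by (simp add: w_def minner.diff_right minner.scaleR_right ss sp)
  have wp: "minner m (w t) (p t) = minner m (w t) (w t)"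
  proof -
    have "p t = w t + v t *\<^sub>R s t" by (simp add: w_def)
    then show ?thesis using sw by (simp add: minner.add_right minner.scaleR_right minner_commute[of m "w t" "s t"])
  qed
  have F: "force m (q t) = force m (s t) /\<^sub>R (r t)\<^sup>2" unfolding qt by (rule force_scaleR[OF r0])
  have sF: "minner m (s t) (force m (q t)) = - pot m (s t) / (r t)\<^sup>2"
    unfolding F by (simp add: minner.scaleR_right minner_commute[of m "s t" "force m (s t)"] minner_force_self divide_inverse mult.commute)
  have dr: "(r has_real_derivative v t) (at t)"
    unfolding r_def v_def by (rule mnorm_has_real_derivative[OF q Ehat_nonzero[OF E]])
  have drho: "((\<lambda>t. \<epsilon> / r t) has_real_derivative - v t * (\<epsilon> / r t) / r t) (at t)"
    using r0 by (auto intro!: derivative_eq_intros dr simp: field_simps power2_eq_square)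
  have dinv: "((\<lambda>t. inverse (r t)) has_real_derivative - v t / (r t)\<^sup>2) (at t)"
    using r0 by (auto intro!: derivative_eq_intros dr simp: field_simps power2_eq_square)
  have "(s has_vector_derivative (inverse (r t) *\<^sub>R p t + (- v t / (r t)\<^sup>2) *\<^sub>R q t)) (at t)"
    unfolding s_def by (rule has_vector_derivative_scaleR[OF dinv q])
  moreover have "inverse (r t) *\<^sub>R p t + (- v t / (r t)\<^sup>2) *\<^sub>R q t = w t /\<^sub>R r t"
    unfolding w_def qt using r0 by (simp add: scaleR_diff_right power2_eq_square field_simps)
  ultimately have ds: "(s has_vector_derivative w t /\<^sub>R r t) (at t)" by simp
  have vs: "v = (\<lambda>t. minner m (s t) (p t))"
    by (simp add: v_def s_def minner.scaleR_left divide_inverse mult.commute)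
  have "(v has_vector_derivative (minner m (s t) (\<epsilon> *\<^sub>R force m (q t)) + minner m (w t /\<^sub>R r t) (p t))) (at t)"
    unfolding vs by (rule minner.has_vector_derivative[OF ds p])
  moreover have "minner m (s t) (\<epsilon> *\<^sub>R force m (q t)) + minner m (w t /\<^sub>R r t) (p t)
     = (minner m (w t) (w t) - \<epsilon> / r t * pot m (s t)) / r t"
    using r0 by (simp add: minner.scaleR_right minner.scaleR_left wp sF power2_eq_square field_simps)
  ultimately have dv: "(v has_real_derivative (minner m (w t) (w t) - \<epsilon> / r t * pot m (s t)) / r t) (at t)"
    by (simp add: has_real_derivative_iff_has_vector_derivative)
  have "(w has_vector_derivative (\<epsilon> *\<^sub>R force m (q t) - (v t *\<^sub>R (w t /\<^sub>R r t)
      + ((minner m (w t) (w t) - \<epsilon> / r t * pot m (s t)) / r t) *\<^sub>R s t))) (at t)"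
    unfolding w_def by (intro has_vector_derivative_diff p has_vector_derivative_scaleR[OF dv[unfolded w_def] ds[unfolded w_def]])
  moreover have "\<epsilon> *\<^sub>R force m (q t) - (v t *\<^sub>R (w t /\<^sub>R r t) + ((minner m (w t) (w t) - \<epsilon> / r t * pot m (s t)) / r t) *\<^sub>R s t)
    = ((\<epsilon> / r t) *\<^sub>R (force m (s t) + pot m (s t) *\<^sub>R s t) - v t *\<^sub>R w t - minner m (w t) (w t) *\<^sub>R s t) /\<^sub>R r t"
    unfolding F using r0 by (simp add: algebra_simps power2_eq_square divide_inverse)
  ultimately have dw: "(w has_vector_derivative ((\<epsilon> / r t) *\<^sub>R (force m (s t) + pot m (s t) *\<^sub>R s t) - v t *\<^sub>R w t - minner m (w t) (w t) *\<^sub>R s t) /\<^sub>R r t) (at t)"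
    by simp
  have bu: "blow_up \<epsilon> (q t) (p t) = (\<epsilon> / r t, s t, v t, w t)" for t
    by (simp add: blow_up_def r_def s_def v_def w_def)
  have "((\<lambda>t. (\<epsilon> / r t, s t, v t, w t)) has_vector_derivative
    (- v t * (\<epsilon> / r t) / r t, w t /\<^sub>R r t, (minner m (w t) (w t) - \<epsilon> / r t * pot m (s t)) / r t,
     ((\<epsilon> / r t) *\<^sub>R (force m (s t) + pot m (s t) *\<^sub>R s t) - v t *\<^sub>R w t - minner m (w t) (w t) *\<^sub>R s t) /\<^sub>R r t)) (at t)"
    using drho dv by (intro has_vector_derivative_Pair ds dw) (auto simp: has_real_derivative_iff_has_vector_derivative)
  moreover have "(- v t * (\<epsilon> / r t) / r t, w t /\<^sub>R r t, (minner m (w t) (w t) - \<epsilon> / r t * pot m (s t)) / r t,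
     ((\<epsilon> / r t) *\<^sub>R (force m (s t) + pot m (s t) *\<^sub>R s t) - v t *\<^sub>R w t - minner m (w t) (w t) *\<^sub>R s t) /\<^sub>R r t)
     = vfield m (blow_up \<epsilon> (q t) (p t)) /\<^sub>R r t"
    by (simp only: vfield_phase[OF ph]) (simp add: bu divide_inverse)
  ultimately have "((\<lambda>t. (\<epsilon> / r t, s t, v t, w t)) has_vector_derivative vfield m (blow_up \<epsilon> (q t) (p t)) /\<^sub>R r t) (at t)"
    by (simp only:)
  then show ?thesis by (simp only: bu r_def)
qed

text \<open>
  \<open>\<kappa>\<close> is \<open>1\<close> in the future and \<open>- 1\<close> in the past,
  where \<open>q\<close> is close to \<open>t A\<close> with \<open>t < 0\<close> and points
  opposite to its velocity.
\<close>

lemma blow_up_limit: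
  assumes p: "(p \<longlongrightarrow> A) F" and A: "A \<in> Ehat m"
    and s: "((\<lambda>t. q t /\<^sub>R mnorm m (q t)) \<longlongrightarrow> \<kappa> *\<^sub>R (A /\<^sub>R mnorm m A)) F" and \<kappa>: "\<kappa>\<^sup>2 = 1"
    and r: "((\<lambda>t. inverse (mnorm m (q t))) \<longlongrightarrow> 0) F"
  shows "((\<lambda>t. blow_up \<epsilon> (q t) (p t)) \<longlongrightarrow> (0, \<kappa> *\<^sub>R (A /\<^sub>R mnorm m A), \<kappa> * mnorm m A, 0)) F"
proof -
  have A0: "mnorm m A > 0" using Ehat_nonzero[OF A] by simp
  have "((\<lambda>t. minner m (q t /\<^sub>R mnorm m (q t)) (p t)) \<longlongrightarrow> minner m (\<kappa> *\<^sub>R (A /\<^sub>R mnorm m A)) A) F"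
    by (rule minner.tendsto[OF s p])
  moreover have "minner m (\<kappa> *\<^sub>R (A /\<^sub>R mnorm m A)) A = \<kappa> * mnorm m A"
    using A0 mnorm_sq[of A] by (simp add: minner.scaleR_left power2_eq_square field_simps)
  moreover have "minner m (q t /\<^sub>R mnorm m (q t)) (p t) = minner m (q t) (p t) / mnorm m (q t)" for t
    by (simp add: minner.scaleR_left divide_inverse mult.commute)
  ultimately have v: "((\<lambda>t. minner m (q t) (p t) / mnorm m (q t)) \<longlongrightarrow> \<kappa> * mnorm m A) F"
    by (simp only:)
  have "((\<lambda>t. p t - (minner m (q t) (p t) / mnorm m (q t)) *\<^sub>R (q t /\<^sub>R mnorm m (q t))) \<longlongrightarrow>
     A - (\<kappa> * mnorm m A) *\<^sub>R (\<kappa> *\<^sub>R (A /\<^sub>R mnorm m A))) F"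
    by (intro tendsto_intros p v s)
  moreover have "A - (\<kappa> * mnorm m A) *\<^sub>R (\<kappa> *\<^sub>R (A /\<^sub>R mnorm m A)) = 0"
  proof -
    have "\<kappa> * mnorm m A * (\<kappa> * inverse (mnorm m A)) = \<kappa>\<^sup>2"
      using A0 by (simp add: power2_eq_square)
    then show ?thesis using \<kappa> by simp
  qed
  ultimately have w: "((\<lambda>t. p t - (minner m (q t) (p t) / mnorm m (q t)) *\<^sub>R (q t /\<^sub>R mnorm m (q t))) \<longlongrightarrow> 0) F"
    by simp
  have "((\<lambda>t. \<epsilon> * inverse (mnorm m (q t))) \<longlongrightarrow> \<epsilon> * 0) F" by (intro tendsto_intros r)
  then have "((\<lambda>t. \<epsilon> / mnorm m (q t)) \<longlongrightarrow> 0) F" by (simp add: divide_inverse)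
  then show ?thesis unfolding blow_up_def by (intro tendsto_Pair s v w)
qed

text \<open>
  Since \<open>q t / t\<close> tends to the asymptotic velocities, the shape \<open>q /
  \<parallel>q\<parallel>\<close> tends to the shapes prescribed by the scattering relation and
  \<open>\<parallel>q\<parallel>\<close> grows linearly.
\<close>

theorem newton_scatters:
  assumes q: "\<And>t. (q has_vector_derivative p t) (at t)"
    and p: "\<And>t. (p has_vector_derivative \<epsilon> *\<^sub>R force m (q t)) (at t)"
    and \<epsilon>: "\<epsilon> \<ge> 0" and nc: "\<And>t. q t \<notin> Coll" and q0: "q 0 \<in> EE m"
    and en: "\<And>t. minner m (p t) (p t) / 2 - \<epsilon> * pot m (q t) > 0"
    and bot: "(p \<longlongrightarrow> A) at_bot" and top: "(p \<longlongrightarrow> A') at_top"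
    and A: "A \<in> Ehat m" and A': "A' \<in> Ehat m"
  shows "scatters m A A'"
proof -
  have AE: "A \<in> EE m" using A by (simp add: Ehat_def)
  note E = newton_in_EE[OF q p bot AE q0]
  have Eh: "q t \<in> Ehat m" for t using E(2) nc by (simp add: Ehat_def)
  have ph: "blow_up \<epsilon> (q t) (p t) \<in> phase m" for t by (rule blow_up_phase[OF Eh E(1) \<epsilon> en])
  let ?r = "\<lambda>t. mnorm m (q t)"
  have rpos: "?r t > 0" for t using Ehat_nonzero[OF Eh] by simp
  have A0: "mnorm m A > 0" "mnorm m A' > 0" using Ehat_nonzero A A' by auto
  have rcont: "continuous_on UNIV ?r"
    using mnorm_has_real_derivative[OF q Ehat_nonzero[OF Eh]] DERIV_isCont
    by (meson continuous_at_imp_continuous_on)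
  have qtop: "((\<lambda>t. q t /\<^sub>R t) \<longlongrightarrow> A') at_top" by (rule mean_velocity_limit_at_top[OF q top])
  have qbot: "((\<lambda>t. q t /\<^sub>R t) \<longlongrightarrow> A) at_bot" by (rule mean_velocity_limit_at_bot[OF q bot])
  have eq: "mnorm m (q t /\<^sub>R t) = ?r t / \<bar>t\<bar>" for t
    by (simp add: mnorm_scaleR divide_inverse mult.commute)
  have ntop: "((\<lambda>t. ?r t / \<bar>t\<bar>) \<longlongrightarrow> mnorm m A') at_top" using tendsto_mnorm[OF qtop] by (simp only: eq)
  have nbot: "((\<lambda>t. ?r t / \<bar>t\<bar>) \<longlongrightarrow> mnorm m A) at_bot" using tendsto_mnorm[OF qbot] by (simp only: eq)
  have "eventually (\<lambda>t. ?r t / \<bar>t\<bar> < mnorm m A' + 1) at_top" by (rule order_tendstoD[OF ntop]) simp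
  then have btop: "eventually (\<lambda>t. ?r t \<le> (mnorm m A' + 1) * t) at_top"
    using eventually_gt_at_top[of 0] by eventually_elim (simp add: field_simps)
  have "eventually (\<lambda>t. ?r t / \<bar>t\<bar> < mnorm m A + 1) at_bot" by (rule order_tendstoD[OF nbot]) simp
  then have bbot: "eventually (\<lambda>t. ?r t \<le> (mnorm m A + 1) * (- t)) at_bot"
    using eventually_gt_at_bot[of 0]
  proof eventually_elim
    case (elim t)
    then have "?r t < (mnorm m A + 1) * \<bar>t\<bar>" by (subst (asm) pos_divide_less_eq) auto
    then show ?case using elim by simp
  qed
  obtain \<theta> where \<theta>: "\<And>\<tau>. (\<theta> has_real_derivative ?r (\<theta> \<tau>)) (at \<tau>)"
    and \<theta>top: "filterlim \<theta> at_top at_top" and \<theta>bot: "filterlim \<theta> at_bot at_bot"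
    using time_change[OF rcont rpos btop bbot] by blast
  \<comment> \<open>The factor from \<open>\<theta>' = \<parallel>q\<parallel>\<close> cancels the one in
    \<open>blow_up_derivative\<close>.\<close>
  define \<gamma> where "\<gamma> \<tau> = blow_up \<epsilon> (q (\<theta> \<tau>)) (p (\<theta> \<tau>))" for \<tau>
  have "is_solution m \<gamma> UNIV" unfolding is_solution_def
  proof (intro ballI conjI)
    fix \<tau>
    show "\<gamma> \<tau> \<in> phase m" by (simp add: \<gamma>_def ph)
    have "((\<lambda>t. blow_up \<epsilon> (q t) (p t)) \<circ> \<theta> has_vector_derivative
       ?r (\<theta> \<tau>) *\<^sub>R (vfield m (\<gamma> \<tau>) /\<^sub>R ?r (\<theta> \<tau>))) (at \<tau>)"
      unfolding \<gamma>_def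
      by (intro vector_diff_chain_at blow_up_derivative[OF q p Eh ph])
        (use \<theta> in \<open>simp add: has_real_derivative_iff_has_vector_derivative\<close>)
    moreover have "?r (\<theta> \<tau>) \<noteq> 0" using rpos[of "\<theta> \<tau>"] by simp
    ultimately show "(\<gamma> has_vector_derivative vfield m (\<gamma> \<tau>)) (at \<tau>)"
      by (simp add: o_def \<gamma>_def[abs_def])
  qed
  moreover have "(\<gamma> \<longlongrightarrow> plus_infinity A') at_top"
  proof -
    have "((\<lambda>t. (q t /\<^sub>R t) /\<^sub>R (?r t / \<bar>t\<bar>)) \<longlongrightarrow> A' /\<^sub>R mnorm m A') at_top"
      using A0 by (intro tendsto_intros qtop ntop) simp
    moreover have "eventually (\<lambda>t. (q t /\<^sub>R t) /\<^sub>R (?r t / \<bar>t\<bar>) = q t /\<^sub>R ?r t) at_top"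
      using eventually_gt_at_top[of 0] by eventually_elim (simp add: divide_inverse)
    ultimately have "((\<lambda>t. q t /\<^sub>R ?r t) \<longlongrightarrow> A' /\<^sub>R mnorm m A') at_top"
      by (rule Lim_transform_eventually)
    then have s: "((\<lambda>t. q t /\<^sub>R ?r t) \<longlongrightarrow> 1 *\<^sub>R (A' /\<^sub>R mnorm m A')) at_top" by simp
    have "((\<lambda>t. inverse t * inverse (?r t / \<bar>t\<bar>)) \<longlongrightarrow> 0 * inverse (mnorm m A')) at_top"
      using A0 by (intro tendsto_intros ntop tendsto_inverse_0_at_top filterlim_ident) simp
    moreover have "eventually (\<lambda>t. inverse t * inverse (?r t / \<bar>t\<bar>) = inverse (?r t)) at_top"
      using eventually_gt_at_top[of 0] by eventually_elim (simp add: divide_inverse)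
    ultimately have "((\<lambda>t. inverse (?r t)) \<longlongrightarrow> 0 * inverse (mnorm m A')) at_top"
      by (rule Lim_transform_eventually)
    then have r: "((\<lambda>t. inverse (?r t)) \<longlongrightarrow> 0) at_top" by simp
    show ?thesis
      using filterlim_compose[OF blow_up_limit[OF top A' s _ r] \<theta>top] by (simp add: \<gamma>_def[abs_def] plus_infinity_def)
  qed
  moreover have "(\<gamma> \<longlongrightarrow> minus_infinity A) at_bot"
  proof -
    have "((\<lambda>t. - ((q t /\<^sub>R t) /\<^sub>R (?r t / \<bar>t\<bar>))) \<longlongrightarrow> - (A /\<^sub>R mnorm m A)) at_bot"
      using A0 by (intro tendsto_intros qbot nbot) simp
    moreover have "eventually (\<lambda>t. - ((q t /\<^sub>R t) /\<^sub>R (?r t / \<bar>t\<bar>)) = q t /\<^sub>R ?r t) at_bot"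
      using eventually_gt_at_bot[of 0] by eventually_elim (simp add: divide_inverse)
    ultimately have "((\<lambda>t. q t /\<^sub>R ?r t) \<longlongrightarrow> - (A /\<^sub>R mnorm m A)) at_bot"
      by (rule Lim_transform_eventually)
    then have s: "((\<lambda>t. q t /\<^sub>R ?r t) \<longlongrightarrow> (-1) *\<^sub>R (A /\<^sub>R mnorm m A)) at_bot" by simp
    have inv: "(inverse \<longlongrightarrow> (0 :: real)) at_bot"
      by (rule tendsto_mono[OF at_bot_le_at_infinity tendsto_inverse_0])
    have "((\<lambda>t. - (inverse t * inverse (?r t / \<bar>t\<bar>))) \<longlongrightarrow> - (0 * inverse (mnorm m A))) at_bot"
      using A0 by (intro tendsto_minus tendsto_mult inv tendsto_inverse nbot) simp
    moreover have "eventually (\<lambda>t. - (inverse t * inverse (?r t / \<bar>t\<bar>)) = inverse (?r t)) at_bot"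
      using eventually_gt_at_bot[of 0] by eventually_elim (simp add: divide_inverse)
    ultimately have "((\<lambda>t. inverse (?r t)) \<longlongrightarrow> - (0 * inverse (mnorm m A))) at_bot"
      by (rule Lim_transform_eventually)
    then have r: "((\<lambda>t. inverse (?r t)) \<longlongrightarrow> 0) at_bot" by simp
    show ?thesis
      using filterlim_compose[OF blow_up_limit[OF bot A s _ r] \<theta>bot] by (simp add: \<gamma>_def[abs_def] minus_infinity_def)
  qed
  ultimately show ?thesis using scatters_iff[OF A A'] by blast
qed

end

section \<open>Improper integrals and force estimates\<close>

text \<open>
  All integrands below are bounded by a multiple of \<open>1 / (1 + t\<^sup>2)\<close>, the
  derivative of \<open>arctan\<close>. Comparing a primitive with \<open>arctan\<close> gives both
  the existence of its limits at the two ends of time and the bounds on them.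
\<close>

lemma arctan_increment_bound:
  fixes F :: "real \<Rightarrow> 'a::real_normed_vector"
  assumes der: "\<And>t. (F has_vector_derivative f t) (at t)"
    and bound: "\<And>t. norm (f t) \<le> K / (1 + t\<^sup>2)" and st: "s \<le> t"
  shows "norm (F t - F s) \<le> K * (arctan t - arctan s)"
proof (cases "s = t")
  case False
  then have "s < t" using st by simp
  have "norm (F t - F s) \<le> K * arctan t - K * arctan s"
  proof (rule differentiable_bound_general[OF \<open>s < t\<close>, where f' = f and \<phi>' = "\<lambda>x. K / (1 + x\<^sup>2)"])
    show "continuous_on {s..t} F"
      using der by (meson continuous_at_imp_continuous_on has_vector_derivative_continuous)
    show "continuous_on {s..t} (\<lambda>x. K * arctan x)" by (intro continuous_intros)
    fix x
    show "((\<lambda>x. K * arctan x) has_vector_derivative K / (1 + x\<^sup>2)) (at x)"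
      unfolding has_real_derivative_iff_has_vector_derivative [symmetric]
      by (auto intro!: derivative_eq_intros simp: divide_inverse)
  qed (use der bound in auto)
  then show ?thesis by (simp add: algebra_simps)
qed simp

text \<open>
  \<open>arctan\<close> has a limit, so \<open>F\<close> is Cauchy at infinity.
\<close>

lemma convergent_at_top_of_arctan_bound:
  fixes F :: "real \<Rightarrow> 'a::banach"
  assumes bound: "\<And>s t. s \<le> t \<Longrightarrow> norm (F t - F s) \<le> K * (arctan t - arctan s)"
  shows "\<exists>l. (F \<longlongrightarrow> l) at_top"
proof -
  have K: "K \<ge> 0"
  proof -
    have "0 \<le> norm (F 1 - F 0)" by simp
    also have "\<dots> \<le> K * (arctan 1 - arctan 0)" using bound[of 0 1] by simp
    finally show ?thesis using pi_gt_zero by (simp add: arctan_one zero_le_mult_iff)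
  qed
  have tail: "norm (F t - F s) \<le> K * (pi / 2 - arctan s)" if "s \<le> t" for s t
  proof -
    have "K * (arctan t - arctan s) \<le> K * (pi / 2 - arctan s)"
      using K arctan_ubound[of t] by (intro mult_left_mono) auto
    then show ?thesis using bound[OF that] by linarith
  qed
  have small: "((\<lambda>s. K * (pi / 2 - arctan s)) \<longlongrightarrow> K * (pi / 2 - pi / 2)) at_top"
    by (intro tendsto_intros tendsto_arctan_at_top)
  have "Cauchy (\<lambda>n. F (real n))"
  proof (rule CauchyI)
    fix e :: real assume "e > 0"
    then have "eventually (\<lambda>s. K * (pi / 2 - arctan s) < e / 2) at_top"
      using order_tendstoD(2)[OF small, of "e / 2"] by simp
    then obtain S where S: "\<And>s. s \<ge> S \<Longrightarrow> K * (pi / 2 - arctan s) < e / 2"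
      by (auto simp: eventually_at_top_linorder)
    obtain N where N: "real N \<ge> S" using real_arch_simple by blast
    have N2: "norm (F (real n) - F (real N)) < e / 2" if "n \<ge> N" for n
      using tail[of "real N" "real n"] S[OF N] that by simp
    have "norm (F (real a) - F (real b)) < e" if "a \<ge> N" "b \<ge> N" for a b
      using N2[OF that(1)] N2[OF that(2)]
        norm_triangle_ineq4[of "F (real a) - F (real N)" "F (real b) - F (real N)"] by simp
    then show "\<exists>N. \<forall>a\<ge>N. \<forall>b\<ge>N. norm (F (real a) - F (real b)) < e" by blast
  qed
  then obtain l where l: "(\<lambda>n. F (real n)) \<longlonglongrightarrow> l" using Cauchy_convergent convergent_def by blast
  have lb: "norm (l - F s) \<le> K * (pi / 2 - arctan s)" for s
  proof (rule tendsto_upperbound)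
    show "(\<lambda>n. norm (F (real n) - F s)) \<longlonglongrightarrow> norm (l - F s)" by (intro tendsto_intros l)
    show "eventually (\<lambda>n. norm (F (real n) - F s) \<le> K * (pi / 2 - arctan s)) sequentially"
      using eventually_ge_at_top[of "nat \<lceil>s\<rceil>"] by eventually_elim (use tail in \<open>simp add: nat_le_iff ceiling_le_iff\<close>)
  qed simp
  have "((\<lambda>s. F s - l) \<longlongrightarrow> 0) at_top"
  proof (rule Lim_null_comparison)
    show "eventually (\<lambda>s. norm (F s - l) \<le> K * (pi / 2 - arctan s)) at_top"
      using lb by (auto simp: norm_minus_commute)
  qed (use small in simp)
  then have "(F \<longlongrightarrow> l) at_top" by (simp add: LIM_zero_iff)
  then show ?thesis by blast
qed

lemma convergent_at_bot_of_arctan_bound: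
  fixes F :: "real \<Rightarrow> 'a::banach"
  assumes bound: "\<And>s t. s \<le> t \<Longrightarrow> norm (F t - F s) \<le> K * (arctan t - arctan s)"
  shows "\<exists>l. (F \<longlongrightarrow> l) at_bot"
proof -
  have "\<exists>l. ((\<lambda>t. F (- t)) \<longlongrightarrow> l) at_top"
  proof (rule convergent_at_top_of_arctan_bound)
    fix s t :: real assume "s \<le> t"
    then show "norm (F (- t) - F (- s)) \<le> K * (arctan t - arctan s)"
      using bound[of "- t" "- s"] by (simp add: norm_minus_commute arctan_minus)
  qed
  then show ?thesis unfolding filterlim_at_bot_mirror .
qed

text \<open>
  The integral of \<open>f\<close> from \<open>- \<infinity>\<close> to \<open>t\<close>.
\<close>

definition vanishing_primitive :: "(real \<Rightarrow> 'a::euclidean_space) \<Rightarrow> real \<Rightarrow> 'a"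
  where "vanishing_primitive f = (SOME F. (\<forall>t. (F has_vector_derivative f t) (at t)) \<and> (F \<longlongrightarrow> 0) at_bot)"

lemma vanishing_primitive:
  fixes f :: "real \<Rightarrow> 'a::euclidean_space"
  assumes cont: "continuous_on UNIV f" and bound: "\<And>t. norm (f t) \<le> K / (1 + t\<^sup>2)"
  shows "(vanishing_primitive f has_vector_derivative f t) (at t)"
    "(vanishing_primitive f \<longlongrightarrow> 0) at_bot" "\<exists>l. (vanishing_primitive f \<longlongrightarrow> l) at_top"
proof -
  obtain F where F: "\<And>t. (F has_vector_derivative f t) (at t)"
    using einterval_antiderivative[of "-\<infinity>" \<infinity> f] cont by (auto simp: continuous_on_eq_continuous_at)
  obtain l where l: "(F \<longlongrightarrow> l) at_bot"
    using convergent_at_bot_of_arctan_bound[of F K] arctan_increment_bound[OF F bound] by blast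
  have "(\<forall>t. ((\<lambda>t. F t - l) has_vector_derivative f t) (at t)) \<and> ((\<lambda>t. F t - l) \<longlongrightarrow> 0) at_bot"
    using F tendsto_diff[OF l tendsto_const[of l]]
    by (auto intro!: derivative_eq_intros)
  then have "\<exists>F. (\<forall>t. (F has_vector_derivative f t) (at t)) \<and> (F \<longlongrightarrow> 0) at_bot" by blast
  then have *: "(\<forall>t. (vanishing_primitive f has_vector_derivative f t) (at t)) \<and> (vanishing_primitive f \<longlongrightarrow> 0) at_bot"
    unfolding vanishing_primitive_def by (rule someI_ex)
  then show 1: "(vanishing_primitive f has_vector_derivative f t) (at t)" for t by blast
  show "(vanishing_primitive f \<longlongrightarrow> 0) at_bot" using * by blast
  show "\<exists>l. (vanishing_primitive f \<longlongrightarrow> l) at_top"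
    using convergent_at_top_of_arctan_bound[of "vanishing_primitive f" K] arctan_increment_bound[OF 1 bound] by blast
qed

lemma vanishing_primitive_bound:
  fixes F :: "real \<Rightarrow> 'a::real_normed_vector"
  assumes der: "\<And>t. (F has_vector_derivative f t) (at t)"
    and bound: "\<And>t. norm (f t) \<le> K / (1 + t\<^sup>2)" and lim: "(F \<longlongrightarrow> 0) at_bot"
  shows "norm (F t) \<le> K * pi"
proof -
  have K: "K \<ge> 0" using order_trans[OF norm_ge_zero bound[of 0]] by simp
  have "norm (F t - 0) \<le> K * pi"
  proof (rule tendsto_upperbound)
    show "((\<lambda>s. norm (F t - F s)) \<longlongrightarrow> norm (F t - 0)) at_bot" by (intro tendsto_intros lim)
    show "eventually (\<lambda>s. norm (F t - F s) \<le> K * pi) at_bot"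
      using eventually_le_at_bot[of t]
    proof eventually_elim
      case (elim s)
      have "K * (arctan t - arctan s) \<le> K * pi"
        using K arctan_ubound[of t] arctan_lbound[of s] by (intro mult_left_mono) auto
      then show ?case using arctan_increment_bound[OF der bound elim] by linarith
    qed
  qed simp
  then show ?thesis by simp
qed

text \<open>
  The integral of \<open>u\<close> from \<open>0\<close> to \<open>t\<close>, for \<open>t\<close>
  of either sign.
\<close>

definition displacement :: "(real \<Rightarrow>\<^sub>C 'a::euclidean_space) \<Rightarrow> real \<Rightarrow> 'a"
  where "displacement u = (SOME R. (\<forall>t. (R has_vector_derivative u t) (at t)) \<and> R 0 = 0)"

lemma displacement:
  "(displacement u has_vector_derivative u t) (at t)" "displacement u 0 = 0"
proof -
  obtain F where F: "\<And>t. (F has_vector_derivative u t) (at t)"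
    using einterval_antiderivative[of "-\<infinity>" \<infinity> "apply_bcontfun u"] continuous_on_apply_bcontfun[of UNIV u]
    by (auto simp: continuous_on_eq_continuous_at simp del: continuous_on_apply_bcontfun)
  have "\<exists>R. (\<forall>t. (R has_vector_derivative u t) (at t)) \<and> R 0 = 0"
    using F by (intro exI[of _ "\<lambda>t. F t - F 0"]) (auto intro!: derivative_eq_intros)
  then have "(\<forall>t. (displacement u has_vector_derivative u t) (at t)) \<and> displacement u 0 = 0"
    unfolding displacement_def by (rule someI_ex)
  then show "(displacement u has_vector_derivative u t) (at t)" "displacement u 0 = 0" by auto
qed

lemma linear_growth_bound:
  fixes R :: "real \<Rightarrow> 'a::real_normed_vector"
  assumes der: "\<And>t. (R has_vector_derivative u t) (at t)" and zero: "R 0 = 0"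
    and bound: "\<And>t. norm (u t) \<le> M"
  shows "norm (R t) \<le> M * \<bar>t\<bar>"
proof -
  have "norm (R t - R 0) \<le> M * norm (t - 0)"
  proof (rule differentiable_bound[OF convex_UNIV])
    show "(R has_derivative (\<lambda>h. h *\<^sub>R u x)) (at x within UNIV)" for x
      using der[of x] by (simp add: has_vector_derivative_def)
    show "onorm (\<lambda>h. h *\<^sub>R u x) \<le> M" for x
      using bound[of x] by (intro onorm_le) (simp add: mult.commute[of M] mult_left_mono)
  qed auto
  then show ?thesis by (simp add: zero)
qed

lemma displacement_diff:
  "norm (displacement u t - displacement u' t) \<le> dist u u' * \<bar>t\<bar>"
proof (rule linear_growth_bound[where u = "\<lambda>t. u t - u' t"])
  show "((\<lambda>t. displacement u t - displacement u' t) has_vector_derivative u t - u' t) (at t)" for t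
    by (intro has_vector_derivative_diff displacement)
  show "norm (u t - u' t) \<le> dist u u'" for t using dist_bounded[of u t u'] by (simp add: dist_norm)
qed (simp add: displacement)

lemma displacement_bound: "norm u \<le> M \<Longrightarrow> norm (displacement u t) \<le> M * \<bar>t\<bar>"
  by (rule linear_growth_bound[where u = u]) (auto simp: displacement intro: order_trans[OF norm_bounded])

definition separated :: "real \<Rightarrow> ('d::finite, 'n::finite) config \<Rightarrow> bool"
  where "separated d q \<longleftrightarrow> (\<forall>i j. i \<noteq> j \<longrightarrow> d \<le> norm (q $ i - q $ j))"

lemma separated_not_Coll: "separated d q \<Longrightarrow> d > 0 \<Longrightarrow> q \<notin> Coll"
  by (force simp: separated_def Coll_def)

lemma separated_mono: "separated d q \<Longrightarrow> d' \<le> d \<Longrightarrow> separated d' q"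
  by (force simp: separated_def)

lemma separated_perturb:
  fixes q :: "('d::finite, 'n::finite) config"
  assumes sep: "separated d q" and x: "norm x \<le> e"
  shows "separated (d - 2 * e) (q + x)"
  unfolding separated_def
proof (intro allI impI)
  fix i j :: 'n assume "i \<noteq> j"
  then have "d \<le> norm (q $ i - q $ j)" using sep by (simp add: separated_def)
  moreover have "norm (q $ i - q $ j) \<le> norm ((q + x) $ i - (q + x) $ j) + norm (x $ i - x $ j)"
    using norm_triangle_ineq4[of "(q + x) $ i - (q + x) $ j" "x $ i - x $ j"] by (simp add: algebra_simps)
  moreover have "norm (x $ i - x $ j) \<le> e + e"
    using x norm_triangle_ineq4[of "x $ i" "x $ j"] Finite_Cartesian_Product.norm_nth_le[of x i]
      Finite_Cartesian_Product.norm_nth_le[of x j] by linarith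
  ultimately show "d - 2 * e \<le> norm ((q + x) $ i - (q + x) $ j)" by simp
qed

lemma norm_le_sum_components:
  fixes v :: "('b::real_normed_vector) ^ 'i::finite"
  shows "norm v \<le> (\<Sum>i\<in>UNIV. norm (v $ i))"
  unfolding norm_vec_def by (rule L2_set_le_sum) simp

context masses begin

definition force_const :: real
  where "force_const = (\<Sum>i\<in>(UNIV :: 'n set). \<Sum>j\<in>UNIV. m j)"

lemma force_const_pos: "force_const > 0"
  unfolding force_const_def by (intro sum_pos) (auto simp: mass_pos)

lemma norm_force_le:
  assumes "separated d q" "d > 0"
  shows "norm (force m q) \<le> force_const / d\<^sup>2"
proof -
  have "norm (force m q) \<le> (\<Sum>i\<in>UNIV. norm (\<Sum>j\<in>UNIV. m j *\<^sub>R kern (q $ j - q $ i)))"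
    using norm_le_sum_components[of "force m q"] by (simp add: force_def)
  also have "\<dots> \<le> (\<Sum>i\<in>(UNIV :: 'n set). \<Sum>j\<in>UNIV. m j * (1 / d\<^sup>2))"
  proof (intro sum_mono order_trans[OF norm_sum])
    fix i j
    have "norm (kern (q $ j - q $ i)) \<le> 1 / d\<^sup>2"
    proof (cases "i = j")
      case False
      then show ?thesis using assms by (intro norm_kern_le) (auto simp: separated_def)
    qed simp
    from mult_left_mono[OF this, of "m j"] show "norm (m j *\<^sub>R kern (q $ j - q $ i)) \<le> m j * (1 / d\<^sup>2)"
      using mass_pos[of j] by simp
  qed
  also have "\<dots> = force_const / d\<^sup>2" by (simp add: force_const_def flip: sum_divide_distrib)
  finally show ?thesis .
qed

lemma force_lipschitz:
  assumes "separated d q" "separated d q'" "d > 0"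
  shows "norm (force m q - force m q') \<le> 8 * force_const / d ^ 3 * norm (q - q')"
proof -
  have "norm (force m q - force m q') \<le> (\<Sum>i\<in>UNIV. norm (\<Sum>j\<in>UNIV. m j *\<^sub>R (kern (q $ j - q $ i) - kern (q' $ j - q' $ i))))"
    using norm_le_sum_components[of "force m q - force m q'"]
    by (simp add: force_def scaleR_diff_right sum_subtractf)
  also have "\<dots> \<le> (\<Sum>i\<in>(UNIV :: 'n set). \<Sum>j\<in>UNIV. m j * (8 / d ^ 3 * norm (q - q')))"
  proof (intro sum_mono order_trans[OF norm_sum])
    fix i j
    have "norm (kern (q $ j - q $ i) - kern (q' $ j - q' $ i)) \<le> 8 / d ^ 3 * norm (q - q')"
    proof (cases "i = j")
      case False
      then have "norm (kern (q $ j - q $ i) - kern (q' $ j - q' $ i)) \<le> 4 / d ^ 3 * norm ((q $ j - q $ i) - (q' $ j - q' $ i))"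
        using assms by (intro kern_lipschitz) (auto simp: separated_def)
      also have "(q $ j - q $ i) - (q' $ j - q' $ i) = (q - q') $ j - (q - q') $ i" by simp
      also have "4 / d ^ 3 * norm ((q - q') $ j - (q - q') $ i) \<le> 4 / d ^ 3 * (2 * norm (q - q'))"
      proof (rule mult_left_mono)
        show "norm ((q - q') $ j - (q - q') $ i) \<le> 2 * norm (q - q')"
          using norm_triangle_ineq4[of "(q - q') $ j" "(q - q') $ i"] Finite_Cartesian_Product.norm_nth_le[of "q - q'" i]
            Finite_Cartesian_Product.norm_nth_le[of "q - q'" j] by linarith
      qed (use assms(3) in simp)
      finally show ?thesis by simp
    qed (use assms in simp)
    from mult_left_mono[OF this, of "m j"]
    show "norm (m j *\<^sub>R (kern (q $ j - q $ i) - kern (q' $ j - q' $ i))) \<le> m j * (8 / d ^ 3 * norm (q - q'))"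
      using mass_pos[of j] by simp
  qed
  also have "\<dots> = 8 * force_const / d ^ 3 * norm (q - q')"
    by (simp add: force_const_def flip: sum_distrib_right sum_divide_distrib)
  finally show ?thesis .
qed

lemma continuous_on_force:
  assumes "continuous_on S q" "\<And>t. t \<in> S \<Longrightarrow> q t \<notin> Coll"
  shows "continuous_on S (\<lambda>t. force m (q t))"
  unfolding force_def
proof (intro continuous_on_vec_lambda continuous_on_sum)
  fix i j
  show "continuous_on S (\<lambda>t. m j *\<^sub>R kern (q t $ j - q t $ i))"
  proof (cases "i = j")
    case False
    have "q t $ j - q t $ i \<noteq> 0" if "t \<in> S" for t
      using assms(2)[OF that] False unfolding Coll_def
      by (metis (mono_tags, lifting) mem_Collect_eq eq_iff_diff_eq_0)
    with assms(1) show ?thesis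
      by (intro continuous_on_scaleR continuous_on_const continuous_on_kern continuous_on_diff continuous_on_component)
  qed simp
qed

end

section \<open>Orbits close to a free line\<close>

text \<open>
  The force decays like the inverse square of the time and its Lipschitz constant like the inverse
  cube, which absorbs displacements that grow linearly in time.
\<close>

lemma time_weight_bounds:
  fixes t :: real
  assumes "0 \<le> a" "0 \<le> b"
  shows "1 / (1 + \<bar>t\<bar>)\<^sup>2 \<le> 1 / (1 + t\<^sup>2)" "(a + b * \<bar>t\<bar>) / (1 + \<bar>t\<bar>) ^ 3 \<le> (a + b) / (1 + t\<^sup>2)"
proof -
  have pos: "1 + t\<^sup>2 > 0" by (simp add: add_pos_nonneg)
  have "1 + t\<^sup>2 \<le> (1 + \<bar>t\<bar>)\<^sup>2" by (simp add: power2_eq_square algebra_simps)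
  then show 1: "1 / (1 + \<bar>t\<bar>)\<^sup>2 \<le> 1 / (1 + t\<^sup>2)" using pos by (intro divide_left_mono) auto
  have "a + b * \<bar>t\<bar> \<le> (a + b) * (1 + \<bar>t\<bar>)" using assms by (simp add: algebra_simps)
  then have "(a + b * \<bar>t\<bar>) / (1 + \<bar>t\<bar>) ^ 3 \<le> (a + b) * (1 + \<bar>t\<bar>) / (1 + \<bar>t\<bar>) ^ 3"
    by (intro divide_right_mono) auto
  also have "\<dots> = (a + b) * (1 / (1 + \<bar>t\<bar>)\<^sup>2)" by (simp add: power3_eq_cube power2_eq_square)
  also have "\<dots> \<le> (a + b) * (1 / (1 + t\<^sup>2))" using 1 assms by (intro mult_left_mono) auto
  finally show "(a + b * \<bar>t\<bar>) / (1 + \<bar>t\<bar>) ^ 3 \<le> (a + b) / (1 + t\<^sup>2)" by simp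
qed

text \<open>
  A straight line motion whose mutual distances are bounded below by a multiple of \<open>1 +
  \<bar>t\<bar>\<close>, as they are when no two bodies collide and no two velocities agree.
\<close>

locale free_line = masses m for m :: "'n::{finite,linorder} \<Rightarrow> real" +
  fixes A B0 :: "('d::finite, 'n) config" and c :: real
  assumes c_pos: "c > 0" and line_separated: "separated (c * (1 + \<bar>t\<bar>)) (t *\<^sub>R A + B0)"
begin

text \<open>
  Bound and Lipschitz constant, both relative to the weight \<open>1 / (1 + t\<^sup>2)\<close>, of
  the force at positions where the distances are still at least \<open>c / 2 * (1 +
  \<bar>t\<bar>)\<close>.
\<close>

definition "force_weight = 4 * force_const / c\<^sup>2"
definition "lip_weight = 64 * force_const / c ^ 3"

lemma weight_pos: "force_weight > 0" "lip_weight > 0"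
  using c_pos force_const_pos by (simp_all add: force_weight_def lip_weight_def)

lemma perturbed_separated:
  assumes B: "norm (B - B0) \<le> c / 8" and x: "norm x \<le> c / 8 * \<bar>t\<bar>"
  shows "separated (c / 2 * (1 + \<bar>t\<bar>)) (t *\<^sub>R A + B + x)"
proof -
  have "norm (B - B0 + x) \<le> c / 8 * (1 + \<bar>t\<bar>)"
    using norm_triangle_ineq[of "B - B0" x] B x by (simp add: algebra_simps)
  from separated_perturb[OF line_separated this, of t]
  have "separated (c * (1 + \<bar>t\<bar>) - 2 * (c / 8 * (1 + \<bar>t\<bar>))) (t *\<^sub>R A + B + x)"
    by (simp add: algebra_simps)
  moreover have "c / 2 * (1 + \<bar>t\<bar>) \<le> c * (1 + \<bar>t\<bar>) - 2 * (c / 8 * (1 + \<bar>t\<bar>))"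
  proof -
    have "c * (1 + \<bar>t\<bar>) > 0" using c_pos by (simp add: add_pos_nonneg)
    moreover have "c / 2 * (1 + \<bar>t\<bar>) = (c * (1 + \<bar>t\<bar>)) / 2" "2 * (c / 8 * (1 + \<bar>t\<bar>)) = (c * (1 + \<bar>t\<bar>)) / 4"
      by (simp_all add: algebra_simps)
    ultimately show ?thesis by linarith
  qed
  ultimately show ?thesis by (rule separated_mono)
qed

lemma perturbed_force_bound:
  assumes "norm (B - B0) \<le> c / 8" "norm x \<le> c / 8 * \<bar>t\<bar>"
  shows "norm (force m (t *\<^sub>R A + B + x)) \<le> force_weight / (1 + t\<^sup>2)"
proof -
  have "norm (force m (t *\<^sub>R A + B + x)) \<le> force_const / (c / 2 * (1 + \<bar>t\<bar>))\<^sup>2"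
    using c_pos by (intro norm_force_le perturbed_separated assms) (simp add: add_pos_nonneg)
  also have "\<dots> = force_weight * (1 / (1 + \<bar>t\<bar>)\<^sup>2)"
    by (simp add: force_weight_def power_mult_distrib power_divide)
  also have "\<dots> \<le> force_weight * (1 / (1 + t\<^sup>2))"
    using weight_pos time_weight_bounds(1)[of 0 0 t] by (intro mult_left_mono) auto
  finally show ?thesis by simp
qed

lemma perturbed_force_diff:
  assumes B: "norm (B - B0) \<le> c / 8" "norm x \<le> c / 8 * \<bar>t\<bar>" and B': "norm (B' - B0) \<le> c / 8" "norm x' \<le> c / 8 * \<bar>t\<bar>"
    and diff: "norm (B - B') \<le> a" "norm (x - x') \<le> b * \<bar>t\<bar>" and "b \<ge> 0"
  shows "norm (force m (t *\<^sub>R A + B + x) - force m (t *\<^sub>R A + B' + x')) \<le> lip_weight * (a + b) / (1 + t\<^sup>2)"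
proof -
  have a: "a \<ge> 0" using diff(1) norm_ge_zero order_trans by blast
  have "norm ((t *\<^sub>R A + B + x) - (t *\<^sub>R A + B' + x')) \<le> a + b * \<bar>t\<bar>"
    using norm_triangle_ineq[of "B - B'" "x - x'"] diff by (simp add: algebra_simps)
  then have le: "8 * force_const / (c / 2 * (1 + \<bar>t\<bar>)) ^ 3 * norm ((t *\<^sub>R A + B + x) - (t *\<^sub>R A + B' + x'))
      \<le> 8 * force_const / (c / 2 * (1 + \<bar>t\<bar>)) ^ 3 * (a + b * \<bar>t\<bar>)"
    using c_pos force_const_pos by (intro mult_left_mono) auto
  have "norm (force m (t *\<^sub>R A + B + x) - force m (t *\<^sub>R A + B' + x'))
     \<le> 8 * force_const / (c / 2 * (1 + \<bar>t\<bar>)) ^ 3 * norm ((t *\<^sub>R A + B + x) - (t *\<^sub>R A + B' + x'))"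
    using c_pos by (intro force_lipschitz perturbed_separated B B') (simp add: add_pos_nonneg)
  also note le
  also have "8 * force_const / (c / 2 * (1 + \<bar>t\<bar>)) ^ 3 * (a + b * \<bar>t\<bar>) = lip_weight * ((a + b * \<bar>t\<bar>) / (1 + \<bar>t\<bar>) ^ 3)"
    by (simp add: lip_weight_def power_mult_distrib power_divide)
  also have "\<dots> \<le> lip_weight * ((a + b) / (1 + t\<^sup>2))"
    using weight_pos time_weight_bounds(2)[OF a \<open>b \<ge> 0\<close>, of t] by (intro mult_left_mono) auto
  finally show ?thesis by simp
qed

text \<open>
  \<open>vmax\<close> bounds the total impulse along the orbits below. The first term in
  \<open>eps_max\<close> keeps them away from collisions, the second one makes the fixed point map
  contract by \<open>1 / 2\<close>.
\<close>

definition "vmax = force_weight * pi"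
definition "eps_max = min (c / (8 * vmax)) (1 / (2 * lip_weight * pi))"

lemma vmax_pos: "vmax > 0" using weight_pos by (simp add: vmax_def)

lemma eps_max_pos: "eps_max > 0"
  using weight_pos c_pos vmax_pos by (simp add: eps_max_def)

lemma eps_max_le:
  assumes "\<epsilon> \<le> eps_max" shows "\<epsilon> * vmax \<le> c / 8" "lip_weight * \<epsilon> * pi \<le> 1 / 2"
proof -
  have "\<epsilon> \<le> c / (8 * vmax)" "\<epsilon> \<le> 1 / (2 * lip_weight * pi)" using assms by (auto simp: eps_max_def)
  then show "\<epsilon> * vmax \<le> c / 8" "lip_weight * \<epsilon> * pi \<le> 1 / 2"
    using vmax_pos weight_pos by (simp_all add: field_simps)
qed

text \<open>
  The orbit is sought in the form \<open>q t = t A + B + \<epsilon> R t\<close> with \<open>R 0 =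
  0\<close>; the unknown is the bounded function \<open>u = R'\<close>, in terms of which Newton's
  equation with incoming velocity \<open>A\<close> says that \<open>u\<close> is the integral from
  \<open>- \<infinity>\<close> of the force along \<open>q\<close>. Prescribing the offset
  \<open>B\<close> at time \<open>0\<close> instead of at \<open>- \<infinity>\<close> avoids the
  logarithmic divergence of \<open>R\<close>.
\<close>

definition path_force :: "real \<Rightarrow> ('d, 'n) config \<Rightarrow> (real \<Rightarrow>\<^sub>C ('d, 'n) config) \<Rightarrow> real \<Rightarrow> ('d, 'n) config"
  where "path_force \<epsilon> B u s = force m (s *\<^sub>R A + B + \<epsilon> *\<^sub>R displacement u s)"

definition velocity_map :: "real \<Rightarrow> ('d, 'n) config \<Rightarrow> (real \<Rightarrow>\<^sub>C ('d, 'n) config) \<Rightarrow> (real \<Rightarrow>\<^sub>C ('d, 'n) config)"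
  where "velocity_map \<epsilon> B u = Bcontfun (vanishing_primitive (path_force \<epsilon> B u))"

context
  fixes \<epsilon> :: real
  assumes eps: "0 \<le> \<epsilon>" "\<epsilon> \<le> eps_max"
begin

lemma scaled_displacement:
  assumes "norm u \<le> vmax" shows "norm (\<epsilon> *\<^sub>R displacement u t) \<le> c / 8 * \<bar>t\<bar>"
proof -
  have "norm (\<epsilon> *\<^sub>R displacement u t) \<le> \<epsilon> * (vmax * \<bar>t\<bar>)"
    using eps displacement_bound[OF assms, of t] by (simp add: mult_left_mono)
  also have "\<dots> \<le> c / 8 * \<bar>t\<bar>"
    using mult_right_mono[OF eps_max_le(1)[OF eps(2)], of "\<bar>t\<bar>"] by (simp add: mult.assoc)
  finally show ?thesis .
qed

lemma path_force_props:
  assumes B: "norm (B - B0) \<le> c / 8" and u: "norm u \<le> vmax"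
  shows "continuous_on UNIV (path_force \<epsilon> B u)" "norm (path_force \<epsilon> B u t) \<le> force_weight / (1 + t\<^sup>2)"
    "separated (c / 2 * (1 + \<bar>t\<bar>)) (t *\<^sub>R A + B + \<epsilon> *\<^sub>R displacement u t)"
proof -
  show sep: "separated (c / 2 * (1 + \<bar>t\<bar>)) (t *\<^sub>R A + B + \<epsilon> *\<^sub>R displacement u t)" for t
    by (rule perturbed_separated[OF B scaled_displacement[OF u]])
  have "continuous_on UNIV (displacement u)"
    using displacement(1)[of u] by (meson continuous_at_imp_continuous_on has_vector_derivative_continuous)
  then have "continuous_on UNIV (\<lambda>t. t *\<^sub>R A + B + \<epsilon> *\<^sub>R displacement u t)"
    by (intro continuous_on_add continuous_on_scaleR continuous_on_const continuous_on_id)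
  moreover have "t *\<^sub>R A + B + \<epsilon> *\<^sub>R displacement u t \<notin> Coll" for t
    using separated_not_Coll[OF sep] c_pos by (simp add: add_pos_nonneg)
  ultimately show "continuous_on UNIV (path_force \<epsilon> B u)"
    unfolding path_force_def[abs_def] by (intro continuous_on_force)
  show "norm (path_force \<epsilon> B u t) \<le> force_weight / (1 + t\<^sup>2)"
    unfolding path_force_def by (rule perturbed_force_bound[OF B scaled_displacement[OF u]])
qed

lemma velocity_map_props:
  assumes B: "norm (B - B0) \<le> c / 8" and u: "norm u \<le> vmax"
  shows "(velocity_map \<epsilon> B u has_vector_derivative path_force \<epsilon> B u t) (at t)"
    "(velocity_map \<epsilon> B u \<longlongrightarrow> 0) at_bot" "\<exists>l. (velocity_map \<epsilon> B u \<longlongrightarrow> l) at_top"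
    "norm (velocity_map \<epsilon> B u) \<le> vmax"
proof -
  note p = vanishing_primitive[OF path_force_props(1,2)[OF B u]]
  have b: "norm (vanishing_primitive (path_force \<epsilon> B u) t) \<le> vmax" for t
    unfolding vmax_def by (rule vanishing_primitive_bound[OF p(1) path_force_props(2)[OF B u] p(2)])
  have "continuous_on UNIV (vanishing_primitive (path_force \<epsilon> B u))"
    using p(1) by (meson continuous_at_imp_continuous_on has_vector_derivative_continuous)
  then have "vanishing_primitive (path_force \<epsilon> B u) \<in> bcontfun" using b by (rule bcontfun_normI)
  then have eq: "apply_bcontfun (velocity_map \<epsilon> B u) = vanishing_primitive (path_force \<epsilon> B u)"
    unfolding velocity_map_def by (rule Bcontfun_inverse)
  show "(velocity_map \<epsilon> B u has_vector_derivative path_force \<epsilon> B u t) (at t)"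
    "(velocity_map \<epsilon> B u \<longlongrightarrow> 0) at_bot" "\<exists>l. (velocity_map \<epsilon> B u \<longlongrightarrow> l) at_top"
    unfolding eq by (rule p)+
  show "norm (velocity_map \<epsilon> B u) \<le> vmax" by (rule norm_bound) (simp add: eq b)
qed

text \<open>
  The dependence on \<open>u\<close> carries a factor \<open>\<epsilon>\<close>, the dependence on
  \<open>B\<close> does not: hence a contraction in \<open>u\<close> whose fixed point is Lipschitz
  in \<open>B\<close>.
\<close>

lemma velocity_map_lipschitz:
  assumes B: "norm (B - B0) \<le> c / 8" and u: "norm u \<le> vmax"
    and B': "norm (B' - B0) \<le> c / 8" and u': "norm u' \<le> vmax"
  shows "dist (velocity_map \<epsilon> B u) (velocity_map \<epsilon> B' u') \<le> lip_weight * (norm (B - B') + \<epsilon> * dist u u') * pi"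
proof (rule dist_bound)
  fix t
  have "norm (velocity_map \<epsilon> B u t - velocity_map \<epsilon> B' u' t) \<le> lip_weight * (norm (B - B') + \<epsilon> * dist u u') * pi"
  proof (rule vanishing_primitive_bound[where F = "\<lambda>t. velocity_map \<epsilon> B u t - velocity_map \<epsilon> B' u' t"])
    show "((\<lambda>t. velocity_map \<epsilon> B u t - velocity_map \<epsilon> B' u' t) has_vector_derivative
       path_force \<epsilon> B u t - path_force \<epsilon> B' u' t) (at t)" for t
      by (intro has_vector_derivative_diff velocity_map_props assms)
    show "((\<lambda>t. velocity_map \<epsilon> B u t - velocity_map \<epsilon> B' u' t) \<longlongrightarrow> 0) at_bot"
      using tendsto_diff[OF velocity_map_props(2)[OF B u] velocity_map_props(2)[OF B' u']] by simp
    fix t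
    have "norm (\<epsilon> *\<^sub>R displacement u t - \<epsilon> *\<^sub>R displacement u' t) \<le> (\<epsilon> * dist u u') * \<bar>t\<bar>"
      using displacement_diff[of u t u'] eps by (simp add: mult_left_mono mult.assoc flip: scaleR_diff_right)
    then show "norm (path_force \<epsilon> B u t - path_force \<epsilon> B' u' t) \<le> lip_weight * (norm (B - B') + \<epsilon> * dist u u') / (1 + t\<^sup>2)"
      unfolding path_force_def using eps
      by (intro perturbed_force_diff B B' scaled_displacement u u') auto
  qed
  then show "dist (velocity_map \<epsilon> B u t) (velocity_map \<epsilon> B' u' t) \<le> lip_weight * (norm (B - B') + \<epsilon> * dist u u') * pi"
    by (simp add: dist_norm)
qed

lemma velocity_fixed_point:
  assumes B: "norm (B - B0) \<le> c / 8"
  shows "\<exists>u. norm u \<le> vmax \<and> velocity_map \<epsilon> B u = u"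
proof -
  have "\<exists>!u\<in>cball 0 vmax. velocity_map \<epsilon> B u = u"
  proof (rule Banach_fix[where c = "1 / 2"])
    show "complete (cball (0 :: real \<Rightarrow>\<^sub>C ('d, 'n) config) vmax)" by (simp add: complete_eq_closed)
    show "cball (0 :: real \<Rightarrow>\<^sub>C ('d, 'n) config) vmax \<noteq> {}" using vmax_pos by auto
    show "velocity_map \<epsilon> B ` cball 0 vmax \<subseteq> cball 0 vmax"
      using velocity_map_props(4)[OF B] by (auto simp: dist_norm)
    fix u u' :: "real \<Rightarrow>\<^sub>C ('d, 'n) config" assume "u \<in> cball 0 vmax" "u' \<in> cball 0 vmax"
    then have "dist (velocity_map \<epsilon> B u) (velocity_map \<epsilon> B u') \<le> lip_weight * (norm (B - B) + \<epsilon> * dist u u') * pi"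
      by (intro velocity_map_lipschitz B) (auto simp: dist_norm)
    also have "\<dots> = (lip_weight * \<epsilon> * pi) * dist u u'" by simp
    also have "\<dots> \<le> 1 / 2 * dist u u'"
      using eps_max_le(2)[OF eps(2)] by (intro mult_right_mono) auto
    finally show "dist (velocity_map \<epsilon> B u) (velocity_map \<epsilon> B u') \<le> 1 / 2 * dist u u'" .
  qed auto
  then show ?thesis by (auto simp: dist_norm)
qed

lemma fixed_point_lipschitz:
  assumes B: "norm (B - B0) \<le> c / 8" and u: "norm u \<le> vmax" "velocity_map \<epsilon> B u = u"
    and B': "norm (B' - B0) \<le> c / 8" and u': "norm u' \<le> vmax" "velocity_map \<epsilon> B' u' = u'"
  shows "dist u u' \<le> 2 * lip_weight * pi * norm (B - B')"
proof -
  have "dist u u' \<le> lip_weight * (norm (B - B') + \<epsilon> * dist u u') * pi"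
    using velocity_map_lipschitz[OF B u(1) B' u'(1)] u(2) u'(2) by simp
  also have "\<dots> = lip_weight * pi * norm (B - B') + (lip_weight * \<epsilon> * pi) * dist u u'" by (simp add: algebra_simps)
  also have "(lip_weight * \<epsilon> * pi) * dist u u' \<le> 1 / 2 * dist u u'"
    using eps_max_le(2)[OF eps(2)] by (intro mult_right_mono) auto
  finally show ?thesis by simp
qed

text \<open>
  \<open>U B\<close> is the outgoing velocity correction divided by \<open>\<epsilon>\<close>. In
  the third property \<open>l\<close> is the integral of the force along the unperturbed line.
\<close>

theorem perturbed_orbits:
  obtains U where "continuous_on (cball B0 (c / 8)) U"
    and "\<And>B. B \<in> cball B0 (c / 8) \<Longrightarrow> norm (U B) \<le> vmax"
    and "\<And>B F l. B \<in> cball B0 (c / 8) \<Longrightarrow> (\<And>t. (F has_vector_derivative force m (t *\<^sub>R A + B)) (at t))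
       \<Longrightarrow> (F \<longlongrightarrow> 0) at_bot \<Longrightarrow> (F \<longlongrightarrow> l) at_top \<Longrightarrow> norm (U B - l) \<le> lip_weight * vmax * pi * \<epsilon>"
    and "\<And>B. B \<in> cball B0 (c / 8) \<Longrightarrow> \<exists>q p. (\<forall>t. (q has_vector_derivative p t) (at t)) \<and>
       (\<forall>t. (p has_vector_derivative \<epsilon> *\<^sub>R force m (q t)) (at t)) \<and> q 0 = B \<and>
       (p \<longlongrightarrow> A) at_bot \<and> (p \<longlongrightarrow> A + \<epsilon> *\<^sub>R U B) at_top \<and>
       (\<forall>t. norm (p t - A) \<le> \<epsilon> * vmax) \<and> (\<forall>t. separated (c / 2) (q t))"
proof -
  define u where "u B = (SOME u. norm u \<le> vmax \<and> velocity_map \<epsilon> B u = u)" for B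
  have u: "norm (u B) \<le> vmax \<and> velocity_map \<epsilon> B (u B) = u B" if "norm (B - B0) \<le> c / 8" for B
    unfolding u_def using velocity_fixed_point[OF that] by (rule someI_ex)
  define U where "U B = Lim at_top (apply_bcontfun (u B))" for B
  have der: "(u B has_vector_derivative path_force \<epsilon> B (u B) t) (at t)"
    and bot: "(u B \<longlongrightarrow> 0) at_bot" and top: "(u B \<longlongrightarrow> U B) at_top"
    if B: "norm (B - B0) \<le> c / 8" for B t
  proof -
    have n: "norm (u B) \<le> vmax" and eq: "velocity_map \<epsilon> B (u B) = u B" using u[OF B] by auto
    note v = velocity_map_props[OF B n, unfolded eq]
    show "(u B has_vector_derivative path_force \<epsilon> B (u B) t) (at t)" "(u B \<longlongrightarrow> 0) at_bot" by (rule v)+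
    obtain l where l: "(u B \<longlongrightarrow> l) at_top" using v(3) by blast
    then have "U B = l" unfolding U_def by (intro tendsto_Lim) simp_all
    with l show "(u B \<longlongrightarrow> U B) at_top" by simp
  qed
  have ball: "norm (B - B0) \<le> c / 8" if "B \<in> cball B0 (c / 8)" for B
    using that by (simp add: dist_norm norm_minus_commute)
  have Ulip: "norm (U B - U B') \<le> 2 * lip_weight * pi * norm (B - B')"
    if B: "norm (B - B0) \<le> c / 8" and B': "norm (B' - B0) \<le> c / 8" for B B'
  proof (rule tendsto_upperbound)
    show "((\<lambda>t. norm (u B t - u B' t)) \<longlongrightarrow> norm (U B - U B')) at_top"
      by (intro tendsto_intros top that)
    have "norm (u B t - u B' t) \<le> 2 * lip_weight * pi * norm (B - B')" for t
      using dist_bounded[of "u B" t "u B'"] fixed_point_lipschitz[of B "u B" B' "u B'"] u[OF B] u[OF B'] that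
      by (simp add: dist_norm)
    then show "eventually (\<lambda>t. norm (u B t - u B' t) \<le> 2 * lip_weight * pi * norm (B - B')) at_top" by simp
  qed simp
  show ?thesis
  proof (rule that[of U])
    have "(2 * lip_weight * pi)-lipschitz_on (cball B0 (c / 8)) U"
      using Ulip ball weight_pos by (intro lipschitz_onI) (auto simp: dist_norm)
    then show "continuous_on (cball B0 (c / 8)) U" by (rule lipschitz_on_continuous_on)
  next
    fix B assume "B \<in> cball B0 (c / 8)"
    then have B: "norm (B - B0) \<le> c / 8" by (rule ball)
    have ub: "norm (u B t) \<le> vmax" for t using u[OF B] norm_bounded order_trans by blast
    show "norm (U B) \<le> vmax"
      by (rule tendsto_upperbound[OF tendsto_norm[OF top[OF B]]]) (use ub in auto)
    show "norm (U B - l) \<le> lip_weight * vmax * pi * \<epsilon>"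
      if F: "\<And>t. (F has_vector_derivative force m (t *\<^sub>R A + B)) (at t)" and F0: "(F \<longlongrightarrow> 0) at_bot"
        and Fl: "(F \<longlongrightarrow> l) at_top" for F l
    proof (rule tendsto_upperbound)
      show "((\<lambda>t. norm (u B t - F t)) \<longlongrightarrow> norm (U B - l)) at_top" by (intro tendsto_intros top B Fl)
      have "norm (u B t - F t) \<le> lip_weight * (0 + \<epsilon> * vmax) * pi" for t
      proof (rule vanishing_primitive_bound[where F = "\<lambda>t. u B t - F t"])
        show "((\<lambda>t. u B t - F t) has_vector_derivative path_force \<epsilon> B (u B) t - force m (t *\<^sub>R A + B)) (at t)" for t
          by (intro has_vector_derivative_diff der B F)
        show "((\<lambda>t. u B t - F t) \<longlongrightarrow> 0) at_bot" using tendsto_diff[OF bot[OF B] F0] by simp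
        fix t
        have d: "norm (\<epsilon> *\<^sub>R displacement (u B) t - 0) \<le> (\<epsilon> * vmax) * \<bar>t\<bar>"
          using displacement_bound[of "u B" vmax t] u[OF B] eps by (simp add: mult_left_mono mult.assoc)
        have "norm (force m (t *\<^sub>R A + B + \<epsilon> *\<^sub>R displacement (u B) t) - force m (t *\<^sub>R A + B + 0)) \<le> lip_weight * (0 + \<epsilon> * vmax) / (1 + t\<^sup>2)"
          using eps vmax_pos c_pos u[OF B] d by (intro perturbed_force_diff B scaled_displacement) auto
        then show "norm (path_force \<epsilon> B (u B) t - force m (t *\<^sub>R A + B)) \<le> lip_weight * (0 + \<epsilon> * vmax) / (1 + t\<^sup>2)"
          by (simp add: path_force_def)
      qed
      then show "eventually (\<lambda>t. norm (u B t - F t) \<le> lip_weight * vmax * pi * \<epsilon>) at_top"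
        by (simp add: mult_ac)
    qed simp
    show "\<exists>q p. (\<forall>t. (q has_vector_derivative p t) (at t)) \<and>
       (\<forall>t. (p has_vector_derivative \<epsilon> *\<^sub>R force m (q t)) (at t)) \<and> q 0 = B \<and>
       (p \<longlongrightarrow> A) at_bot \<and> (p \<longlongrightarrow> A + \<epsilon> *\<^sub>R U B) at_top \<and>
       (\<forall>t. norm (p t - A) \<le> \<epsilon> * vmax) \<and> (\<forall>t. separated (c / 2) (q t))"
    proof (rule exI[of _ "\<lambda>t. t *\<^sub>R A + B + \<epsilon> *\<^sub>R displacement (u B) t"],
        rule exI[of _ "\<lambda>t. A + \<epsilon> *\<^sub>R u B t"], intro conjI allI)
      fix t
      show "((\<lambda>t. t *\<^sub>R A + B + \<epsilon> *\<^sub>R displacement (u B) t) has_vector_derivative A + \<epsilon> *\<^sub>R u B t) (at t)"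
        by (auto intro!: derivative_eq_intros displacement)
      show "((\<lambda>t. A + \<epsilon> *\<^sub>R u B t) has_vector_derivative \<epsilon> *\<^sub>R force m (t *\<^sub>R A + B + \<epsilon> *\<^sub>R displacement (u B) t)) (at t)"
        using der[OF B, of t] by (auto intro!: derivative_eq_intros simp: path_force_def)
      show "norm (A + \<epsilon> *\<^sub>R u B t - A) \<le> \<epsilon> * vmax" using ub[of t] eps by (simp add: mult_left_mono)
      have "c / 2 \<le> c / 2 * (1 + \<bar>t\<bar>)" using c_pos by (simp add: algebra_simps)
      then show "separated (c / 2) (t *\<^sub>R A + B + \<epsilon> *\<^sub>R displacement (u B) t)"
        using path_force_props(3)[OF B] u[OF B] separated_mono by blast
    next
      show "0 *\<^sub>R A + B + \<epsilon> *\<^sub>R displacement (u B) 0 = B" by (simp add: displacement)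
      show "((\<lambda>t. A + \<epsilon> *\<^sub>R u B t) \<longlongrightarrow> A) at_bot"
        using tendsto_add[OF tendsto_const[of A] tendsto_scaleR[OF tendsto_const[of \<epsilon>] bot[OF B]]] by simp
      show "((\<lambda>t. A + \<epsilon> *\<^sub>R u B t) \<longlongrightarrow> A + \<epsilon> *\<^sub>R U B) at_top"
        by (intro tendsto_intros top B)
    qed
  qed
qed

end

end

section \<open>First-order deflection\<close>

text \<open>
  For \<open>a = 0\<close> the division by zero makes this the identity.
\<close>

definition perp :: "'a::real_inner \<Rightarrow> 'a \<Rightarrow> 'a"
  where "perp a b = b - ((a \<bullet> b) / (a \<bullet> a)) *\<^sub>R a"

text \<open>
  The gradient of the logarithm of the norm.
\<close>

definition inversion :: "'a::real_inner \<Rightarrow> 'a"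
  where "inversion x = x /\<^sub>R (x \<bullet> x)"

definition inversion_deriv :: "'a::real_inner \<Rightarrow> 'a \<Rightarrow> 'a"
  where "inversion_deriv x h = h /\<^sub>R (x \<bullet> x) - (2 * (x \<bullet> h) / (x \<bullet> x)\<^sup>2) *\<^sub>R x"

text \<open>
  The integral of \<open>kern (t a + b)\<close> over all \<open>t\<close>; see
  \<open>kern_line_primitive\<close>.
\<close>

definition deflection :: "'a::real_inner \<Rightarrow> 'a \<Rightarrow> 'a"
  where "deflection a b = (2 / norm a) *\<^sub>R inversion (perp a b)"

definition deflection_deriv :: "'a::real_inner \<Rightarrow> 'a \<Rightarrow> 'a \<Rightarrow> 'a"
  where "deflection_deriv a b c = (2 / norm a) *\<^sub>R inversion_deriv (perp a b) (perp a c)"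

lemma inner_perp [simp]: "a \<bullet> perp a b = 0" "perp a b \<bullet> a = 0"
  by (cases "a = 0"; simp add: perp_def inner_diff_right inner_diff_left inner_commute)+

lemma linear_perp: "linear (perp a)"
  by (auto intro!: linearI simp: perp_def inner_add_right inner_scaleR_right add_divide_distrib algebra_simps)

lemma perp_minus: "perp (- a) b = perp a b" "perp a (- b) = - perp a b"
  by (simp_all add: perp_def)

text \<open>
  The projection is symmetric and idempotent.
\<close>

lemma perp_inner: "perp a x \<bullet> y = perp a x \<bullet> perp a y"
  by (simp add: perp_def[of a y] inner_diff_right)

lemma perp_eq_0_iff: "perp a b = 0 \<longleftrightarrow> (\<exists>k. b = k *\<^sub>R a)"
proof
  assume "perp a b = 0"
  then show "\<exists>k. b = k *\<^sub>R a" by (auto simp: perp_def)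
next
  assume "\<exists>k. b = k *\<^sub>R a"
  then show "perp a b = 0" by (cases "a = 0") (auto simp: perp_def)
qed

lemma linear_inversion_deriv: "linear (inversion_deriv x)"
  by (auto intro!: linearI simp: inversion_deriv_def inner_add_right algebra_simps add_divide_distrib)

lemma linear_deflection_deriv: "linear (deflection_deriv a b)"
  using linear_compose[OF linear_perp[of a] linear_inversion_deriv[of "perp a b"]]
  by (auto simp: linear_iff deflection_deriv_def o_def scaleR_add_right)

lemma deflection_minus: "deflection (- a) (- b) = - deflection a b"
  by (simp add: deflection_def inversion_def perp_minus)

lemma deflection_deriv_minus: "deflection_deriv (- a) (- b) (- c) = - deflection_deriv a b c"
  by (simp add: deflection_deriv_def inversion_deriv_def perp_minus scaleR_diff_right algebra_simps)

lemma inner_deflection: "a \<bullet> deflection a b = 0"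
  by (simp add: deflection_def inversion_def)

lemma inner_deflection_deriv: "a \<bullet> deflection_deriv a b c = 0"
  by (simp add: deflection_deriv_def inversion_deriv_def inner_diff_right)

lemma inversion_has_derivative:
  assumes "x \<noteq> 0"
  shows "(inversion has_derivative inversion_deriv x) (at x)"
proof -
  have "((\<lambda>x. inverse (x \<bullet> x)) has_derivative (\<lambda>h. - (inverse (x \<bullet> x) * (x \<bullet> h + h \<bullet> x) * inverse (x \<bullet> x)))) (at x)"
    using assms by (auto intro!: derivative_eq_intros)
  then have "((\<lambda>x. inverse (x \<bullet> x) *\<^sub>R x) has_derivative
     (\<lambda>h. inverse (x \<bullet> x) *\<^sub>R h + (- (inverse (x \<bullet> x) * (x \<bullet> h + h \<bullet> x) * inverse (x \<bullet> x))) *\<^sub>R x)) (at x)"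
    by (intro has_derivative_scaleR has_derivative_ident)
  also have "(\<lambda>h. inverse (x \<bullet> x) *\<^sub>R h + (- (inverse (x \<bullet> x) * (x \<bullet> h + h \<bullet> x) * inverse (x \<bullet> x))) *\<^sub>R x) = inversion_deriv x"
    by (simp add: fun_eq_iff inversion_deriv_def inner_commute divide_inverse power2_eq_square mult_ac)
  finally show ?thesis by (simp add: inversion_def[abs_def])
qed

lemma deflection_has_derivative:
  fixes a b :: "'a::euclidean_space"
  assumes "perp a b \<noteq> 0"
  shows "(deflection a has_derivative deflection_deriv a b) (at b)"
proof -
  have "(perp a has_derivative perp a) (at b)"
    by (rule linear_imp_has_derivative[OF linear_perp])
  from has_derivative_compose[OF this inversion_has_derivative[OF assms]]
  have "((\<lambda>b. inversion (perp a b)) has_derivative (\<lambda>c. inversion_deriv (perp a b) (perp a c))) (at b)" .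
  from has_derivative_scaleR_right[OF this, of "2 / norm a"] show ?thesis
    unfolding deflection_def[abs_def] deflection_deriv_def[abs_def] .
qed

lemma line_decomposition:
  assumes "a \<noteq> 0"
  shows "s *\<^sub>R a + b = (s + (a \<bullet> b) / (a \<bullet> a)) *\<^sub>R a + perp a b"
    "(norm (s *\<^sub>R a + b))\<^sup>2 = (s + (a \<bullet> b) / (a \<bullet> a))\<^sup>2 * (a \<bullet> a) + perp a b \<bullet> perp a b"
proof -
  show 1: "s *\<^sub>R a + b = (s + (a \<bullet> b) / (a \<bullet> a)) *\<^sub>R a + perp a b"
    by (simp add: perp_def scaleR_add_left)
  show "(norm (s *\<^sub>R a + b))\<^sup>2 = (s + (a \<bullet> b) / (a \<bullet> a))\<^sup>2 * (a \<bullet> a) + perp a b \<bullet> perp a b"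
    unfolding 1 power2_norm_eq_inner
    by (simp only: inner_add_left inner_add_right inner_scaleR_left inner_scaleR_right inner_perp)
       (simp add: power2_eq_square)
qed

lemma hyperbolic_ratio_limits:
  fixes \<alpha> \<beta> x0 :: real
  assumes \<alpha>: "\<alpha> > 0"
  shows "((\<lambda>s. (s + x0) / sqrt ((s + x0)\<^sup>2 * \<alpha>\<^sup>2 + \<beta>)) \<longlongrightarrow> 1 / \<alpha>) at_top"
    "((\<lambda>s. (s + x0) / sqrt ((s + x0)\<^sup>2 * \<alpha>\<^sup>2 + \<beta>)) \<longlongrightarrow> - (1 / \<alpha>)) at_bot"
    "((\<lambda>s. 1 / sqrt ((s + x0)\<^sup>2 * \<alpha>\<^sup>2 + \<beta>)) \<longlongrightarrow> 0) at_top"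
    "((\<lambda>s. 1 / sqrt ((s + x0)\<^sup>2 * \<alpha>\<^sup>2 + \<beta>)) \<longlongrightarrow> 0) at_bot"
proof -
  have inv: "((\<lambda>x::real. inverse x) \<longlongrightarrow> 0) at_top" by (rule tendsto_inverse_0_at_top[OF filterlim_ident])
  have "((\<lambda>x. 1 / sqrt (\<alpha>\<^sup>2 + \<beta> * (inverse x)\<^sup>2)) \<longlongrightarrow> 1 / sqrt (\<alpha>\<^sup>2 + \<beta> * 0\<^sup>2)) at_top"
    using \<alpha> by (intro tendsto_intros inv) simp
  moreover have "eventually (\<lambda>x. 1 / sqrt (\<alpha>\<^sup>2 + \<beta> * (inverse x)\<^sup>2) = x / sqrt (x\<^sup>2 * \<alpha>\<^sup>2 + \<beta>)) at_top"
    using eventually_gt_at_top[of 0]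
  proof eventually_elim
    case (elim x)
    have "x\<^sup>2 * \<alpha>\<^sup>2 + \<beta> = x\<^sup>2 * (\<alpha>\<^sup>2 + \<beta> * (inverse x)\<^sup>2)"
      using elim by (simp add: algebra_simps power2_eq_square)
    then have "sqrt (x\<^sup>2 * \<alpha>\<^sup>2 + \<beta>) = x * sqrt (\<alpha>\<^sup>2 + \<beta> * (inverse x)\<^sup>2)"
      using elim by (simp only: real_sqrt_mult real_sqrt_abs abs_of_pos)
    then show ?case using elim by simp
  qed
  ultimately have "((\<lambda>x. x / sqrt (x\<^sup>2 * \<alpha>\<^sup>2 + \<beta>)) \<longlongrightarrow> 1 / sqrt (\<alpha>\<^sup>2 + \<beta> * 0\<^sup>2)) at_top"
    by (rule Lim_transform_eventually)
  then have T: "((\<lambda>x. x / sqrt (x\<^sup>2 * \<alpha>\<^sup>2 + \<beta>)) \<longlongrightarrow> 1 / \<alpha>) at_top" using \<alpha> by simp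
  have "((\<lambda>x. x / sqrt (x\<^sup>2 * \<alpha>\<^sup>2 + \<beta>) * inverse x) \<longlongrightarrow> 1 / \<alpha> * 0) at_top"
    by (intro tendsto_mult T inv)
  moreover have "eventually (\<lambda>x. x / sqrt (x\<^sup>2 * \<alpha>\<^sup>2 + \<beta>) * inverse x = 1 / sqrt (x\<^sup>2 * \<alpha>\<^sup>2 + \<beta>)) at_top"
    using eventually_gt_at_top[of 0] by eventually_elim simp
  ultimately have "((\<lambda>x. 1 / sqrt (x\<^sup>2 * \<alpha>\<^sup>2 + \<beta>)) \<longlongrightarrow> 1 / \<alpha> * 0) at_top"
    by (rule Lim_transform_eventually)
  then have N: "((\<lambda>x. 1 / sqrt (x\<^sup>2 * \<alpha>\<^sup>2 + \<beta>)) \<longlongrightarrow> 0) at_top" by simp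
  have shift: "filterlim (\<lambda>s. s + x0) at_top at_top"
    using filterlim_tendsto_add_at_top[OF tendsto_const[of x0] filterlim_ident] by (simp add: add.commute)
  have shift': "filterlim (\<lambda>s. - s - x0) at_top at_bot"
  proof -
    have "(\<lambda>s. - s - x0) = (\<lambda>s. - x0 + - s)" by auto
    then show ?thesis
      using filterlim_tendsto_add_at_top[OF tendsto_const[of "- x0"] filterlim_uminus_at_top_at_bot] by (simp only:)
  qed
  show "((\<lambda>s. (s + x0) / sqrt ((s + x0)\<^sup>2 * \<alpha>\<^sup>2 + \<beta>)) \<longlongrightarrow> 1 / \<alpha>) at_top"
    by (rule filterlim_compose[OF T shift])
  show "((\<lambda>s. 1 / sqrt ((s + x0)\<^sup>2 * \<alpha>\<^sup>2 + \<beta>)) \<longlongrightarrow> 0) at_top"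
    by (rule filterlim_compose[OF N shift])
  have sq: "(- s - x0)\<^sup>2 = (s + x0)\<^sup>2" for s by (simp add: power2_eq_square algebra_simps)
  show "((\<lambda>s. 1 / sqrt ((s + x0)\<^sup>2 * \<alpha>\<^sup>2 + \<beta>)) \<longlongrightarrow> 0) at_bot"
    using filterlim_compose[OF N shift'] by (simp only: sq)
  have "((\<lambda>s. - ((- s - x0) / sqrt ((s + x0)\<^sup>2 * \<alpha>\<^sup>2 + \<beta>))) \<longlongrightarrow> - (1 / \<alpha>)) at_bot"
    using tendsto_minus[OF filterlim_compose[OF T shift']] by (simp only: sq)
  moreover have "- ((- s - x0) / r) = (s + x0) / r" for s r :: real
    by (cases "r = 0") (simp_all add: field_simps)
  ultimately show "((\<lambda>s. (s + x0) / sqrt ((s + x0)\<^sup>2 * \<alpha>\<^sup>2 + \<beta>)) \<longlongrightarrow> - (1 / \<alpha>)) at_bot"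
    by (simp only:)
qed

text \<open>
  In the orthogonal decomposition of \<open>t a + b\<close> along \<open>a\<close> and \<open>perp a
  b\<close>, the integrand has the elementary primitives \<open>(t + x0) / \<rho>\<close> and
  \<open>1 / \<rho>\<close>, where \<open>\<rho>\<close> is the norm of \<open>t a + b\<close> and
  \<open>- x0\<close> is the time of closest approach. The component along \<open>a\<close> cancels.
\<close>

lemma kern_line_primitive:
  fixes a b :: "'a::real_inner"
  assumes a: "a \<noteq> 0" and b: "perp a b \<noteq> 0"
  obtains \<Phi> where "\<And>t. (\<Phi> has_vector_derivative kern (t *\<^sub>R a + b)) (at t)"
    "(\<Phi> \<longlongrightarrow> 0) at_bot" "(\<Phi> \<longlongrightarrow> deflection a b) at_top"
proof -
  define x0 \<alpha> \<beta> where "x0 = (a \<bullet> b) / (a \<bullet> a)" and "\<alpha> = norm a" and "\<beta> = perp a b \<bullet> perp a b"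
  have pos: "\<alpha> > 0" "\<beta> > 0" and aa: "a \<bullet> a = \<alpha>\<^sup>2"
    using a b by (auto simp: \<alpha>_def \<beta>_def power2_norm_eq_inner)
  define \<rho> where "\<rho> s = sqrt ((s + x0)\<^sup>2 * \<alpha>\<^sup>2 + \<beta>)" for s
  have arg: "(s + x0)\<^sup>2 * \<alpha>\<^sup>2 + \<beta> > 0" for s using pos by (intro add_nonneg_pos) auto
  have \<rho>: "\<rho> s > 0" "(\<rho> s)\<^sup>2 = (s + x0)\<^sup>2 * \<alpha>\<^sup>2 + \<beta>" for s
    using arg[of s] by (auto simp: \<rho>_def)
  have norm: "norm (s *\<^sub>R a + b) = \<rho> s" for s
    using line_decomposition(2)[OF a, of s b] by (simp add: \<rho>_def aa x0_def \<beta>_def real_sqrt_unique)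
  have d\<rho>: "(\<rho> has_real_derivative (s + x0) * \<alpha>\<^sup>2 / \<rho> s) (at s)" for s
    unfolding \<rho>_def[abs_def] using arg[of s]
    by (auto intro!: derivative_eq_intros simp: field_simps)
  have h1: "((\<lambda>s. (s + x0) / \<rho> s) has_real_derivative \<beta> / \<rho> s ^ 3) (at s)" for s
  proof -
    have "((\<lambda>s. (s + x0) / \<rho> s) has_real_derivative ((1 * \<rho> s - (s + x0) * ((s + x0) * \<alpha>\<^sup>2 / \<rho> s)) / (\<rho> s * \<rho> s))) (at s)"
      using \<rho>(1)[of s] by (intro DERIV_divide d\<rho>) (auto intro!: derivative_eq_intros)
    moreover have "(1 * \<rho> s - (s + x0) * ((s + x0) * \<alpha>\<^sup>2 / \<rho> s)) / (\<rho> s * \<rho> s) = ((\<rho> s)\<^sup>2 - (s + x0)\<^sup>2 * \<alpha>\<^sup>2) / \<rho> s ^ 3"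
      using \<rho>(1)[of s] by (simp add: field_simps power2_eq_square power3_eq_cube)
    ultimately show ?thesis by (simp add: \<rho>(2))
  qed
  have h2: "((\<lambda>s. 1 / \<rho> s) has_real_derivative - ((s + x0) * \<alpha>\<^sup>2 / \<rho> s ^ 3)) (at s)" for s
    using \<rho>(1)[of s] by (auto intro!: derivative_eq_intros d\<rho> simp: field_simps power2_eq_square power3_eq_cube)
  define \<Phi> where "\<Phi> s = (((s + x0) / \<rho> s + 1 / \<alpha>) * inverse \<beta>) *\<^sub>R perp a b - (1 / \<rho> s * inverse (\<alpha>\<^sup>2)) *\<^sub>R a" for s
  show ?thesis
  proof (rule that[of \<Phi>])
    fix s
    have e1: "((\<lambda>s. ((s + x0) / \<rho> s + 1 / \<alpha>) * inverse \<beta>) has_real_derivative \<beta> / \<rho> s ^ 3 * inverse \<beta>) (at s)"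
      using DERIV_cmult_right[OF DERIV_add[OF h1 DERIV_const]] by simp
    have e2: "((\<lambda>s. 1 / \<rho> s * inverse (\<alpha>\<^sup>2)) has_real_derivative - ((s + x0) * \<alpha>\<^sup>2 / \<rho> s ^ 3) * inverse (\<alpha>\<^sup>2)) (at s)"
      by (rule DERIV_cmult_right[OF h2])
    have "(\<Phi> has_vector_derivative (\<beta> / \<rho> s ^ 3 * inverse \<beta>) *\<^sub>R perp a b
        - (- ((s + x0) * \<alpha>\<^sup>2 / \<rho> s ^ 3) * inverse (\<alpha>\<^sup>2)) *\<^sub>R a) (at s)"
      unfolding \<Phi>_def
      using has_vector_derivative_diff[OF has_vector_derivative_scaleR[OF e1 has_vector_derivative_const[of "perp a b"]]
        has_vector_derivative_scaleR[OF e2 has_vector_derivative_const[of a]]] by simp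
    moreover have "(\<beta> / \<rho> s ^ 3 * inverse \<beta>) *\<^sub>R perp a b - (- ((s + x0) * \<alpha>\<^sup>2 / \<rho> s ^ 3) * inverse (\<alpha>\<^sup>2)) *\<^sub>R a
       = ((s + x0) *\<^sub>R a + perp a b) /\<^sub>R \<rho> s ^ 3"
    proof -
      have "\<beta> / \<rho> s ^ 3 * inverse \<beta> = inverse (\<rho> s ^ 3)"
        "- ((s + x0) * \<alpha>\<^sup>2 / \<rho> s ^ 3) * inverse (\<alpha>\<^sup>2) = - (inverse (\<rho> s ^ 3) * (s + x0))"
        using pos \<rho>(1)[of s] by (simp_all add: field_simps)
      then show ?thesis by (simp add: scaleR_add_right add.commute)
    qed
    moreover have "\<dots> = kern (s *\<^sub>R a + b)"
      by (simp only: kern_def norm line_decomposition(1)[OF a, of s b, folded x0_def, symmetric])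
    ultimately show "(\<Phi> has_vector_derivative kern (s *\<^sub>R a + b)) (at s)" by simp
  next
    note lims = hyperbolic_ratio_limits[OF pos(1), of x0 \<beta>, folded \<rho>_def]
    have "(\<Phi> \<longlongrightarrow> ((- (1 / \<alpha>) + 1 / \<alpha>) * inverse \<beta>) *\<^sub>R perp a b - (0 * inverse (\<alpha>\<^sup>2)) *\<^sub>R a) at_bot"
      unfolding \<Phi>_def by (intro tendsto_diff tendsto_scaleR tendsto_mult tendsto_add tendsto_const lims)
    then show "(\<Phi> \<longlongrightarrow> 0) at_bot" by simp
    have "(\<Phi> \<longlongrightarrow> ((1 / \<alpha> + 1 / \<alpha>) * inverse \<beta>) *\<^sub>R perp a b - (0 * inverse (\<alpha>\<^sup>2)) *\<^sub>R a) at_top"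
      unfolding \<Phi>_def by (intro tendsto_diff tendsto_scaleR tendsto_mult tendsto_add tendsto_const lims)
    moreover have "((1 / \<alpha> + 1 / \<alpha>) * inverse \<beta>) *\<^sub>R perp a b - (0 * inverse (\<alpha>\<^sup>2)) *\<^sub>R a = deflection a b"
      by (simp add: deflection_def inversion_def \<alpha>_def \<beta>_def)
    ultimately show "(\<Phi> \<longlongrightarrow> deflection a b) at_top" by (simp only:)
  qed
qed

text \<open>
  Reduces the calculus of vectors of vectors to sums of linear images.
\<close>

lemma vec_eq_sum_axis: "(\<chi> i. f i) = (\<Sum>i\<in>UNIV. axis i (f i))"
  by (simp add: vec_eq_iff axis_def if_distrib if_distribR cong: if_cong)

lemma bounded_linear_axis: "bounded_linear (axis i :: 'a::euclidean_space \<Rightarrow> 'a ^ 'n::finite)"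
  unfolding linear_conv_bounded_linear [symmetric]
  by (auto intro!: linearI simp: vec_eq_iff axis_def)

lemma has_derivative_vec_lambda:
  fixes f :: "'n::finite \<Rightarrow> 'x::real_normed_vector \<Rightarrow> 'a::euclidean_space"
  assumes "\<And>i. (f i has_derivative f' i) F"
  shows "((\<lambda>x. \<chi> i. f i x) has_derivative (\<lambda>h. \<chi> i. f' i h)) F"
  unfolding vec_eq_sum_axis
  by (intro has_derivative_sum bounded_linear.has_derivative[OF bounded_linear_axis] assms)

lemma has_vector_derivative_vec_lambda:
  fixes f :: "'n::finite \<Rightarrow> real \<Rightarrow> 'a::euclidean_space"
  assumes "\<And>i. (f i has_vector_derivative f' i) F"
  shows "((\<lambda>x. \<chi> i. f i x) has_vector_derivative (\<chi> i. f' i)) F"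
  unfolding vec_eq_sum_axis
  by (intro has_vector_derivative_sum bounded_linear.has_vector_derivative[OF bounded_linear_axis] assms)

text \<open>
  The first-order change of velocity of an orbit close to \<open>t A + B\<close>.
\<close>

definition scatter_grad :: "('n::finite \<Rightarrow> real) \<Rightarrow> ('d::finite, 'n) config \<Rightarrow> ('d, 'n) config \<Rightarrow> ('d, 'n) config"
  where "scatter_grad m A B = pair_sum m (\<lambda>i j. deflection (A $ j - A $ i) (B $ j - B $ i))"

definition scatter_hess ::
    "('n::finite \<Rightarrow> real) \<Rightarrow> ('d::finite, 'n) config \<Rightarrow> ('d, 'n) config \<Rightarrow> ('d, 'n) config \<Rightarrow> ('d, 'n) config"
  where "scatter_hess m A B C = pair_sum m (\<lambda>i j. deflection_deriv (A $ j - A $ i) (B $ j - B $ i) (C $ j - C $ i))"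

text \<open>
  The bodies moving along \<open>t A + B\<close> never collide and have distinct velocities.
\<close>

definition free_pair :: "('d::finite, 'n::finite) config \<Rightarrow> ('d, 'n) config \<Rightarrow> bool"
  where "free_pair A B \<longleftrightarrow> (\<forall>i j. i \<noteq> j \<longrightarrow> A $ j - A $ i \<noteq> 0 \<and> perp (A $ j - A $ i) (B $ j - B $ i) \<noteq> 0)"

lemma line_force_integral:
  assumes AB: "free_pair A B"
  obtains F where "\<And>t. (F has_vector_derivative force m (t *\<^sub>R A + B)) (at t)" "(F \<longlongrightarrow> 0) at_bot"
    "(F \<longlongrightarrow> scatter_grad m A B) at_top"
proof -
  define P where "P i j \<Phi> \<longleftrightarrow> (\<forall>t. (\<Phi> has_vector_derivative kern (t *\<^sub>R (A $ j - A $ i) + (B $ j - B $ i))) (at t)) \<and>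
     (\<Phi> \<longlongrightarrow> 0) at_bot \<and> (\<Phi> \<longlongrightarrow> deflection (A $ j - A $ i) (B $ j - B $ i)) at_top" for i j \<Phi>
  have "\<exists>\<Phi>. P i j \<Phi>" for i j
  proof (cases "i = j")
    case True
    then show ?thesis by (intro exI[of _ "\<lambda>_. 0"]) (simp add: P_def deflection_def inversion_def perp_def)
  next
    case False
    then show ?thesis using AB kern_line_primitive unfolding free_pair_def P_def by metis
  qed
  then obtain \<Phi> where "P i j (\<Phi> i j)" for i j by metis
  then have \<Phi>: "\<And>i j t. (\<Phi> i j has_vector_derivative kern (t *\<^sub>R (A $ j - A $ i) + (B $ j - B $ i))) (at t)"
     "\<And>i j. (\<Phi> i j \<longlongrightarrow> 0) at_bot" "\<And>i j. (\<Phi> i j \<longlongrightarrow> deflection (A $ j - A $ i) (B $ j - B $ i)) at_top"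
    unfolding P_def by blast+
  define F where "F t = pair_sum m (\<lambda>i j. \<Phi> i j t)" for t
  show ?thesis
  proof (rule that[of F])
    fix t
    have "(F has_vector_derivative pair_sum m (\<lambda>i j. kern (t *\<^sub>R (A $ j - A $ i) + (B $ j - B $ i)))) (at t)"
      unfolding F_def[abs_def] pair_sum_def
      by (intro has_vector_derivative_vec_lambda has_vector_derivative_sum
          bounded_linear.has_vector_derivative[OF bounded_linear_scaleR_right] \<Phi>)
    then show "(F has_vector_derivative force m (t *\<^sub>R A + B)) (at t)"
      by (simp add: force_eq_pair_sum algebra_simps)
  next
    have "(F \<longlongrightarrow> pair_sum m (\<lambda>i j. 0)) at_bot"
      unfolding F_def[abs_def] pair_sum_def
      by (intro tendsto_vec_lambda tendsto_sum tendsto_scaleR tendsto_const \<Phi>)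
    then show "(F \<longlongrightarrow> 0) at_bot" by simp
    show "(F \<longlongrightarrow> scatter_grad m A B) at_top"
      unfolding F_def[abs_def] pair_sum_def scatter_grad_def
      by (intro tendsto_vec_lambda tendsto_sum tendsto_scaleR tendsto_const \<Phi>)
  qed
qed

lemma scatter_grad_has_derivative:
  assumes AB: "free_pair A B"
  shows "(scatter_grad m A has_derivative scatter_hess m A B) (at B)"
  unfolding scatter_grad_def[abs_def] scatter_hess_def[abs_def] pair_sum_def
proof (intro has_derivative_vec_lambda has_derivative_sum has_derivative_scaleR_right)
  fix i j
  have lin: "((\<lambda>B. B $ j - B $ i) has_derivative (\<lambda>C. C $ j - C $ i)) (at B)"
    by (intro derivative_intros bounded_linear_imp_has_derivative bounded_linear_vec_nth)
  show "((\<lambda>B. deflection (A $ j - A $ i) (B $ j - B $ i)) has_derivative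
     (\<lambda>C. deflection_deriv (A $ j - A $ i) (B $ j - B $ i) (C $ j - C $ i))) (at B)"
  proof (cases "i = j")
    case True
    then show ?thesis by (simp add: deflection_def inversion_def perp_def deflection_deriv_def inversion_deriv_def)
  next
    case False
    then have "perp (A $ j - A $ i) (B $ j - B $ i) \<noteq> 0" using AB by (simp add: free_pair_def)
    from has_derivative_compose[OF lin deflection_has_derivative[OF this]] show ?thesis .
  qed
qed

lemma linear_scatter_hess: "linear (scatter_hess m A B)"
proof -
  have "linear (\<lambda>C. deflection_deriv (A $ j - A $ i) (B $ j - B $ i) (C $ j - C $ i))" for i j
    using linear_compose[of "\<lambda>C. C $ j - C $ i", OF _ linear_deflection_deriv[of "A $ j - A $ i" "B $ j - B $ i"]]
    by (auto simp: o_def linear_iff algebra_simps)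
  note lin = this
  show ?thesis
  proof (rule linearI)
    show "scatter_hess m A B (x + y) = scatter_hess m A B x + scatter_hess m A B y" for x y
      unfolding scatter_hess_def pair_sum_def linear_add[OF lin]
      by (simp add: vec_eq_iff sum.distrib distrib_left)
    show "scatter_hess m A B (r *\<^sub>R x) = r *\<^sub>R scatter_hess m A B x" for r x
      unfolding scatter_hess_def pair_sum_def linear_scale[OF lin]
      by (simp add: vec_eq_iff sum_distrib_left mult_ac)
  qed
qed

text \<open>
  To first order the speed does not change.
\<close>

lemma scatter_grad_tangent: "scatter_grad m A B \<in> EE m" "minner m A (scatter_grad m A B) = 0"
proof -
  have anti: "deflection (A $ i - A $ j) (B $ i - B $ j) = - deflection (A $ j - A $ i) (B $ j - B $ i)" for i j
    by (metis deflection_minus minus_diff_eq)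
  show "scatter_grad m A B \<in> EE m" unfolding scatter_grad_def by (rule pair_sum_in_EE) (rule anti)
  have "2 * minner m A (scatter_grad m A B) = 0"
    unfolding scatter_grad_def by (subst minner_pair_sum, rule anti) (simp add: inner_deflection)
  then show "minner m A (scatter_grad m A B) = 0" by simp
qed

lemma deflection_deriv_anti:
  "deflection_deriv (A $ i - A $ j) (B $ i - B $ j) (C $ i - C $ j)
    = - deflection_deriv (A $ j - A $ i) (B $ j - B $ i) (C $ j - C $ i)"
  by (metis deflection_deriv_minus minus_diff_eq)

lemma scatter_hess_tangent: "scatter_hess m A B C \<in> EE m" "minner m A (scatter_hess m A B C) = 0"
proof -
  show "scatter_hess m A B C \<in> EE m"
    unfolding scatter_hess_def by (rule pair_sum_in_EE) (rule deflection_deriv_anti)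
  have "2 * minner m A (scatter_hess m A B C) = 0"
    unfolding scatter_hess_def by (subst minner_pair_sum, rule deflection_deriv_anti) (simp add: inner_deflection_deriv)
  then show "minner m A (scatter_hess m A B C) = 0" by simp
qed

text \<open>
  The distance is at least \<open>norm (perp a b)\<close> and at least \<open>norm a\<close> times
  the time elapsed since closest approach; \<open>k\<close> adds up the two resulting estimates.
\<close>

lemma pair_line_separation:
  fixes a b :: "'a::real_inner"
  assumes a: "a \<noteq> 0" and b: "perp a b \<noteq> 0"
  shows "\<exists>k>0. \<forall>t. 1 + \<bar>t\<bar> \<le> k * norm (t *\<^sub>R a + b)"
proof -
  define x0 where "x0 = (a \<bullet> b) / (a \<bullet> a)"
  define k where "k = 1 / norm a + (1 + \<bar>x0\<bar>) / norm (perp a b)"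
  have pos: "norm a > 0" "norm (perp a b) > 0" using a b by auto
  have "1 + \<bar>t\<bar> \<le> k * norm (t *\<^sub>R a + b)" for t
  proof -
    let ?n = "norm (t *\<^sub>R a + b)"
    have n: "?n\<^sup>2 = (\<bar>t + x0\<bar> * norm a)\<^sup>2 + (norm (perp a b))\<^sup>2"
      using line_decomposition(2)[OF a, of t b] by (simp add: x0_def power_mult_distrib power2_norm_eq_inner)
    have n1: "norm (perp a b) \<le> ?n" by (rule power2_le_imp_le) (auto simp: n)
    have n2: "\<bar>t + x0\<bar> * norm a \<le> ?n" by (rule power2_le_imp_le) (auto simp: n)
    have "\<bar>t\<bar> \<le> \<bar>t + x0\<bar> + \<bar>x0\<bar>" by linarith
    moreover have "\<bar>t + x0\<bar> \<le> ?n / norm a" using n2 pos by (simp add: field_simps)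
    moreover have "1 \<le> ?n / norm (perp a b)" using n1 pos by (simp add: field_simps)
    then have "(1 + \<bar>x0\<bar>) * 1 \<le> (1 + \<bar>x0\<bar>) * (?n / norm (perp a b))" by (intro mult_left_mono) auto
    then have "1 + \<bar>x0\<bar> \<le> (1 + \<bar>x0\<bar>) * (?n / norm (perp a b))" by (simp only: mult_1_right)
    moreover have "1 + \<bar>t\<bar> \<le> u + v" if "\<bar>t\<bar> \<le> \<bar>t + x0\<bar> + \<bar>x0\<bar>" "\<bar>t + x0\<bar> \<le> u" "1 + \<bar>x0\<bar> \<le> v" for u v
      using that by linarith
    ultimately have "1 + \<bar>t\<bar> \<le> ?n / norm a + (1 + \<bar>x0\<bar>) * (?n / norm (perp a b))" by blast
    then show ?thesis by (simp add: k_def algebra_simps)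
  qed
  moreover have x1: "1 + \<bar>x0\<bar> > 0" by linarith
  have "k > 0" unfolding k_def by (intro add_pos_pos divide_pos_pos zero_less_one pos x1)
  ultimately show ?thesis by blast
qed

lemma free_pair_separated:
  assumes AB: "free_pair A B"
  obtains c where "c > 0" "\<And>t. separated (c * (1 + \<bar>t\<bar>)) (t *\<^sub>R A + B)"
proof -
  have "\<exists>k>0. i \<noteq> j \<longrightarrow> (\<forall>t. 1 + \<bar>t\<bar> \<le> k * norm (t *\<^sub>R (A $ j - A $ i) + (B $ j - B $ i)))" for i j
    using pair_line_separation[of "A $ j - A $ i" "B $ j - B $ i"] AB unfolding free_pair_def
    by (metis zero_less_one)
  then obtain k where k: "\<And>i j. k i j > 0"
    "\<And>i j t. i \<noteq> j \<Longrightarrow> 1 + \<bar>t\<bar> \<le> k i j * norm (t *\<^sub>R (A $ j - A $ i) + (B $ j - B $ i))" by metis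
  define K where "K = 1 + (\<Sum>i\<in>UNIV. \<Sum>j\<in>UNIV. k i j)"
  have k0: "0 \<le> k i j" for i j using k(1)[of i j] by simp
  have Kk: "k i j \<le> K" for i j
  proof -
    have "k i j \<le> (\<Sum>j\<in>UNIV. k i j)" using k0 by (intro member_le_sum) auto
    also have "\<dots> \<le> (\<Sum>i\<in>UNIV. \<Sum>j\<in>UNIV. k i j)"
      using k0 by (intro member_le_sum[of i UNIV "\<lambda>i. \<Sum>j\<in>UNIV. k i j"]) (auto intro!: sum_nonneg)
    finally show ?thesis by (simp add: K_def)
  qed
  have K: "K > 0" using k0 by (auto simp: K_def intro!: add_pos_nonneg sum_nonneg)
  show ?thesis
  proof (rule that[of "1 / K"])
    fix t
    show "separated (1 / K * (1 + \<bar>t\<bar>)) (t *\<^sub>R A + B)" unfolding separated_def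
    proof (intro allI impI)
      fix i j :: 'b assume "i \<noteq> j"
      let ?n = "norm ((t *\<^sub>R A + B) $ i - (t *\<^sub>R A + B) $ j)"
      have eq: "(t *\<^sub>R A + B) $ i - (t *\<^sub>R A + B) $ j = t *\<^sub>R (A $ i - A $ j) + (B $ i - B $ j)"
        by (simp add: algebra_simps)
      have "1 + \<bar>t\<bar> \<le> k j i * ?n" using k(2)[of j i t] \<open>i \<noteq> j\<close> unfolding eq by auto
      also have "\<dots> \<le> K * ?n" by (intro mult_right_mono Kk) simp
      finally show "1 / K * (1 + \<bar>t\<bar>) \<le> ?n" using K by (simp add: field_simps)
    qed
  qed (use K in simp)
qed

section \<open>Scattering images with interior\<close>

lemma not_CollD: "q \<notin> Coll \<Longrightarrow> i \<noteq> j \<Longrightarrow> q $ i \<noteq> q $ j"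
  unfolding Coll_def by blast

lemma closed_EE: "closed (EE m :: ('d::finite, 'n::finite) config set)"
  by (rule closed_subspace[OF subspace_EE])

text \<open>
  The tangent space at \<open>A\<close> of the sphere of velocities with the same energy.
\<close>

definition tangent :: "('n::finite \<Rightarrow> real) \<Rightarrow> ('d::finite, 'n) config \<Rightarrow> ('d, 'n) config set"
  where "tangent m A = {C \<in> EE m. minner m A C = 0}"

definition tangent_proj :: "('n::finite \<Rightarrow> real) \<Rightarrow> ('d::finite, 'n) config \<Rightarrow> ('d, 'n) config \<Rightarrow> ('d, 'n) config"
  where "tangent_proj m A x = x - (minner m A x / minner m A A) *\<^sub>R A"

text \<open>
  \<open>scatter_hess m A B\<close> maps the tangent space to itself, so this says that it is
  invertible there.
\<close>

definition nondegenerate :: "('n::finite \<Rightarrow> real) \<Rightarrow> ('d::finite, 'n) config \<Rightarrow> ('d, 'n) config \<Rightarrow> bool"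
  where "nondegenerate m A B \<longleftrightarrow> (\<forall>C\<in>tangent m A. scatter_hess m A B C = 0 \<longrightarrow> C = 0)"

lemma subspace_tangent: "subspace (tangent m A)"
  using subspace_EE[of m] by (auto simp: subspace_def tangent_def minner.zero_right minner.add_right minner.scaleR_right)

lemma linear_tangent_proj: "linear (tangent_proj m A)"
  by (auto intro!: linearI simp: tangent_proj_def minner.add_right minner.scaleR_right add_divide_distrib algebra_simps)

lemma tangent_proj_id: "C \<in> tangent m A \<Longrightarrow> tangent_proj m A C = C"
  by (simp add: tangent_def tangent_proj_def)

lemma linear_imp_bounded_norm:
  fixes f :: "'a::euclidean_space \<Rightarrow> 'b::real_normed_vector"
  assumes "linear f" obtains k where "k > 0" "\<And>x. norm (f x) \<le> k * norm x"
  using bounded_linear.pos_bounded[of f] assms by (auto simp: linear_conv_bounded_linear mult.commute)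

lemma separated_of_not_Coll:
  fixes A :: "('d::finite, 'n::finite) config"
  assumes "A \<notin> Coll"
  obtains d where "d > 0" "separated d A"
proof -
  let ?S = "insert 1 ((\<lambda>(i, j). norm (A $ i - A $ j)) ` {(i, j). i \<noteq> j})"
  have fin: "finite ?S" "?S \<noteq> {}" by auto
  have "Min ?S > 0" using assms fin by (subst Min_gr_iff) (auto simp: Coll_def)
  moreover have "separated (Min ?S) A"
    unfolding separated_def using fin by (auto intro!: Min_le)
  ultimately show ?thesis using that by blast
qed

context masses begin

lemma tangent_proj_in:
  assumes "A \<in> EE m" "x \<in> EE m"
  shows "tangent_proj m A x \<in> tangent m A"
  using assms by (cases "A = 0")
    (auto simp: tangent_def tangent_proj_def minner.diff_right minner.scaleR_right minner.zero_left intro!: EE_closed)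

text \<open>
  On the open half sphere around \<open>A\<close> the projection to the tangent space is a chart.
\<close>

lemma sphere_point_determined:
  assumes n: "mnorm m x = mnorm m y" and P: "tangent_proj m A x = tangent_proj m A y"
    and x: "minner m A x > 0" and y: "minner m A y > 0"
  shows "x = y"
proof -
  define a b u where "a = minner m A x / minner m A A" and "b = minner m A y / minner m A A" and "u = tangent_proj m A x"
  have A0: "A \<noteq> 0" using x by (auto simp: minner.zero_left)
  then have AA: "minner m A A > 0" by (rule minner_pos)
  have xu: "x = u + a *\<^sub>R A" by (simp add: u_def a_def tangent_proj_def)
  have yu: "y = u + b *\<^sub>R A" using P by (simp add: u_def b_def tangent_proj_def algebra_simps)
  have Au: "minner m A u = 0" using AA by (simp add: u_def tangent_proj_def minner.diff_right minner.scaleR_right minner.zero_left)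
  have sq: "minner m (u + t *\<^sub>R A) (u + t *\<^sub>R A) = minner m u u + t\<^sup>2 * minner m A A" for t
    using Au by (simp add: minner.add_left minner.add_right minner.scaleR_left minner.scaleR_right
        minner_commute[of m u A] power2_eq_square)
  have "minner m x x = minner m y y" using n mnorm_sq by metis
  then have "a\<^sup>2 = b\<^sup>2" using sq[of a] sq[of b] AA A0 by (simp add: xu[symmetric] yu[symmetric])
  moreover have "a > 0" "b > 0" using x y AA by (auto simp: a_def b_def)
  ultimately have "a = b" by (simp add: power2_eq_iff_nonneg)
  then show ?thesis using xu yu by simp
qed

lemma pot_le:
  assumes "separated d q" "d > 0"
  shows "pot m q \<le> (\<Sum>(i, j) | i < j. m i * m j) / d"
  unfolding pot_def sum_divide_distrib case_prod_beta
proof (rule sum_mono)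
  fix p :: "'n \<times> 'n" assume "p \<in> {p. fst p < snd p}"
  then have "d \<le> norm (q $ fst p - q $ snd p)" using assms(1) by (auto simp: separated_def)
  then show "m (fst p) * m (snd p) / norm (q $ fst p - q $ snd p) \<le> m (fst p) * m (snd p) / d"
    using assms(2) mass_pos by (intro divide_left_mono) (auto intro!: mult_nonneg_nonneg mult_pos_pos less_imp_le)
qed

lemma tangent_inverse:
  fixes A B :: "('d::finite, 'n) config"
  assumes nd: "nondegenerate m A B"
  obtains L where "linear L" "range L \<subseteq> tangent m A"
    "\<And>C. C \<in> tangent m A \<Longrightarrow> L (scatter_hess m A B C) = C"
    "\<And>y. y \<in> tangent m A \<Longrightarrow> L y = 0 \<Longrightarrow> y = 0"
proof -
  let ?V = "tangent m A" and ?D = "scatter_hess m A B"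
  have span: "span ?V = ?V" using subspace_tangent by (rule span_eq_iff[THEN iffD2])
  have lin: "linear ?D" by (rule linear_scatter_hess)
  have inj: "inj_on ?D ?V"
  proof (rule inj_onI)
    fix x y assume xy: "x \<in> ?V" "y \<in> ?V" "?D x = ?D y"
    then have "x - y \<in> ?V" "?D (x - y) = 0"
      using subspace_diff[OF subspace_tangent] linear_diff[OF lin] by auto
    then have "x - y = 0" using nd by (auto simp: nondegenerate_def)
    then show "x = y" by simp
  qed
  then have inj': "inj_on ?D (span ?V)" by (simp add: span)
  obtain L where L: "range L \<subseteq> ?V" "linear L" "\<forall>x\<in>?V. L (?D x) = x"
    using linear_inj_on_left_inverse[OF lin inj'] unfolding span by blast
  have "?D ` ?V \<subseteq> ?V" by (auto simp: tangent_def scatter_hess_tangent)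
  moreover have "dim (?D ` ?V) = dim ?V" by (rule dim_image_eq[OF lin inj'])
  ultimately have onto: "?D ` ?V = ?V"
    by (intro subspace_dim_equal linear_subspace_image[OF lin] subspace_tangent) auto
  show ?thesis
  proof (rule that[of L])
    show "y = 0" if "y \<in> ?V" "L y = 0" for y
    proof -
      have "y \<in> ?D ` ?V" unfolding onto by (rule that(1))
      then obtain C where C: "y = ?D C" "C \<in> ?V" by (rule imageE)
      have "C = L (?D C)" using L(3) C(2) by simp
      also have "\<dots> = 0" using that(2) C(1) by simp
      finally show ?thesis using C(1) linear_0[OF lin] by simp
    qed
    show "linear L" "range L \<subseteq> ?V" by (rule L)+
    show "L (?D C) = C" if "C \<in> ?V" for C using L(3) that by blast
  qed
qed

text \<open>
  The scaled tangential change of velocity \<open>P (U (B0 + C))\<close> is within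
  \<open>O(\<epsilon>)\<close> of \<open>G (B0 + C)\<close>, whose derivative at \<open>C =
  0\<close> has the inverse \<open>L\<close>. So \<open>C \<mapsto> C - L (P (U (B0 + C) -
  y))\<close> maps a small ball to itself for \<open>y\<close> near \<open>y0 = G B0\<close>, and a
  fixed point, which exists by Brouwer's theorem, is an offset with \<open>P (U (B0 + C)) =
  y\<close>.
\<close>

lemma scattering_near_free_line:
  fixes A B0 :: "('d::finite, 'n) config"
  assumes A: "A \<in> Ehat m" and B0: "B0 \<in> EE m" and fp: "free_pair A B0" and nd: "nondegenerate m A B0"
  obtains \<epsilon>1 \<delta> K y0 where "\<epsilon>1 > 0" "\<delta> > 0" "K > 0" "y0 \<in> tangent m A"
    "\<And>\<epsilon> y. 0 < \<epsilon> \<Longrightarrow> \<epsilon> \<le> \<epsilon>1 \<Longrightarrow> y \<in> tangent m A \<Longrightarrow> norm (y - y0) \<le> \<delta> \<Longrightarrow>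
      \<exists>A'\<in>Ehat m. scatters m A A' \<and> minner m A A' > 0 \<and> tangent_proj m A A' = \<epsilon> *\<^sub>R y \<and> norm (A' - A) \<le> K * \<epsilon>"
proof -
  let ?V = "tangent m A" and ?G = "scatter_grad m A" and ?D = "scatter_hess m A B0" and ?P = "tangent_proj m A"
  have AE: "A \<in> EE m" and Anc: "A \<notin> Coll" using A by (auto simp: Ehat_def)
  have AA: "minner m A A > 0" using minner_pos[OF Ehat_nonzero[OF A]] .
  obtain c where c: "c > 0" and sep: "\<And>t. separated (c * (1 + \<bar>t\<bar>)) (t *\<^sub>R A + B0)"
    using free_pair_separated[OF fp] by blast
  interpret fl: free_line m A B0 c by unfold_locales (rule c, rule sep)
  obtain L where L: "linear L" "range L \<subseteq> ?V" "\<And>C. C \<in> ?V \<Longrightarrow> L (?D C) = C" "\<And>y. y \<in> ?V \<Longrightarrow> L y = 0 \<Longrightarrow> y = 0"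
    using tangent_inverse[OF nd] by blast
  have linLP: "linear (\<lambda>x. L (?P x))" using linear_compose[OF linear_tangent_proj L(1)] by (simp add: o_def)
  obtain \<Lambda> where \<Lambda>: "\<Lambda> > 0" "\<And>x. norm (L (?P x)) \<le> \<Lambda> * norm x" using linear_imp_bounded_norm[OF linLP] by blast
  have LPV: "L (?P x) \<in> ?V" for x using L(2) by blast
  define y0 where "y0 = ?G B0"
  have GV: "?G B \<in> ?V" for B by (simp add: tangent_def scatter_grad_tangent)
  have DV: "?D C \<in> ?V" for C by (simp add: tangent_def scatter_hess_tangent)
  obtain \<eta>0 where \<eta>0: "\<eta>0 > 0" "\<And>B. norm (B - B0) < \<eta>0 \<Longrightarrow> norm (?G B - ?G B0 - ?D (B - B0)) \<le> 1 / (4 * \<Lambda>) * norm (B - B0)"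
    using scatter_grad_has_derivative[OF fp, of m] \<Lambda>(1) unfolding has_derivative_within_alt
    by (metis (no_types, lifting) UNIV_I mult_pos_pos zero_less_divide_1_iff zero_less_numeral)
  \<comment> \<open>\<open>\<eta>\<close> is the radius of the ball of offsets: small enough for the linear
    approximation of \<open>G\<close> to be accurate and for all the lines in it to stay well
    separated.\<close>
  define \<eta> where "\<eta> = min (\<eta>0 / 2) (c / 8)"
  have \<eta>: "\<eta> > 0" "\<eta> < \<eta>0" "\<eta> \<le> c / 8" using \<eta>0(1) c by (auto simp: \<eta>_def)
  define \<delta> where "\<delta> = \<eta> / (4 * \<Lambda>)"
  have \<delta>: "\<delta> > 0" using \<eta> \<Lambda> by (simp add: \<delta>_def)
  obtain d where d: "d > 0" "separated d A" using separated_of_not_Coll[OF Anc] by blast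
  obtain Cm where Cm: "Cm > 0" "\<And>x. \<bar>minner m A x\<bar> \<le> Cm * norm x"
    using bounded_linear.pos_bounded[OF minner.bounded_linear_right[of m A]] by (auto simp: mult.commute)
  define Q where "Q = (\<Sum>(i, j) | i < j. m i * m j) / (c / 2)"
  define \<kappa> where "\<kappa> = fl.lip_weight * fl.vmax * pi"
  have \<kappa>: "\<kappa> > 0" using fl.weight_pos fl.vmax_pos by (simp add: \<kappa>_def)
  \<comment> \<open>The bounds on \<open>\<epsilon>\<close> serve, in this order: existence of the orbits; the error
    \<open>U - G\<close>; that the outgoing velocity is not a collision; that it is in the half sphere
    around \<open>A\<close>; that the energy is positive.\<close>
  define \<epsilon>1 where "\<epsilon>1 = Min {fl.eps_max, \<eta> / (4 * \<Lambda> * \<kappa>), d / (4 * fl.vmax), minner m A A / (8 * Cm * fl.vmax), minner m A A / (8 * (\<bar>Q\<bar> + 1))}"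
  have \<epsilon>1: "\<epsilon>1 > 0"
    using fl.eps_max_pos \<eta> \<Lambda> \<kappa> d fl.vmax_pos AA Cm by (simp add: \<epsilon>1_def)
  show ?thesis
  proof (rule that[of \<epsilon>1 \<delta> fl.vmax y0, OF \<epsilon>1 \<delta> fl.vmax_pos])
    show "y0 \<in> ?V" unfolding y0_def by (rule GV)
    fix \<epsilon> y assume \<epsilon>: "0 < \<epsilon>" "\<epsilon> \<le> \<epsilon>1" and y: "y \<in> ?V" "norm (y - y0) \<le> \<delta>"
    have le: "\<epsilon> \<le> fl.eps_max" "\<epsilon> \<le> \<eta> / (4 * \<Lambda> * \<kappa>)" "\<epsilon> \<le> d / (4 * fl.vmax)"
      "\<epsilon> \<le> minner m A A / (8 * Cm * fl.vmax)" "\<epsilon> \<le> minner m A A / (8 * (\<bar>Q\<bar> + 1))"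
      using \<epsilon>(2) by (auto simp: \<epsilon>1_def)
    have e2: "\<Lambda> * (\<kappa> * \<epsilon>) \<le> \<eta> / 4" using le(2) \<Lambda>(1) \<kappa> by (simp add: field_simps)
    have e3: "2 * (\<epsilon> * fl.vmax) < d" using le(3) fl.vmax_pos d(1) by (simp add: field_simps)
    have e4: "Cm * (\<epsilon> * fl.vmax) \<le> minner m A A / 8" using le(4) fl.vmax_pos Cm(1) by (simp add: field_simps)
    have e5: "\<epsilon> * (\<bar>Q\<bar> + 1) \<le> minner m A A / 8" using le(5) by (simp add: field_simps add_pos_nonneg)
    obtain U where U: "continuous_on (cball B0 (c / 8)) U"
      and UG: "\<And>B F l. B \<in> cball B0 (c / 8) \<Longrightarrow> (\<And>t. (F has_vector_derivative force m (t *\<^sub>R A + B)) (at t))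
         \<Longrightarrow> (F \<longlongrightarrow> 0) at_bot \<Longrightarrow> (F \<longlongrightarrow> l) at_top \<Longrightarrow> norm (U B - l) \<le> fl.lip_weight * fl.vmax * pi * \<epsilon>"
      and Ub: "\<And>B. B \<in> cball B0 (c / 8) \<Longrightarrow> norm (U B) \<le> fl.vmax"
      and Uq: "\<And>B. B \<in> cball B0 (c / 8) \<Longrightarrow> \<exists>q p. (\<forall>t. (q has_vector_derivative p t) (at t)) \<and>
       (\<forall>t. (p has_vector_derivative \<epsilon> *\<^sub>R force m (q t)) (at t)) \<and> q 0 = B \<and>
       (p \<longlongrightarrow> A) at_bot \<and> (p \<longlongrightarrow> A + \<epsilon> *\<^sub>R U B) at_top \<and>
       (\<forall>t. norm (p t - A) \<le> \<epsilon> * fl.vmax) \<and> (\<forall>t. separated (c / 2) (q t))"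
      using fl.perturbed_orbits[of \<epsilon>] \<epsilon> le(1) by (metis less_imp_le)
    have Gdist: "norm (U B - ?G B) \<le> \<kappa> * \<epsilon>" if B: "B \<in> cball B0 (c / 8)" for B
    proof -
      have nB: "norm (B - B0) \<le> c / 8" using B by (simp add: dist_norm norm_minus_commute)
      have sepB: "separated (c / 2 * (1 + \<bar>t\<bar>)) (t *\<^sub>R A + B)" for t
        using fl.perturbed_separated[OF nB, of 0 t] c by simp
      have fpB: "free_pair A B" unfolding free_pair_def
      proof (intro allI impI conjI)
        fix i j :: 'n assume ij: "i \<noteq> j"
        then show a: "A $ j - A $ i \<noteq> 0" using fp by (simp add: free_pair_def)
        \<comment> \<open>The transverse offset is the relative position at the time of closest approach.\<close>
        define t where "t = - ((A $ j - A $ i) \<bullet> (B $ j - B $ i) / ((A $ j - A $ i) \<bullet> (A $ j - A $ i)))"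
        have "perp (A $ j - A $ i) (B $ j - B $ i) = t *\<^sub>R (A $ j - A $ i) + (B $ j - B $ i)"
          by (simp add: perp_def t_def)
        also have "\<dots> = (t *\<^sub>R A + B) $ j - (t *\<^sub>R A + B) $ i" by (simp add: algebra_simps)
        also have "\<dots> \<noteq> 0"
        proof -
          have "t *\<^sub>R A + B \<notin> Coll" using separated_not_Coll[OF sepB[of t]] c by (simp add: add_pos_nonneg)
          from not_CollD[OF this, of j i] show ?thesis using ij by simp
        qed
        finally show "perp (A $ j - A $ i) (B $ j - B $ i) \<noteq> 0" .
      qed
      obtain F where "\<And>t. (F has_vector_derivative force m (t *\<^sub>R A + B)) (at t)" "(F \<longlongrightarrow> 0) at_bot" "(F \<longlongrightarrow> ?G B) at_top"
        using line_force_integral[OF fpB, of m] by blast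
      from UG[OF B this] show ?thesis by (simp add: \<kappa>_def)
    qed
    define S where "S = ?V \<inter> cball 0 \<eta>"
    \<comment> \<open>A fixed point of \<open>f\<close> is an offset for which the scaled deflection is
      \<open>y\<close>.\<close>
    define f where "f C = C - L (?P (U (B0 + C) - y))" for C
    have SB: "B0 + C \<in> cball B0 (c / 8)" if "C \<in> S" for C
      using that \<eta> by (auto simp: S_def dist_norm)
    have fS: "f C \<in> S" if C: "C \<in> S" for C
    proof -
      have CV: "C \<in> ?V" and Cn: "norm C \<le> \<eta>" using C by (auto simp: S_def)
      define R where "R = ?G (B0 + C) - ?G B0 - ?D C"
      have Rn: "norm R \<le> 1 / (4 * \<Lambda>) * norm C"
        using \<eta>0(2)[of "B0 + C"] Cn \<eta> by (simp add: R_def)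
      have "U (B0 + C) - y = (U (B0 + C) - ?G (B0 + C)) + R + ?D C - (y - y0)"
        by (simp add: R_def y0_def)
      then have "L (?P (U (B0 + C) - y)) = L (?P (U (B0 + C) - ?G (B0 + C))) + L (?P R) + L (?P (?D C)) - L (?P (y - y0))"
        by (simp only: linear_add[OF linLP] linear_diff[OF linLP])
      moreover have "L (?P (?D C)) = C" using tangent_proj_id[OF DV] L(3)[OF CV] by simp
      ultimately have "f C = L (?P (y - y0)) - L (?P (U (B0 + C) - ?G (B0 + C))) - L (?P R)"
        by (simp add: f_def)
      then have "norm (f C) \<le> norm (L (?P (y - y0))) + norm (L (?P (U (B0 + C) - ?G (B0 + C)))) + norm (L (?P R))"
        by (metis (no_types, opaque_lifting) add_mono_thms_linordered_semiring(3) norm_triangle_ineq4 order_trans)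
      moreover have "norm (L (?P (y - y0))) \<le> \<eta> / 4"
        using \<Lambda>(2)[of "y - y0"] mult_left_mono[OF y(2), of \<Lambda>] \<Lambda>(1) by (simp add: \<delta>_def)
      moreover have "norm (L (?P (U (B0 + C) - ?G (B0 + C)))) \<le> \<eta> / 4"
        using \<Lambda>(2)[of "U (B0 + C) - ?G (B0 + C)"] mult_left_mono[OF Gdist[OF SB[OF C]], of \<Lambda>] \<Lambda>(1) e2 by linarith
      moreover have "norm (L (?P R)) \<le> \<eta> / 4"
        using \<Lambda>(2)[of R] mult_left_mono[OF Rn, of \<Lambda>] \<Lambda>(1) Cn by simp
      ultimately have "norm (f C) \<le> \<eta>" using \<eta>(1) by linarith
      moreover have "f C \<in> ?V" unfolding f_def by (intro subspace_diff[OF subspace_tangent] CV LPV)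
      ultimately show ?thesis by (simp add: S_def)
    qed
    have contf: "continuous_on S f"
    proof -
      have "continuous_on S (\<lambda>C. U (B0 + C))"
        by (rule continuous_on_compose2[OF U]) (use SB in \<open>auto intro!: continuous_intros\<close>)
      then have "continuous_on S (\<lambda>C. L (?P (U (B0 + C) - y)))"
        using linLP by (intro bounded_linear.continuous_on[of "\<lambda>x. L (?P x)"])
          (auto simp: linear_conv_bounded_linear intro!: continuous_intros)
      then show ?thesis unfolding f_def[abs_def] by (intro continuous_on_diff continuous_on_id)
    qed
    have "compact S" unfolding S_def
      by (intro closed_Int_compact closed_subspace subspace_tangent compact_cball)
    moreover have "convex S" unfolding S_def
      by (intro convex_Int subspace_imp_convex subspace_tangent convex_cball)
    moreover have "S \<noteq> {}" using subspace_0[OF subspace_tangent, of m A] \<eta>(1) by (auto simp: S_def)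
    ultimately obtain C where C: "C \<in> S" "f C = C"
      using brouwer[of S f] contf fS by blast
    define B where "B = B0 + C"
    have BB: "B \<in> cball B0 (c / 8)" using SB[OF C(1)] by (simp add: B_def)
    have BE: "B \<in> EE m" using C(1) B0 by (auto simp: B_def S_def tangent_def intro: EE_closed)
    define A' where "A' = A + \<epsilon> *\<^sub>R U B"
    obtain q p where qp: "\<And>t. (q has_vector_derivative p t) (at t)"
       "\<And>t. (p has_vector_derivative \<epsilon> *\<^sub>R force m (q t)) (at t)" "q 0 = B"
       "(p \<longlongrightarrow> A) at_bot" "(p \<longlongrightarrow> A') at_top" "\<And>t. norm (p t - A) \<le> \<epsilon> * fl.vmax" "\<And>t. separated (c / 2) (q t)"
      using Uq[OF BB] unfolding A'_def by blast
    have pE: "p t \<in> EE m" for t by (rule newton_in_EE(1)[OF qp(1,2,4) AE]) (simp add: qp(3) BE)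
    have A'E: "A' \<in> EE m"
      by (rule Lim_in_closed_set[OF closed_EE _ _ qp(5)]) (use pE in auto)
    have UE: "U B \<in> EE m"
    proof -
      have "U B = (1 / \<epsilon>) *\<^sub>R (A' - A)" using \<epsilon>(1) by (simp add: A'_def)
      then show ?thesis using A'E AE by (auto intro: EE_closed)
    qed
    have yE: "y \<in> EE m" using y(1) by (simp add: tangent_def)
    have "L (?P (U B - y)) = 0" using C(2) by (simp add: f_def B_def)
    from L(4)[OF tangent_proj_in[OF AE EE_closed(2)[OF UE yE]] this] have "?P (U B - y) = 0" .
    then have PU: "?P (U B) = y" using tangent_proj_id[OF y(1)] by (simp add: linear_diff[OF linear_tangent_proj])
    have near: "norm (A' - A) \<le> \<epsilon> * fl.vmax" using Ub[OF BB] \<epsilon>(1) by (simp add: A'_def mult_left_mono)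
    have inner_low: "minner m A x \<ge> minner m A A * (7 / 8)" if "norm (x - A) \<le> \<epsilon> * fl.vmax" for x
    proof -
      have "\<bar>minner m A (x - A)\<bar> \<le> minner m A A / 8"
        using Cm(2)[of "x - A"] mult_left_mono[OF that, of Cm] Cm(1) e4 by linarith
      moreover have "minner m A (x - A) = minner m A x - minner m A A" by (rule minner.diff_right)
      ultimately show ?thesis by linarith
    qed
    have A'hat: "A' \<in> Ehat m"
    proof -
      have "separated (d - 2 * (\<epsilon> * fl.vmax)) (A + (A' - A))" by (rule separated_perturb[OF d(2) near])
      then have "A' \<notin> Coll" using e3 by (intro separated_not_Coll) auto
      then show ?thesis using A'E by (simp add: Ehat_def)
    qed
    have "scatters m A A'"
    proof (rule newton_scatters[OF qp(1,2) _ _ _ _ qp(4,5) A A'hat])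
      show "0 \<le> \<epsilon>" using \<epsilon> by simp
      show "q t \<notin> Coll" for t using separated_not_Coll[OF qp(7)] c by simp
      show "q 0 \<in> EE m" by (simp add: qp(3) BE)
      fix t
      have "minner m (p t) (p t) = 2 * minner m A (p t) - minner m A A + minner m (p t - A) (p t - A)"
        by (simp add: minner.diff_left minner.diff_right minner_commute[of m "p t" A])
      then have low: "minner m (p t) (p t) \<ge> minner m A A * (3 / 4)"
        using inner_low[OF qp(6)[of t]] minner_nonneg[of "p t - A"] by linarith
      have "pot m (q t) \<le> Q" unfolding Q_def by (rule pot_le[OF qp(7)]) (use c in simp)
      then have "\<epsilon> * pot m (q t) \<le> \<epsilon> * (\<bar>Q\<bar> + 1)" using \<epsilon>(1) by (intro mult_left_mono) auto
      then show "0 < minner m (p t) (p t) / 2 - \<epsilon> * pot m (q t)" using low e5 AA by linarith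
    qed
    moreover have "minner m A A' > 0" using inner_low[OF near] AA by linarith
    moreover have "?P A' = \<epsilon> *\<^sub>R y"
    proof -
      have "?P A = 0" using AA by (simp add: tangent_proj_def)
      then show ?thesis
        by (simp add: A'_def linear_add[OF linear_tangent_proj] linear_scale[OF linear_tangent_proj] PU)
    qed
    ultimately show "\<exists>A'\<in>Ehat m. scatters m A A' \<and> minner m A A' > 0 \<and> ?P A' = \<epsilon> *\<^sub>R y \<and> norm (A' - A) \<le> fl.vmax * \<epsilon>"
      using A'hat near by (intro bexI[of _ A']) (auto simp: mult.commute)
  qed
qed

text \<open>
  \<open>W\<close> is the union over \<open>\<epsilon>\<close> of the balls covered in
  \<open>scattering_near_free_line\<close>, a truncated cone with its tip at \<open>A\<close> in the
  chart of \<open>sphere_point_determined\<close>.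
\<close>

theorem scattering_image_open:
  fixes A B0 :: "('d::finite, 'n) config"
  assumes A: "A \<in> Ehat m" and B0: "B0 \<in> EE m" and fp: "free_pair A B0" and nd: "nondegenerate m A B0"
  shows "\<exists>W. W \<noteq> {} \<and> openin (top_of_set (Shat m (mnorm m A))) W \<and> W \<subseteq> HS m A \<and> A \<in> closure W"
proof -
  obtain \<epsilon>1 \<delta> K y0 where \<epsilon>1: "\<epsilon>1 > 0" and \<delta>: "\<delta> > 0" and K: "K > 0" and y0: "y0 \<in> tangent m A"
    and sc: "\<And>\<epsilon> y. 0 < \<epsilon> \<Longrightarrow> \<epsilon> \<le> \<epsilon>1 \<Longrightarrow> y \<in> tangent m A \<Longrightarrow> norm (y - y0) \<le> \<delta> \<Longrightarrow>
      \<exists>A'\<in>Ehat m. scatters m A A' \<and> minner m A A' > 0 \<and> tangent_proj m A A' = \<epsilon> *\<^sub>R y \<and> norm (A' - A) \<le> K * \<epsilon>"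
    using scattering_near_free_line[OF assms] by metis
  let ?S = "Shat m (mnorm m A)" and ?P = "tangent_proj m A"
  define N where "N = {x. 0 < minner m A x} \<inter> (\<Union>\<epsilon>\<in>{0<..<\<epsilon>1}. {x. norm (?P x /\<^sub>R \<epsilon> - y0) < \<delta>})"
  have contP: "continuous_on UNIV ?P"
    by (rule linear_continuous_on[OF linear_tangent_proj[unfolded linear_conv_bounded_linear]])
  have "open {x. norm (?P x /\<^sub>R \<epsilon> - y0) < \<delta>}" for \<epsilon>
    by (intro open_Collect_less continuous_on_norm continuous_on_diff continuous_on_scaleR continuous_on_const contP)
  moreover have "open {x. 0 < minner m A x}"
    by (intro open_Collect_less continuous_on_const linear_continuous_on minner.bounded_linear_right)
  ultimately have "open N" unfolding N_def by (intro open_Int open_UN) auto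
  define W where "W = ?S \<inter> N"
  have "openin (top_of_set ?S) W" unfolding W_def using \<open>open N\<close> by (simp add: openin_open_Int)
  moreover have "W \<subseteq> HS m A"
  proof
    fix x assume "x \<in> W"
    then obtain \<epsilon> where x: "x \<in> Ehat m" "mnorm m x = mnorm m A" "0 < minner m A x"
      and \<epsilon>: "0 < \<epsilon>" "\<epsilon> < \<epsilon>1" "norm (?P x /\<^sub>R \<epsilon> - y0) < \<delta>"
      by (auto simp: W_def N_def Shat_def)
    have AE: "A \<in> EE m" "x \<in> EE m" using A x by (auto simp: Ehat_def)
    have "?P x /\<^sub>R \<epsilon> \<in> tangent m A"
      by (intro subspace_scale[OF subspace_tangent] tangent_proj_in AE)
    then obtain A' where A': "A' \<in> Ehat m" "scatters m A A'" "minner m A A' > 0" "?P A' = \<epsilon> *\<^sub>R (?P x /\<^sub>R \<epsilon>)"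
      using sc[of \<epsilon> "?P x /\<^sub>R \<epsilon>"] \<epsilon> by fastforce
    have "x = A'"
    proof (rule sphere_point_determined[OF _ _ x(3) A'(3)])
      show "mnorm m x = mnorm m A'" using scatters_energy[OF A A'(1,2)] x(2) by simp
      show "?P x = ?P A'" using A'(4) \<epsilon>(1) by simp
    qed
    then show "x \<in> HS m A" using A' by (simp add: HS_def)
  qed
  moreover have "\<exists>x\<in>W. dist x A < e" if e: "e > 0" for e
  proof -
    define \<epsilon> where "\<epsilon> = min (\<epsilon>1 / 2) (e / (2 * K))"
    have \<epsilon>: "0 < \<epsilon>" "\<epsilon> < \<epsilon>1" "K * \<epsilon> < e"
    proof -
      show "0 < \<epsilon>" "\<epsilon> < \<epsilon>1" using \<epsilon>1 e K by (auto simp: \<epsilon>_def)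
      have "K * \<epsilon> \<le> K * (e / (2 * K))" using K by (intro mult_left_mono) (auto simp: \<epsilon>_def)
      also have "\<dots> < e" using K e by simp
      finally show "K * \<epsilon> < e" .
    qed
    obtain A' where A': "A' \<in> Ehat m" "scatters m A A'" "minner m A A' > 0" "?P A' = \<epsilon> *\<^sub>R y0" "norm (A' - A) \<le> K * \<epsilon>"
      using sc[of \<epsilon> y0] \<epsilon> y0 \<delta> by auto
    have "?P A' /\<^sub>R \<epsilon> - y0 = 0" using A'(4) \<epsilon>(1) by simp
    then have "A' \<in> N" using A'(3) \<epsilon> \<delta> by (auto simp: N_def intro!: bexI[of _ \<epsilon>])
    then have "A' \<in> W" using A'(1) scatters_energy[OF A A'(1,2)] by (simp add: W_def Shat_def)
    moreover have "dist A' A < e" using A'(5) \<epsilon>(3) by (simp add: dist_norm)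
    ultimately show ?thesis by blast
  qed
  then have "A \<in> closure W" "W \<noteq> {}" using zero_less_one by (auto simp: closure_approachable) (metis all_not_in_conv zero_less_one)
  ultimately show ?thesis by blast
qed

end

section \<open>Nondegenerate lines: openness and planar velocities\<close>

lemma tendsto_perp [tendsto_intros]:
  assumes "(f \<longlongrightarrow> a) F" "(g \<longlongrightarrow> b) F" "a \<noteq> 0"
  shows "((\<lambda>x. perp (f x) (g x)) \<longlongrightarrow> perp a b) F"
  unfolding perp_def using assms by (intro tendsto_intros) auto

lemma tendsto_deflection_deriv [tendsto_intros]:
  assumes f: "(f \<longlongrightarrow> a) F" and g: "(g \<longlongrightarrow> b) F" and h: "(h \<longlongrightarrow> c) F" and a: "a \<noteq> 0" and b: "perp a b \<noteq> 0"
  shows "((\<lambda>x. deflection_deriv (f x) (g x) (h x)) \<longlongrightarrow> deflection_deriv a b c) F"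
proof -
  note p = tendsto_perp[OF f g a] tendsto_perp[OF f h a]
  show ?thesis unfolding deflection_deriv_def inversion_deriv_def
    using a b by (intro tendsto_scaleR tendsto_diff tendsto_divide tendsto_mult tendsto_inverse tendsto_norm
        tendsto_inner tendsto_power tendsto_const f p) auto
qed

lemma deflection_deriv_0 [simp]: "deflection_deriv 0 b c = 0"
  by (simp add: deflection_deriv_def)

lemma tendsto_pair_diff:
  "(f \<longlongrightarrow> (A :: ('a::real_normed_vector) ^ 'n::finite)) F \<Longrightarrow> ((\<lambda>x. f x $ j - f x $ i) \<longlongrightarrow> A $ j - A $ i) F"
  by (intro tendsto_diff tendsto_vec_nth)

lemma tendsto_scatter_hess:
  assumes f: "(f \<longlongrightarrow> A) F" and g: "(g \<longlongrightarrow> B) F" and h: "(h \<longlongrightarrow> C) F" and AB: "free_pair A B"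
  shows "((\<lambda>x. scatter_hess m (f x) (g x) (h x)) \<longlongrightarrow> scatter_hess m A B C) F"
  unfolding scatter_hess_def pair_sum_def
proof (intro tendsto_vec_lambda tendsto_sum tendsto_scaleR tendsto_const)
  fix i j
  show "((\<lambda>x. deflection_deriv (f x $ j - f x $ i) (g x $ j - g x $ i) (h x $ j - h x $ i)) \<longlongrightarrow>
     deflection_deriv (A $ j - A $ i) (B $ j - B $ i) (C $ j - C $ i)) F"
  proof (cases "i = j")
    case False
    then show ?thesis using AB
      by (intro tendsto_deflection_deriv tendsto_pair_diff f g h) (auto simp: free_pair_def)
  qed simp
qed

lemma eventually_free_pair:
  assumes f: "(f \<longlongrightarrow> A) F" and g: "(g \<longlongrightarrow> B) F" and AB: "free_pair A B"
  shows "eventually (\<lambda>x. free_pair (f x) (g x)) F"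
  unfolding free_pair_def
proof (intro eventually_all_finite)
  fix i j
  show "eventually (\<lambda>x. i \<noteq> j \<longrightarrow> f x $ j - f x $ i \<noteq> 0 \<and> perp (f x $ j - f x $ i) (g x $ j - g x $ i) \<noteq> 0) F"
  proof (cases "i = j")
    case False
    then have ne: "A $ j - A $ i \<noteq> 0" "perp (A $ j - A $ i) (B $ j - B $ i) \<noteq> 0" using AB by (auto simp: free_pair_def)
    have "eventually (\<lambda>x. f x $ j - f x $ i \<noteq> 0) F"
      by (rule tendsto_imp_eventually_ne[OF tendsto_pair_diff[OF f] ne(1)])
    moreover have "eventually (\<lambda>x. perp (f x $ j - f x $ i) (g x $ j - g x $ i) \<noteq> 0) F"
      by (rule tendsto_imp_eventually_ne[OF tendsto_perp[OF tendsto_pair_diff[OF f] tendsto_pair_diff[OF g] ne(1)] ne(2)])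
    ultimately show ?thesis by eventually_elim simp
  qed simp
qed

text \<open>
  With the next two lemmas, the compactness argument that is used twice below: along a convergent
  sequence of degenerate lines, kernel vectors of norm one accumulate at a tangent vector of norm
  one.
\<close>

lemma degenerate_unit_vector:
  assumes "\<not> nondegenerate m A B"
  obtains C where "C \<in> tangent m A" "norm C = 1" "scatter_hess m A B C = 0"
proof -
  obtain C where C: "C \<in> tangent m A" "scatter_hess m A B C = 0" "C \<noteq> 0"
    using assms by (auto simp: nondegenerate_def)
  show ?thesis
  proof (rule that[of "C /\<^sub>R norm C"])
    show "C /\<^sub>R norm C \<in> tangent m A" by (rule subspace_scale[OF subspace_tangent C(1)])
    show "norm (C /\<^sub>R norm C) = 1" using C(3) by simp
    show "scatter_hess m A B (C /\<^sub>R norm C) = 0" using C(2) linear_scale[OF linear_scatter_hess[of m A B], of "inverse (norm C)" C] by simp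
  qed
qed

lemma unit_subsequence:
  fixes C :: "nat \<Rightarrow> 'a::euclidean_space"
  assumes "\<And>n. norm (C n) = 1"
  obtains l r where "norm l = 1" "strict_mono (r :: nat \<Rightarrow> nat)" "(\<lambda>n. C (r n)) \<longlonglongrightarrow> l"
proof -
  have "compact (sphere (0::'a) 1)" by simp
  then obtain l r where "l \<in> sphere 0 1" "strict_mono (r :: nat \<Rightarrow> nat)" "(C \<circ> r) \<longlonglongrightarrow> l"
    using assms unfolding compact_def by (metis mem_sphere_0)
  then show ?thesis using that by (auto simp: o_def)
qed

lemma tangent_limit:
  assumes A: "A \<longlonglongrightarrow> a" and C: "C \<longlonglongrightarrow> c" and "\<And>n. C n \<in> tangent m (A n)"
  shows "c \<in> tangent m a"
proof -
  have "c \<in> EE m" by (rule closed_sequentially[OF closed_EE _ C]) (use assms(3) in \<open>auto simp: tangent_def\<close>)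
  moreover have "(\<lambda>n. minner m (A n) (C n)) \<longlonglongrightarrow> minner m a c" by (rule minner.tendsto[OF A C])
  then have "minner m a c = 0" using assms(3) by (simp add: tangent_def tendsto_const_iff LIMSEQ_const_iff)
  ultimately show ?thesis by (simp add: tangent_def)
qed

text \<open>
  The velocities for which the generic openness statement will be shown.
\<close>

definition scattering_regular :: "('n::finite \<Rightarrow> real) \<Rightarrow> ('d::finite, 'n) config \<Rightarrow> bool"
  where "scattering_regular m A \<longleftrightarrow> (\<exists>B\<in>EE m. free_pair A B \<and> nondegenerate m A B)"

lemma scattering_regular_open:
  fixes A :: "('d::finite, 'n::finite) config"
  assumes "scattering_regular m A"
  shows "\<exists>e>0. \<forall>A'. dist A' A < e \<longrightarrow> scattering_regular m A'"
proof (rule ccontr)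
  assume neg: "\<not> (\<exists>e>0. \<forall>A'. dist A' A < e \<longrightarrow> scattering_regular m A')"
  obtain B where B: "B \<in> EE m" "free_pair A B" "nondegenerate m A B"
    using assms by (auto simp: scattering_regular_def)
  have "\<exists>A'. dist A' A < inverse (real (Suc n)) \<and> \<not> scattering_regular m A'" for n
    using neg by (metis inverse_positive_iff_positive of_nat_0_less_iff zero_less_Suc)
  then obtain X where X: "\<And>n. dist (X n) A < inverse (real (Suc n))" "\<And>n. \<not> scattering_regular m (X n)" by metis
  have XA: "X \<longlonglongrightarrow> A"
  proof (rule tendsto_dist_iff[THEN iffD2, OF Lim_null_comparison])
    show "eventually (\<lambda>n. norm (dist (X n) A) \<le> inverse (real (Suc n))) sequentially"
      using less_imp_le[OF X(1)] by simp
  qed (rule LIMSEQ_inverse_real_of_nat)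
  obtain N where N: "\<And>n. n \<ge> N \<Longrightarrow> free_pair (X n) B"
    using eventually_free_pair[OF XA tendsto_const B(2)] by (auto simp: eventually_sequentially)
  have "\<exists>C. C \<in> tangent m (X (n + N)) \<and> norm C = 1 \<and> scatter_hess m (X (n + N)) B C = 0" for n
    using X(2)[of "n + N"] N[of "n + N"] B(1) degenerate_unit_vector[of m "X (n + N)" B]
    unfolding scattering_regular_def by (metis le_add2)
  then obtain C where C: "\<And>n. C n \<in> tangent m (X (n + N))" "\<And>n. norm (C n) = 1"
    "\<And>n. scatter_hess m (X (n + N)) B (C n) = 0" by metis
  obtain c r where c: "norm c = 1" "strict_mono r" "(\<lambda>n. C (r n)) \<longlonglongrightarrow> c" by (rule unit_subsequence[OF C(2)])
  have Xr: "(\<lambda>n. X (r n + N)) \<longlonglongrightarrow> A"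
    using LIMSEQ_subseq_LIMSEQ[OF LIMSEQ_ignore_initial_segment[OF XA, of N] c(2)] by (simp add: o_def)
  have "c \<in> tangent m A" by (rule tangent_limit[OF Xr c(3)]) (rule C)
  moreover have "(\<lambda>n. scatter_hess m (X (r n + N)) B (C (r n))) \<longlonglongrightarrow> scatter_hess m A B c"
    by (rule tendsto_scatter_hess[OF Xr tendsto_const c(3) B(2)])
  then have "scatter_hess m A B c = 0" by (simp add: C(3) LIMSEQ_const_iff)
  ultimately have "c = 0" using B(3) by (auto simp: nondegenerate_def)
  then show False using c(1) by simp
qed

text \<open>
  The derivative of the deflection acts on the plane transverse to \<open>a\<close> as a multiple of
  minus the reflection that flips \<open>b\<close>. If \<open>d\<close> is the reflection of
  \<open>c\<close> in the plane spanned by \<open>a\<close> and \<open>b\<close>, the two signs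
  combine to a definite one.
\<close>

lemma inner_reflected_deflection_deriv:
  fixes a b c :: "'a::real_inner"
  assumes aa: "a \<bullet> a = n" and bb: "b \<bullet> b = n" and ab: "a \<bullet> b = 0" and n: "n > 0"
    and d: "d = (2 * (a \<bullet> c) / n) *\<^sub>R a + (2 * (b \<bullet> c) / n) *\<^sub>R b - c"
  shows "d \<bullet> deflection_deriv a b c = - (2 / (norm a * n)) * (perp a c \<bullet> perp a c)"
proof -
  define p where "p = perp a c"
  have pb: "perp a b = b" by (simp add: perp_def ab)
  have p: "p = c - ((a \<bullet> c) / n) *\<^sub>R a" by (simp add: p_def perp_def aa)
  have bp: "b \<bullet> p = b \<bullet> c" using ab by (simp add: p inner_diff_right inner_commute)
  have bd: "b \<bullet> d = b \<bullet> c" using n ab bb by (simp add: d inner_diff_right inner_add_right inner_commute)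
  have ap: "a \<bullet> p = 0" by (simp add: p_def)
  have pp: "p \<bullet> p = c \<bullet> p" by (simp add: p_def perp_inner[of a c c, symmetric] inner_commute)
  have dp: "d \<bullet> p = 2 * (b \<bullet> c) * (b \<bullet> c) / n - p \<bullet> p"
    using ap bp pp by (simp add: d inner_diff_left inner_add_left)
  have "d \<bullet> inversion_deriv b p = (d \<bullet> p - 2 * (b \<bullet> c) * (b \<bullet> c) / n) / n"
    using n by (simp add: inversion_deriv_def bb inner_diff_right bp bd[unfolded inner_commute[of b d]] power2_eq_square field_simps)
  also have "\<dots> = - (p \<bullet> p) / n" by (simp add: dp)
  finally show ?thesis by (simp add: deflection_deriv_def pb p_def[symmetric])
qed

context masses begin

lemma constant_in_EE:
  assumes X: "X \<in> EE m" and const: "\<And>i. X $ i = z"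
  shows "X = 0"
proof -
  have "(\<Sum>i\<in>UNIV. m i) *\<^sub>R z = 0" using X const by (simp add: EE_def scaleR_sum_left)
  moreover have "(\<Sum>i\<in>UNIV. m i) > 0" by (intro sum_pos) (auto simp: mass_pos)
  ultimately have "z = 0" by simp
  then show ?thesis using const by (simp add: vec_eq_iff)
qed

text \<open>
  Tangent configurations are orthogonal to both translations and dilations of \<open>A\<close>.
\<close>

lemma tangent_homothety_zero:
  assumes A: "A \<in> Ehat m" and C: "C \<in> tangent m A" and h: "\<And>i. C $ i = z + k *\<^sub>R (A $ i - y)"
  shows "C = 0"
proof -
  have "C - k *\<^sub>R A = 0"
    using A C by (intro constant_in_EE[of _ "z - k *\<^sub>R y"] EE_closed)
      (auto simp: tangent_def Ehat_def h algebra_simps)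
  then have CA: "C = k *\<^sub>R A" by simp
  then have "k * minner m A A = 0" using C by (simp add: tangent_def minner.scaleR_right)
  then have "k = 0" using Ehat_nonzero[OF A] by simp
  then show ?thesis using CA by simp
qed

text \<open>
  Take three bodies \<open>p\<close>, \<open>q\<close>, \<open>r\<close> whose velocities form a
  proper triangle. The differences of \<open>C\<close> along its sides form a similar triangle, of
  ratio \<open>\<kappa>\<close>, say; subtract \<open>\<kappa> A\<close> from \<open>C\<close>. For
  any other body \<open>l\<close>, the difference to the common value at \<open>p\<close>,
  \<open>q\<close> and \<open>r\<close> is then parallel to three vectors \<open>A $ l - A $
  p\<close>, \<open>A $ l - A $ q\<close>, \<open>A $ l - A $ r\<close>, which are not all on one
  line.
\<close>

lemma parallel_differences_zero:
  fixes A C :: "('d::finite, 'n) config"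
  assumes A: "A \<in> Ehat m" and nc: "\<not> collinear (range (\<lambda>i. A $ i))" and C: "C \<in> tangent m A"
    and par: "\<And>i j. perp (A $ j - A $ i) (C $ j - C $ i) = 0"
  shows "C = 0"
proof -
  have Ane: "A $ i \<noteq> A $ j" if "i \<noteq> j" for i j using A not_CollD[OF _ that] by (auto simp: Ehat_def)
  have par': "\<exists>k. C $ j - C $ i = k *\<^sub>R (A $ j - A $ i)" for i j
    using par unfolding perp_eq_0_iff .
  define lam where "lam i j = (SOME k. C $ j - C $ i = k *\<^sub>R (A $ j - A $ i))" for i j
  have lam: "C $ j - C $ i = lam i j *\<^sub>R (A $ j - A $ i)" for i j
    unfolding lam_def by (rule someI_ex[OF par'])
  obtain p q :: 'n where pq: "p \<noteq> q" using two_elements[OF two_bodies] by blast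
  define u where "u = A $ q - A $ p"
  have u: "u \<noteq> 0" using Ane[OF pq] by (simp add: u_def)
  obtain r where r: "\<And>k. A $ r - A $ p \<noteq> k *\<^sub>R u"
  proof -
    have "\<exists>r. \<forall>k. A $ r - A $ p \<noteq> k *\<^sub>R u"
    proof (rule ccontr)
      assume "\<not> ?thesis"
      then obtain k where "\<And>r. A $ r - A $ p = k r *\<^sub>R u" by metis
      then have "A $ i - A $ j = (k i - k j) *\<^sub>R u" for i j
        by (metis (no_types, lifting) diff_diff_eq2 diff_add_cancel scaleR_diff_left)
      then have "collinear (range (\<lambda>i. A $ i))" unfolding collinear_def by blast
      with nc show False by blast
    qed
    then show ?thesis using that by blast
  qed
  define v where "v = A $ r - A $ p"
  define \<kappa> where "\<kappa> = lam p q"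
  have "lam q r *\<^sub>R (v - u) = lam p r *\<^sub>R v - lam p q *\<^sub>R u"
  proof -
    have vu: "v - u = A $ r - A $ q" by (simp add: u_def v_def)
    show ?thesis unfolding vu unfolding u_def v_def lam[symmetric] by simp
  qed
  then have dep: "(lam q r - lam p r) *\<^sub>R v = (lam q r - lam p q) *\<^sub>R u" by (simp add: algebra_simps)
  have eq1: "lam q r = lam p r"
  proof (rule ccontr)
    assume ne: "lam q r \<noteq> lam p r"
    then have "v = ((lam q r - lam p q) / (lam q r - lam p r)) *\<^sub>R u"
      using arg_cong[OF dep, of "\<lambda>x. (1 / (lam q r - lam p r)) *\<^sub>R x"] by simp
    with r[of "(lam q r - lam p q) / (lam q r - lam p r)", folded v_def] show False by contradiction
  qed
  then have eq2: "lam q r = lam p q" using dep u by simp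
  define X where "X = C - \<kappa> *\<^sub>R A"
  have X: "X $ j - X $ i = (lam i j - \<kappa>) *\<^sub>R (A $ j - A $ i)" for i j
    using lam[of j i] by (simp add: X_def algebra_simps)
  have Xpq: "X $ q = X $ p" using X[of q p] by (simp add: \<kappa>_def)
  have Xpr: "X $ r = X $ p" using X[of r p] eq1 eq2 by (simp add: \<kappa>_def)
  have "X $ l = X $ p" for l
  proof (rule ccontr)
    assume ne: "X $ l \<noteq> X $ p"
    define x where "x = X $ l - X $ p"
    have mult: "\<exists>s. A $ l - A $ i = s *\<^sub>R x" if "X $ i = X $ p" for i
    proof -
      have e: "x = (lam i l - \<kappa>) *\<^sub>R (A $ l - A $ i)" using X[of l i] that by (simp add: x_def)
      then have "lam i l - \<kappa> \<noteq> 0" using ne by (auto simp: x_def)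
      then have "A $ l - A $ i = (1 / (lam i l - \<kappa>)) *\<^sub>R x" by (simp add: e)
      then show ?thesis by blast
    qed
    obtain s1 s2 s3 where s: "A $ l - A $ p = s1 *\<^sub>R x" "A $ l - A $ q = s2 *\<^sub>R x" "A $ l - A $ r = s3 *\<^sub>R x"
      using mult[of p] mult[OF Xpq] mult[OF Xpr] by blast
    have us: "u = (s1 - s2) *\<^sub>R x" unfolding u_def scaleR_diff_left s[symmetric] by simp
    have vs: "A $ r - A $ p = (s1 - s3) *\<^sub>R x" unfolding scaleR_diff_left s[symmetric] by simp
    have "s1 - s2 \<noteq> 0" using us u by auto
    then have "A $ r - A $ p = ((s1 - s3) / (s1 - s2)) *\<^sub>R u" unfolding us vs by simp
    then show False using r by blast
  qed
  then show ?thesis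
    by (intro tangent_homothety_zero[OF A C, of "X $ p" \<kappa> 0]) (simp add: X_def algebra_simps)
qed

text \<open>
  Only differences of offsets matter, so the centre of mass can always be moved to the origin.
\<close>

lemma centred_representative:
  fixes B :: "('d::finite, 'n) config"
  obtains B' where "B' \<in> EE m" "\<And>i j. B' $ j - B' $ i = B $ j - B $ i"
proof -
  define M where "M = (\<Sum>i\<in>UNIV. m i)"
  have M: "M > 0" unfolding M_def by (intro sum_pos) (auto simp: mass_pos)
  define z where "z = (\<Sum>i\<in>UNIV. m i *\<^sub>R B $ i) /\<^sub>R M"
  have "(\<Sum>i\<in>UNIV. m i *\<^sub>R (B $ i - z)) = (\<Sum>i\<in>UNIV. m i *\<^sub>R B $ i) - M *\<^sub>R z"
    by (simp add: scaleR_diff_right sum_subtractf M_def scaleR_sum_left)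
  also have "\<dots> = 0" using M by (simp add: z_def)
  finally show ?thesis by (intro that[of "\<chi> i. B $ i - z"]) (auto simp: EE_def)
qed

lemma scattering_regularI:
  fixes A B :: "('d::finite, 'n) config"
  assumes "free_pair A B" "nondegenerate m A B"
  shows "scattering_regular m A"
proof -
  obtain B' where B': "B' \<in> EE m" "\<And>i j. B' $ j - B' $ i = B $ j - B $ i" using centred_representative by blast
  have "free_pair A B'" using assms(1) by (simp add: free_pair_def B'(2))
  moreover have "nondegenerate m A B'" using assms(2) by (simp add: nondegenerate_def scatter_hess_def B'(2))
  ultimately show ?thesis using B'(1) by (auto simp: scattering_regular_def)
qed

text \<open>
  \<open>J\<close> turns the plane by a right angle and kills its complement; \<open>\<rho>\<close>
  is the reflection in the plane. For every pair the relative offset is \<open>J\<close> of the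
  relative velocity, so that \<open>inner_reflected_deflection_deriv\<close> applies to all pairs
  with the same \<open>\<rho>\<close>.
\<close>

lemma planar_scattering_regular:
  fixes A :: "('d::finite, 'n) config"
  assumes A: "A \<in> Ehat m" and nc: "\<not> collinear (range (\<lambda>i. A $ i))"
    and e: "e1 \<bullet> e1 = 1" "e2 \<bullet> e2 = 1" "e1 \<bullet> e2 = 0"
    and pl: "\<And>i j. A $ j - A $ i \<in> span {e1, e2}"
  shows "scattering_regular m A"
proof -
  define J where "J x = (e1 \<bullet> x) *\<^sub>R e2 - (e2 \<bullet> x) *\<^sub>R e1" for x
  define B where "B = (\<chi> i. J (A $ i))"
  have Jdiff: "B $ j - B $ i = J (A $ j - A $ i)" for i j
    by (simp add: B_def J_def inner_diff_right algebra_simps)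
  have Ane: "A $ j - A $ i \<noteq> 0" if "i \<noteq> j" for i j using A not_CollD[of A j i] that by (auto simp: Ehat_def)
  have xy: "\<exists>x y. A $ j - A $ i = x *\<^sub>R e1 + y *\<^sub>R e2" for i j
    using pl[of j i] unfolding span_insert span_empty by (auto simp: algebra_simps)
  have J: "a \<bullet> J a = 0" "J a \<bullet> J a = a \<bullet> a" "(a \<bullet> a) *\<^sub>R ((e1 \<bullet> c) *\<^sub>R e1 + (e2 \<bullet> c) *\<^sub>R e2) = (a \<bullet> c) *\<^sub>R a + (J a \<bullet> c) *\<^sub>R J a"
    if a: "a = A $ j - A $ i" for a c i j
  proof -
    obtain x y where axy: "a = x *\<^sub>R e1 + y *\<^sub>R e2" using xy a by blast
    have e1a: "e1 \<bullet> a = x" and e2a: "e2 \<bullet> a = y"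
      using e by (auto simp: axy inner_add_right inner_commute)
    have Ja: "J a = x *\<^sub>R e2 - y *\<^sub>R e1" by (simp add: J_def e1a e2a)
    show "a \<bullet> J a = 0" unfolding Ja using e1a e2a
      by (simp add: inner_diff_right inner_commute[of a])
    have aa: "a \<bullet> a = x * x + y * y" unfolding axy using e
      by (simp add: inner_add_left inner_add_right inner_commute[of e2 e1] algebra_simps)
    then show "J a \<bullet> J a = a \<bullet> a" unfolding Ja using e
      by (simp add: inner_diff_left inner_diff_right inner_commute[of e2 e1] algebra_simps)
    show "(a \<bullet> a) *\<^sub>R ((e1 \<bullet> c) *\<^sub>R e1 + (e2 \<bullet> c) *\<^sub>R e2) = (a \<bullet> c) *\<^sub>R a + (J a \<bullet> c) *\<^sub>R J a"
      unfolding aa Ja unfolding axy by (simp add: inner_add_left inner_diff_left algebra_simps)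
  qed
  have fp: "free_pair A B" unfolding free_pair_def
  proof (intro allI impI conjI)
    fix i j :: 'n assume ij: "i \<noteq> j"
    show a: "A $ j - A $ i \<noteq> 0" by (rule Ane[OF ij])
    have "perp (A $ j - A $ i) (B $ j - B $ i) = J (A $ j - A $ i)"
      unfolding Jdiff perp_def by (simp add: J(1)[OF refl])
    moreover have "J (A $ j - A $ i) \<noteq> 0" using J(2)[OF refl, of j i] a by (metis inner_eq_zero_iff)
    ultimately show "perp (A $ j - A $ i) (B $ j - B $ i) \<noteq> 0" by simp
  qed
  have "nondegenerate m A B" unfolding nondegenerate_def
  proof (intro ballI impI)
    fix C assume C: "C \<in> tangent m A" and hess: "scatter_hess m A B C = 0"
    \<comment> \<open>\<open>T i j\<close> is the contribution of a pair when the kernel equation is tested against the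
      reflection \<open>D\<close> of \<open>C\<close>.\<close>
    define \<rho> where "\<rho> c = 2 *\<^sub>R ((e1 \<bullet> c) *\<^sub>R e1 + (e2 \<bullet> c) *\<^sub>R e2) - c" for c
    define D where "D = (\<chi> i. \<rho> (C $ i))"
    have Ddiff: "D $ j - D $ i = \<rho> (C $ j - C $ i)" for i j
      by (simp add: D_def \<rho>_def inner_diff_right algebra_simps)
    define T where "T i j = m i * m j * ((D $ j - D $ i) \<bullet> deflection_deriv (A $ j - A $ i) (B $ j - B $ i) (C $ j - C $ i))" for i j
    have T_eq: "T i j = - (m i * m j * (2 / (norm a * (a \<bullet> a)) * (perp a c \<bullet> perp a c)))"
      if ij: "i \<noteq> j" and a: "a = A $ j - A $ i" and c: "c = C $ j - C $ i" for i j a c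
    proof -
      have n: "a \<bullet> a > 0" using Ane[OF ij] a by simp
      have "\<rho> c = (1 / (a \<bullet> a)) *\<^sub>R (2 *\<^sub>R ((a \<bullet> a) *\<^sub>R ((e1 \<bullet> c) *\<^sub>R e1 + (e2 \<bullet> c) *\<^sub>R e2))) - c"
        using n by (simp add: \<rho>_def)
      also have "\<dots> = (2 * (a \<bullet> c) / (a \<bullet> a)) *\<^sub>R a + (2 * (J a \<bullet> c) / (a \<bullet> a)) *\<^sub>R J a - c"
        unfolding J(3)[OF a] by (simp add: scaleR_add_right)
      finally have "\<rho> c = \<dots>" .
      from inner_reflected_deflection_deriv[OF refl J(2)[OF a] J(1)[OF a] n this]
      show ?thesis by (simp add: T_def Ddiff Jdiff a c)
    qed
    have Tle: "T i j \<le> 0" for i j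
    proof (cases "i = j")
      case False
      show ?thesis unfolding T_eq[OF False refl refl]
        using mass_pos[of i] mass_pos[of j] by (simp add: less_imp_le)
    qed (simp add: T_def)
    have "2 * minner m D (scatter_hess m A B C) = - (\<Sum>i\<in>UNIV. \<Sum>j\<in>UNIV. T i j)"
      unfolding scatter_hess_def T_def by (rule minner_pair_sum) (rule deflection_deriv_anti)
    then have "(\<Sum>i\<in>UNIV. \<Sum>j\<in>UNIV. - T i j) = 0" by (simp add: hess minner.zero_right sum_negf)
    then have "\<forall>i\<in>UNIV. (\<Sum>j\<in>UNIV. - T i j) = 0"
      by (subst (asm) sum_nonneg_eq_0_iff) (use Tle in \<open>auto intro!: sum_nonneg simp del: sum_negf simp: sum_nonpos sum_negf\<close>)
    then have "\<forall>j\<in>UNIV. - T i j = 0" for i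
      using sum_nonneg_eq_0_iff[of UNIV "\<lambda>j. - T i j"] Tle by auto
    then have T0: "T i j = 0" for i j by simp
    have "perp (A $ j - A $ i) (C $ j - C $ i) = 0" for i j
    proof (cases "i = j")
      case False
      then show ?thesis
        using T0[of i j] T_eq[OF False refl refl] Ane[OF False] mass_pos[of i] mass_pos[of j] by auto
    qed (simp add: perp_def)
    then show "C = 0" by (rule parallel_differences_zero[OF A nc C])
  qed
  with fp show ?thesis by (rule scattering_regularI)
qed

text \<open>
  The differences of the \<open>A $ i\<close> lie in a subspace of dimension at most two, and
  exactly two as the configuration is not collinear; an orthonormal basis of it provides
  \<open>e1\<close> and \<open>e2\<close>.
\<close>

lemma planar_noncollinear_scattering_regular:
  fixes A :: "('d::finite, 'n) config"
  assumes A: "A \<in> Ehat m" and pl: "planar_noncollinear A"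
  shows "scattering_regular m A"
proof -
  have nc: "\<not> collinear (range (\<lambda>i. A $ i))" using pl by (simp add: planar_noncollinear_def)
  obtain u v w where uvw: "range (\<lambda>i. A $ i) \<subseteq> affine hull {u, v, w}"
    using pl by (auto simp: planar_noncollinear_def coplanar_def)
  define S where "S = span {v - u, w - u}"
  have diff: "A $ j - A $ i \<in> S" for i j
  proof -
    have "A $ i \<in> affine hull {u, v, w}" "A $ j \<in> affine hull {u, v, w}" using uvw by auto
    then obtain a b c a' b' c' where
      Ai: "A $ i = a *\<^sub>R u + b *\<^sub>R v + c *\<^sub>R w" "a + b + c = 1" and
      Aj: "A $ j = a' *\<^sub>R u + b' *\<^sub>R v + c' *\<^sub>R w" "a' + b' + c' = 1"
      unfolding affine_hull_3 by blast
    have a: "a = 1 - b - c" "a' = 1 - b' - c'" using Ai(2) Aj(2) by linarith+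
    have "A $ j - A $ i = (b' - b) *\<^sub>R (v - u) + (c' - c) *\<^sub>R (w - u)"
      unfolding Ai(1) Aj(1) a by (simp add: algebra_simps)
    then show ?thesis unfolding S_def by (simp only:) (intro span_add span_scale span_base; simp)
  qed
  have "dim S \<le> 2" unfolding S_def dim_span
    by (rule order_trans[OF dim_le_card']) (auto simp: card_insert_if)
  moreover have "dim S \<ge> 2"
  proof (rule ccontr)
    assume "\<not> dim S \<ge> 2"
    then have "dim S \<le> 1" by simp
    have "collinear (range (\<lambda>i. A $ i))"
    proof -
      obtain Bs where Bs: "Bs \<subseteq> S" "independent Bs" "S \<subseteq> span Bs" "card Bs = dim S" using basis_exists[of S] by blast
      have fin: "finite Bs" using Bs(2) by (rule independent_imp_finite)
      obtain x where "Bs \<subseteq> {x}"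
        using Bs(4) \<open>dim S \<le> 1\<close> fin by (metis card_le_Suc0_iff_eq One_nat_def empty_subsetI insert_iff subsetI subset_singletonD)
      then have "S \<subseteq> span {x}" using Bs(3) span_mono by blast
      then show ?thesis using diff unfolding collinear_def span_singleton by blast
    qed
    with nc show False by blast
  qed
  ultimately have "dim S = 2" by simp
  then obtain Bs where Bs: "pairwise orthogonal Bs" "\<And>x. x \<in> Bs \<Longrightarrow> norm x = 1" "card Bs = 2" "span Bs = S"
    using orthonormal_basis_subspace[of S] unfolding S_def by (metis subspace_span)
  then obtain e1 e2 where e12: "Bs = {e1, e2}" "e1 \<noteq> e2" by (meson card_2_iff)
  have "e1 \<bullet> e1 = 1" "e2 \<bullet> e2 = 1" using Bs(2) e12 by (auto simp: norm_eq_1)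
  moreover have "e1 \<bullet> e2 = 0" using Bs(1) e12 by (auto simp: pairwise_def orthogonal_def)
  ultimately show ?thesis
    using planar_scattering_regular[OF A nc] diff Bs(4) e12(1) by metis
qed

end

section \<open>Density of regular velocities\<close>

lemma inversion_deriv_eq_0:
  assumes "x \<noteq> 0" "inversion_deriv x h = 0" shows "h = 0"
proof -
  have xx: "x \<bullet> x \<noteq> 0" using assms(1) by simp
  have h: "h /\<^sub>R (x \<bullet> x) = (2 * (x \<bullet> h) / (x \<bullet> x)\<^sup>2) *\<^sub>R x"
    using assms(2) by (simp add: inversion_deriv_def)
  then have "x \<bullet> (h /\<^sub>R (x \<bullet> x)) = x \<bullet> ((2 * (x \<bullet> h) / (x \<bullet> x)\<^sup>2) *\<^sub>R x)" by simp
  then have "x \<bullet> h = 0" using xx by (simp add: power2_eq_square field_simps)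
  then show ?thesis using h xx by simp
qed

lemma bounded_linear_inversion_deriv: "bounded_linear (inversion_deriv (x :: 'a::euclidean_space))"
  and bounded_linear_perp: "bounded_linear (perp (x :: 'a::euclidean_space))"
  by (simp_all add: linear_inversion_deriv linear_perp flip: linear_conv_bounded_linear)

text \<open>
  Close approaches dominate: the derivative of the deflection blows up like the inverse square of
  the distance.
\<close>

lemma inversion_deriv_scaleR:
  assumes "c \<noteq> 0" shows "c\<^sup>2 *\<^sub>R inversion_deriv (c *\<^sub>R x) h = inversion_deriv x h"
  using assms by (simp add: inversion_deriv_def scaleR_diff_right power2_eq_square field_simps)

text \<open>
  When offset and variation have parallel transverse parts, the derivative of the deflection is
  negative, because it sees only the derivative of \<open>1 / x\<close>.
\<close>

lemma inner_deflection_deriv_parallel: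
  fixes y :: "'a::real_inner"
  assumes pb: "perp a b = s *\<^sub>R y" and pc: "perp a c = t *\<^sub>R y" and s: "s \<noteq> 0" and y: "y \<noteq> 0"
  shows "c \<bullet> deflection_deriv a b c = - (2 / norm a * (t\<^sup>2 / s\<^sup>2))"
proof -
  have yy: "y \<bullet> y \<noteq> 0" using y by simp
  have "inversion_deriv (perp a b) (perp a c) = - (t / (s\<^sup>2 * (y \<bullet> y))) *\<^sub>R y"
  proof -
    have "inversion_deriv (s *\<^sub>R y) (t *\<^sub>R y)
       = (inverse (s * (s * (y \<bullet> y))) * t - 2 * (s * (t * (y \<bullet> y))) / (s * (s * (y \<bullet> y)))\<^sup>2 * s) *\<^sub>R y"
      by (simp add: inversion_deriv_def scaleR_diff_left)
    moreover have "inverse (s * (s * n)) * t - 2 * (s * (t * n)) / (s * (s * n))\<^sup>2 * s = - (t / (s\<^sup>2 * n))"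
      if "n \<noteq> 0" for n
      using s that by (simp add: divide_simps power2_eq_square)
    ultimately show ?thesis unfolding pb pc using yy by (simp only: simp_thms)
  qed
  then have dd: "deflection_deriv a b c = (2 / norm a * - (t / (s\<^sup>2 * (y \<bullet> y)))) *\<^sub>R y" by (simp add: deflection_deriv_def)
  have "t \<noteq> 0 \<Longrightarrow> c \<bullet> y = t * (y \<bullet> y)"
  proof -
    assume "t \<noteq> 0"
    have "c \<bullet> perp a c = perp a c \<bullet> perp a c" using perp_inner[of a c c] by (simp add: inner_commute)
    then show ?thesis unfolding pc using \<open>t \<noteq> 0\<close> by simp
  qed
  then show ?thesis unfolding dd using s yy by (cases "t = 0") (simp_all add: power2_eq_square field_simps)
qed

context masses begin

context
  fixes A :: "('d::finite, 'n) config" and r :: 'n and lam :: "'n \<Rightarrow> real" and e :: "'n \<Rightarrow> real ^ 'd"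
  assumes A: "A \<in> Ehat m"
    and indep: "\<And>j k. j \<noteq> r \<Longrightarrow> k \<noteq> r \<Longrightarrow> j \<noteq> k \<Longrightarrow> perp (A $ j - A $ r) (A $ k - A $ r) \<noteq> 0"
    and lam: "inj lam"
    and e0: "e r = 0" and e: "\<And>j. j \<noteq> r \<Longrightarrow> e j \<noteq> 0 \<and> (A $ j - A $ r) \<bullet> e j = 0"
begin

text \<open>
  In the limit \<open>\<eta> = 0\<close> every body \<open>j\<close> collides with the root
  \<open>r\<close>, at a time determined by \<open>lam j\<close>; \<open>\<eta>\<close> is the order
  of the miss distance.
\<close>

definition star_config :: "real \<Rightarrow> ('d, 'n) config"
  where "star_config \<eta> = (\<chi> j. lam j *\<^sub>R (A $ j - A $ r) + \<eta> *\<^sub>R e j)"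

lemma velocities_distinct: "i \<noteq> j \<Longrightarrow> A $ j - A $ i \<noteq> 0"
  using A not_CollD[of A j i] by (auto simp: Ehat_def)

lemma star_root: "perp (A $ j - A $ r) (star_config \<eta> $ j - star_config \<eta> $ r) = \<eta> *\<^sub>R e j"
proof (cases "j = r")
  case False
  have "star_config \<eta> $ j - star_config \<eta> $ r = lam j *\<^sub>R (A $ j - A $ r) + \<eta> *\<^sub>R e j"
    by (simp add: star_config_def e0)
  then show ?thesis using e[OF False] velocities_distinct[of r j] False by (simp add: perp_def inner_add_right)
qed (simp add: e0 perp_def)

lemma perp_combination:
  "perp (A $ k - A $ j) (s *\<^sub>R (A $ k - A $ r) - t *\<^sub>R (A $ j - A $ r)) = (s - t) *\<^sub>R perp (A $ k - A $ j) (A $ k - A $ r)"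
proof -
  have "s *\<^sub>R (A $ k - A $ r) - t *\<^sub>R (A $ j - A $ r) = (s - t) *\<^sub>R (A $ k - A $ r) + t *\<^sub>R (A $ k - A $ j)"
    by (simp add: algebra_simps)
  moreover have "perp (A $ k - A $ j) (A $ k - A $ j) = 0" using perp_eq_0_iff[of "A $ k - A $ j"] by (metis scaleR_one)
  ultimately show ?thesis
    by (simp add: linear_add[OF linear_perp] linear_scale[OF linear_perp])
qed

lemma perp_nonroot_nonzero:
  assumes "j \<noteq> r" "k \<noteq> r" "j \<noteq> k"
  shows "perp (A $ k - A $ j) (A $ k - A $ r) \<noteq> 0"
proof
  assume "perp (A $ k - A $ j) (A $ k - A $ r) = 0"
  then obtain s where s: "A $ k - A $ r = s *\<^sub>R (A $ k - A $ j)" unfolding perp_eq_0_iff by blast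
  then have s0: "s \<noteq> 0" using velocities_distinct[of r k] assms by auto
  have "(A $ k - A $ r) - (A $ j - A $ r) = A $ k - A $ j" by simp
  then have "A $ k - A $ r = s *\<^sub>R ((A $ k - A $ r) - (A $ j - A $ r))" using s by (simp only:)
  then have "s *\<^sub>R (A $ j - A $ r) = (s - 1) *\<^sub>R (A $ k - A $ r)" by (simp add: algebra_simps)
  moreover have "x = (inverse s * (s - 1)) *\<^sub>R y" if "s *\<^sub>R x = (s - 1) *\<^sub>R y" for x y :: "real ^ 'd"
    using arg_cong[OF that, of "\<lambda>x. inverse s *\<^sub>R x"] s0 by simp
  ultimately have "A $ j - A $ r = (inverse s * (s - 1)) *\<^sub>R (A $ k - A $ r)" by blast
  then have "perp (A $ k - A $ r) (A $ j - A $ r) = 0" unfolding perp_eq_0_iff by blast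
  with indep[of k j] assms show False by auto
qed

lemma star_zero_perp:
  "perp (A $ k - A $ j) (star_config 0 $ k - star_config 0 $ j) = (lam k - lam j) *\<^sub>R perp (A $ k - A $ j) (A $ k - A $ r)"
  using perp_combination[of k j "lam k" "lam j"] by (simp add: star_config_def)

lemma star_zero_free:
  assumes "j \<noteq> r" "k \<noteq> r" "j \<noteq> k"
  shows "perp (A $ k - A $ j) (star_config 0 $ k - star_config 0 $ j) \<noteq> 0"
  using perp_nonroot_nonzero[OF assms] lam assms(3) by (auto simp: star_zero_perp dest: injD)

lemma tendsto_star_config:
  assumes "(\<eta> \<longlongrightarrow> 0) F" shows "((\<lambda>n. star_config (\<eta> n)) \<longlongrightarrow> star_config 0) F"
  unfolding star_config_def using assms by (intro tendsto_vec_lambda tendsto_intros)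

lemma eventually_star_free_pair:
  assumes \<eta>: "(\<eta> \<longlongrightarrow> 0) F" and pos: "\<And>n. \<eta> n > 0"
  shows "eventually (\<lambda>n. free_pair A (star_config (\<eta> n))) F"
  unfolding free_pair_def
proof (intro eventually_all_finite)
  fix i j
  show "eventually (\<lambda>n. i \<noteq> j \<longrightarrow> A $ j - A $ i \<noteq> 0 \<and> perp (A $ j - A $ i) (star_config (\<eta> n) $ j - star_config (\<eta> n) $ i) \<noteq> 0) F"
  proof (cases "i = j \<or> i = r \<or> j = r")
    case True
    have "i \<noteq> j \<longrightarrow> A $ j - A $ i \<noteq> 0 \<and> perp (A $ j - A $ i) (star_config (\<eta> n) $ j - star_config (\<eta> n) $ i) \<noteq> 0" for n
    proof (intro impI conjI)
      assume ij: "i \<noteq> j"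
      then show "A $ j - A $ i \<noteq> 0" by (rule velocities_distinct)
      have flip: "perp (A $ r - A $ i) (B $ r - B $ i) = - perp (A $ i - A $ r) (B $ i - B $ r)" for B :: "('d, 'n) config"
        by (metis minus_diff_eq perp_minus)
      show "perp (A $ j - A $ i) (star_config (\<eta> n) $ j - star_config (\<eta> n) $ i) \<noteq> 0"
      proof (cases "i = r")
        case True
        then show ?thesis using e[of j] ij pos[of n] by (auto simp: star_root)
      next
        case False
        then have "j = r" using True ij \<open>i = j \<or> i = r \<or> j = r\<close> by blast
        then show ?thesis using e[of i] ij pos[of n] by (auto simp: flip star_root)
      qed
    qed
    then show ?thesis by simp
  next
    case False
    then have ne: "A $ j - A $ i \<noteq> 0" "perp (A $ j - A $ i) (star_config 0 $ j - star_config 0 $ i) \<noteq> 0"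
      using velocities_distinct star_zero_free by auto
    have "eventually (\<lambda>n. perp (A $ j - A $ i) (star_config (\<eta> n) $ j - star_config (\<eta> n) $ i) \<noteq> 0) F"
      by (rule tendsto_imp_eventually_ne[OF tendsto_perp[OF tendsto_const tendsto_pair_diff[OF tendsto_star_config[OF \<eta>]] ne(1)] ne(2)])
    then show ?thesis by eventually_elim (use ne in simp)
  qed
qed

text \<open>
  Multiply the component \<open>j\<close> of the kernel equation by \<open>\<eta>\<^sup>2\<close>.
  In the limit only the interaction with the root survives, and \<open>inversion_deriv (e j)\<close>
  is injective.
\<close>

lemma star_limit_parallel:
  assumes \<eta>: "\<eta> \<longlonglongrightarrow> 0" and pos: "\<And>n. \<eta> n > (0::real)" and C: "C \<longlonglongrightarrow> c"
    and hess: "\<And>n. scatter_hess m A (star_config (\<eta> n)) (C n) = 0" and j: "j \<noteq> r"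
  shows "perp (A $ j - A $ r) (c $ j - c $ r) = 0"
proof -
  define B where "B n = star_config (\<eta> n)" for n
  have BB: "B \<longlonglongrightarrow> star_config 0" unfolding B_def by (rule tendsto_star_config[OF \<eta>])
  define T where "T n k = (\<eta> n)\<^sup>2 *\<^sub>R deflection_deriv (A $ k - A $ j) (B n $ k - B n $ j) (C n $ k - C n $ j)" for n k
  \<comment> \<open>\<open>T n k\<close> is the contribution of body \<open>k\<close>, rescaled by
    \<open>\<eta>\<^sup>2\<close>; \<open>L\<close> is its limit for the root.\<close>
  define L where "L = - (2 / norm (A $ j - A $ r)) *\<^sub>R inversion_deriv (e j) (perp (A $ j - A $ r) (c $ j - c $ r))"
  have sum0: "(\<Sum>k\<in>UNIV. m k *\<^sub>R T n k) = 0" for n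
  proof -
    have "(\<Sum>k\<in>UNIV. m k *\<^sub>R T n k) = (\<eta> n)\<^sup>2 *\<^sub>R (scatter_hess m A (B n) (C n) $ j)"
      by (simp add: T_def scatter_hess_def pair_sum_def scaleR_sum_right mult.commute)
    then show ?thesis using hess[of n] by (simp add: B_def)
  qed
  have lim: "(\<lambda>n. T n k) \<longlonglongrightarrow> (if k = r then L else 0)" for k
  proof (cases "k = r")
    case True
    have "T n r = - (2 / norm (A $ j - A $ r)) *\<^sub>R inversion_deriv (e j) (perp (A $ j - A $ r) (C n $ j - C n $ r))" for n
    proof -
      have "T n r = - ((\<eta> n)\<^sup>2 *\<^sub>R deflection_deriv (A $ j - A $ r) (B n $ j - B n $ r) (C n $ j - C n $ r))"
        unfolding T_def using deflection_deriv_anti[of A r j "B n" "C n"] by simp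
      also have "\<dots> = - (2 / norm (A $ j - A $ r)) *\<^sub>R ((\<eta> n)\<^sup>2 *\<^sub>R inversion_deriv (\<eta> n *\<^sub>R e j) (perp (A $ j - A $ r) (C n $ j - C n $ r)))"
        by (simp add: deflection_deriv_def B_def star_root mult.commute)
      also have "(\<eta> n)\<^sup>2 *\<^sub>R inversion_deriv (\<eta> n *\<^sub>R e j) (perp (A $ j - A $ r) (C n $ j - C n $ r))
         = inversion_deriv (e j) (perp (A $ j - A $ r) (C n $ j - C n $ r))"
        using pos[of n] by (intro inversion_deriv_scaleR) simp
      finally show ?thesis .
    qed
    moreover have "(\<lambda>n. - (2 / norm (A $ j - A $ r)) *\<^sub>R inversion_deriv (e j) (perp (A $ j - A $ r) (C n $ j - C n $ r))) \<longlonglongrightarrow> L"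
      unfolding L_def
      by (intro tendsto_scaleR tendsto_const bounded_linear.tendsto[OF bounded_linear_inversion_deriv]
          bounded_linear.tendsto[OF bounded_linear_perp] tendsto_pair_diff C)
    ultimately show ?thesis using True by simp
  next
    case False
    show ?thesis
    proof (cases "k = j")
      case True
      then show ?thesis using False by (simp add: T_def)
    next
      case kj: False
      have "(\<lambda>n. T n k) \<longlonglongrightarrow> 0\<^sup>2 *\<^sub>R deflection_deriv (A $ k - A $ j) (star_config 0 $ k - star_config 0 $ j) (c $ k - c $ j)"
        unfolding T_def using kj False j
        by (intro tendsto_scaleR tendsto_power \<eta> tendsto_deflection_deriv tendsto_const tendsto_pair_diff BB C velocities_distinct star_zero_free) auto
      then show ?thesis using False by simp
    qed
  qed
  have "(\<lambda>n. \<Sum>k\<in>UNIV. m k *\<^sub>R T n k) \<longlonglongrightarrow> (\<Sum>k\<in>UNIV. m k *\<^sub>R (if k = r then L else 0))"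
    by (intro tendsto_sum tendsto_scaleR tendsto_const lim)
  then have "(\<Sum>k\<in>UNIV. m k *\<^sub>R (if k = r then L else 0)) = 0" by (simp only: sum0 LIMSEQ_const_iff)
  then have "m r *\<^sub>R L = 0" by (simp add: if_distrib cong: if_cong)
  then have "inversion_deriv (e j) (perp (A $ j - A $ r) (c $ j - c $ r)) = 0"
    using mass_pos[of r] velocities_distinct[of r j] j by (simp add: L_def)
  then show ?thesis using inversion_deriv_eq_0 e[OF j] by blast
qed

text \<open>
  By the previous lemma \<open>c\<close> moves each body along its velocity relative to the root,
  say by \<open>\<mu> j\<close> times it. Test the kernel equations against \<open>c\<close> itself.
  The pairs that contain the root drop out before the limit, because the deflection is transverse to
  the relative velocity; the limit of the other terms is a negative multiple of \<open>(\<mu> j -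
  \<mu> i)\<^sup>2 / (lam j - lam i)\<^sup>2\<close> by
  \<open>inner_deflection_deriv_parallel\<close>. So all \<open>\<mu> j\<close> agree and
  \<open>c\<close> is a homothetic image of \<open>A\<close>.
\<close>

lemma star_limit_zero:
  assumes \<eta>: "\<eta> \<longlonglongrightarrow> 0" and pos: "\<And>n. \<eta> n > (0::real)" and C: "C \<longlonglongrightarrow> c"
    and hess: "\<And>n. scatter_hess m A (star_config (\<eta> n)) (C n) = 0" and c: "c \<in> tangent m A"
  shows "c = 0"
proof -
  define B where "B n = star_config (\<eta> n)" for n
  have BB: "B \<longlonglongrightarrow> star_config 0" unfolding B_def by (rule tendsto_star_config[OF \<eta>])
  have "\<exists>\<mu>. c $ j - c $ r = \<mu> *\<^sub>R (A $ j - A $ r)" for j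
  proof (cases "j = r")
    case False
    from star_limit_parallel[OF \<eta> pos C hess this] show ?thesis unfolding perp_eq_0_iff .
  qed simp
  then obtain \<mu> where \<mu>: "\<And>j. c $ j - c $ r = \<mu> j *\<^sub>R (A $ j - A $ r)" by metis
  define T where "T n i j = m i * m j * ((c $ j - c $ i) \<bullet> deflection_deriv (A $ j - A $ i) (B n $ j - B n $ i) (C n $ j - C n $ i))" for n i j
  define L where "L i j = (if i = j \<or> i = r \<or> j = r then 0
     else - (m i * m j * (2 / norm (A $ j - A $ i) * ((\<mu> j - \<mu> i)\<^sup>2 / (lam j - lam i)\<^sup>2))))" for i j
  have sum0: "(\<Sum>i\<in>UNIV. \<Sum>j\<in>UNIV. T n i j) = 0" for n
  proof -
    have "2 * minner m c (scatter_hess m A (B n) (C n)) = - (\<Sum>i\<in>UNIV. \<Sum>j\<in>UNIV. T n i j)"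
      unfolding scatter_hess_def T_def by (rule minner_pair_sum) (rule deflection_deriv_anti)
    then show ?thesis using hess[of n] by (simp add: B_def minner.zero_right)
  qed
  have lim: "(\<lambda>n. T n i j) \<longlonglongrightarrow> L i j" for i j
  proof (cases "i = j \<or> i = r \<or> j = r")
    case True
    have "T n i j = 0" for n
    proof -
      have "c $ j - c $ i = (if i = r then \<mu> j else \<mu> i) *\<^sub>R (A $ j - A $ i)"
        using True \<mu>[of i] \<mu>[of j] by (auto simp: minus_diff_eq[of "c $ i" "c $ r", symmetric] simp flip: scaleR_minus_right)
      then show ?thesis by (simp add: T_def inner_deflection_deriv)
    qed
    then show ?thesis using True by (simp add: L_def)
  next
    case False
    have lim: "(\<lambda>n. T n i j) \<longlonglongrightarrow> m i * m j * ((c $ j - c $ i) \<bullet> deflection_deriv (A $ j - A $ i)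
        (star_config 0 $ j - star_config 0 $ i) (c $ j - c $ i))"
      unfolding T_def using False
      by (intro tendsto_mult tendsto_inner tendsto_deflection_deriv tendsto_const tendsto_pair_diff BB C velocities_distinct star_zero_free) auto
    have cd: "c $ j - c $ i = \<mu> j *\<^sub>R (A $ j - A $ r) - \<mu> i *\<^sub>R (A $ i - A $ r)"
      unfolding \<mu>[symmetric] by simp
    have pc: "perp (A $ j - A $ i) (c $ j - c $ i) = (\<mu> j - \<mu> i) *\<^sub>R perp (A $ j - A $ i) (A $ j - A $ r)"
      unfolding cd by (rule perp_combination)
    have "lam j - lam i \<noteq> 0" using lam False by (auto dest: injD)
    from inner_deflection_deriv_parallel[OF star_zero_perp pc this perp_nonroot_nonzero] False
    have "(c $ j - c $ i) \<bullet> deflection_deriv (A $ j - A $ i) (star_config 0 $ j - star_config 0 $ i) (c $ j - c $ i)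
      = - (2 / norm (A $ j - A $ i) * ((\<mu> j - \<mu> i)\<^sup>2 / (lam j - lam i)\<^sup>2))" by auto
    with lim show ?thesis using False by (simp add: L_def)
  qed
  have Lle: "0 \<le> - L i j" for i j
    using mass_pos[of i] mass_pos[of j] by (auto simp: L_def intro!: mult_nonneg_nonneg divide_nonneg_nonneg less_imp_le)
  have "(\<lambda>n. \<Sum>i\<in>UNIV. \<Sum>j\<in>UNIV. T n i j) \<longlonglongrightarrow> (\<Sum>i\<in>UNIV. \<Sum>j\<in>UNIV. L i j)"
    by (intro tendsto_sum lim)
  then have "(\<Sum>i\<in>UNIV. \<Sum>j\<in>UNIV. L i j) = 0" by (simp only: sum0 LIMSEQ_const_iff)
  then have "(\<Sum>i\<in>UNIV. \<Sum>j\<in>UNIV. - L i j) = 0" by (simp only: sum_negf neg_equal_0_iff_equal)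
  moreover have rows: "0 \<le> (\<Sum>j\<in>UNIV. - L i j)" for i by (intro sum_nonneg Lle)
  then have "(\<Sum>i\<in>UNIV. \<Sum>j\<in>UNIV. - L i j) = 0 \<longleftrightarrow> (\<forall>i\<in>UNIV. (\<Sum>j\<in>UNIV. - L i j) = 0)"
    by (intro sum_nonneg_eq_0_iff finite)
  ultimately have "(\<Sum>j\<in>UNIV. - L i j) = 0" for i by blast
  then have "\<forall>j\<in>UNIV. - L i j = 0" for i
    using sum_nonneg_eq_0_iff[of UNIV "\<lambda>j. - L i j", OF finite Lle] by blast
  then have L0: "L i j = 0" for i j by simp
  have \<mu>eq: "\<mu> i = \<mu> j" if "i \<noteq> r" "j \<noteq> r" for i j
  proof (cases "i = j")
    case False
    then have "lam j - lam i \<noteq> 0" using lam by (auto dest: injD)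
    then show ?thesis
      using L0[of i j] that False mass_pos[of i] mass_pos[of j] velocities_distinct[OF False] by (auto simp: L_def)
  qed simp
  define k where "k = (if \<exists>j. j \<noteq> r then \<mu> (SOME j. j \<noteq> r) else 0)"
  have "c $ j = c $ r + k *\<^sub>R (A $ j - A $ r)" for j
  proof (cases "j = r")
    case False
    then have "(SOME j. j \<noteq> r) \<noteq> r" by (rule someI[where P = "\<lambda>j. j \<noteq> r"])
    then have "\<mu> j = k" using \<mu>eq[OF False] False by (auto simp: k_def)
    then show ?thesis using \<mu>[of j] by (simp add: algebra_simps)
  qed simp
  then show ?thesis by (rule tangent_homothety_zero[OF A c])
qed

lemma star_scattering_regular: "scattering_regular m A"
proof (rule ccontr)
  assume neg: "\<not> scattering_regular m A"
  define \<eta> where "\<eta> n = inverse (real (Suc n))" for n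
  have \<eta>: "\<eta> \<longlonglongrightarrow> 0" unfolding \<eta>_def by (rule LIMSEQ_inverse_real_of_nat)
  have pos: "\<eta> n > 0" for n by (simp add: \<eta>_def)
  obtain N where N: "\<And>n. n \<ge> N \<Longrightarrow> free_pair A (star_config (\<eta> n))"
    using eventually_star_free_pair[OF \<eta> pos] by (auto simp: eventually_sequentially)
  have "\<exists>C. C \<in> tangent m A \<and> norm C = 1 \<and> scatter_hess m A (star_config (\<eta> (n + N))) C = 0" for n
  proof -
    have "\<not> nondegenerate m A (star_config (\<eta> (n + N)))"
      using neg N[of "n + N"] scattering_regularI by auto
    from degenerate_unit_vector[OF this] show ?thesis by blast
  qed
  then obtain C where C: "\<And>n. C n \<in> tangent m A" "\<And>n. norm (C n) = 1"
    "\<And>n. scatter_hess m A (star_config (\<eta> (n + N))) (C n) = 0" by metis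
  obtain c s where c: "norm c = 1" "strict_mono s" "(\<lambda>n. C (s n)) \<longlonglongrightarrow> c" by (rule unit_subsequence[OF C(2)])
  have \<eta>s: "(\<lambda>n. \<eta> (s n + N)) \<longlonglongrightarrow> 0"
    using LIMSEQ_subseq_LIMSEQ[OF LIMSEQ_ignore_initial_segment[OF \<eta>, of N] c(2)] by (simp add: o_def)
  have "c \<in> tangent m A" by (rule tangent_limit[OF tendsto_const c(3)]) (rule C)
  then have "c = 0" using star_limit_zero[OF \<eta>s pos c(3)] C(3) by blast
  then show False using c(1) by simp
qed

end

lemma independent_scattering_regular:
  fixes A :: "('d::finite, 'n) config"
  assumes d2: "CARD('d) \<ge> 2" and A: "A \<in> Ehat m"
    and indep: "\<And>j k. j \<noteq> r \<Longrightarrow> k \<noteq> r \<Longrightarrow> j \<noteq> k \<Longrightarrow> perp (A $ j - A $ r) (A $ k - A $ r) \<noteq> 0"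
  shows "scattering_regular m A"
proof -
  obtain lam :: "'n \<Rightarrow> nat" where lam: "inj lam"
    using finite_imp_inj_to_nat_seg[of "UNIV :: 'n set"] by auto
  then have inj: "inj (\<lambda>i. real (lam i))" by (auto simp: inj_def)
  have "\<exists>v. v \<noteq> 0 \<and> (A $ j - A $ r) \<bullet> v = 0" for j
    using orthogonal_to_vector_exists[of "A $ j - A $ r"] d2 by (auto simp: orthogonal_def)
  then obtain v where v: "\<And>j. v j \<noteq> 0 \<and> (A $ j - A $ r) \<bullet> v j = 0" by metis
  show ?thesis
    by (rule star_scattering_regular[where r = r and lam = "\<lambda>i. real (lam i)" and e = "\<lambda>j. if j = r then 0 else v j", OF A indep inj])
      (use v in auto)
qed

lemma finite_quadratic_zeros:
  fixes \<alpha> \<beta> \<gamma> :: real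
  assumes "\<gamma> \<noteq> 0" shows "finite {t. \<alpha> + \<beta> * t + \<gamma> * t\<^sup>2 = 0}"
proof -
  have "finite {t. poly [:\<alpha>, \<beta>, \<gamma>:] t = 0}" using assms by (intro poly_roots_finite) simp
  then show ?thesis by (simp add: power2_eq_square algebra_simps)
qed

text \<open>
  Perturb in the direction of distinct points on the parabola \<open>(x, x\<^sup>2)\<close> in a
  coordinate plane. For each pair of bodies a \<open>2 \<times> 2\<close> minor of their velocities
  relative to the root is then a quadratic polynomial in the size \<open>t\<close> of the
  perturbation, with a Vandermonde determinant as leading coefficient.
\<close>

lemma scattering_regular_dense:
  fixes A :: "('d::finite, 'n) config"
  assumes d2: "CARD('d) \<ge> 2" and A: "A \<in> Ehat m" and \<delta>: "\<delta> > 0"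
  shows "\<exists>A'\<in>Ehat m. scattering_regular m A' \<and> dist A' A < \<delta>"
proof -
  obtain k1 k2 :: 'd where k: "k1 \<noteq> k2" using two_elements[OF d2] by blast
  obtain f0 :: "'n \<Rightarrow> nat" where f0: "inj f0"
    using finite_imp_inj_to_nat_seg[of "UNIV :: 'n set"] by auto
  define f where "f i = real (f0 i)" for i
  have f: "f i \<noteq> f j" if "i \<noteq> j" for i j using f0 that by (auto simp: f_def dest: injD)
  define X0 :: "('d, 'n) config" where "X0 = (\<chi> i. axis k1 (f i) + axis k2 ((f i)\<^sup>2))"
  obtain X where X: "X \<in> EE m" "\<And>i j. X $ j - X $ i = X0 $ j - X0 $ i" using centred_representative by blast
  obtain r :: 'n where True by blast
  define minor where "minor u w = u $ k1 * w $ k2 - u $ k2 * w $ k1" for u w :: "real ^ 'd"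
  have minor: "perp u w \<noteq> 0" if "minor u w \<noteq> 0" for u w
    using that by (auto simp: perp_eq_0_iff minor_def)
  let ?a = "\<lambda>j. A $ j - A $ r" and ?x = "\<lambda>j. X $ j - X $ r"
  have minor_line: "minor (?a j + t *\<^sub>R ?x j) (?a k + t *\<^sub>R ?x k)
     = minor (?a j) (?a k) + (minor (?a j) (?x k) + minor (?x j) (?a k)) * t + minor (?x j) (?x k) * t\<^sup>2" for j k t
    by (simp add: minor_def power2_eq_square algebra_simps)
  have xk: "?x j $ k1 = f j - f r" "?x j $ k2 = (f j)\<^sup>2 - (f r)\<^sup>2" for j
    using k by (auto simp: X(2) X0_def axis_def)
  have minorX: "minor (?x j) (?x k) \<noteq> 0" if "j \<noteq> r" "k \<noteq> r" "j \<noteq> k" for j k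
  proof -
    have "minor (?x j) (?x k) = (f j - f r) * (f k - f r) * (f k - f j)"
      unfolding minor_def xk by (simp add: power2_eq_square algebra_simps)
    then show ?thesis using f that by auto
  qed
  \<comment> \<open>The finitely many sizes of the perturbation for which some minor vanishes.\<close>
  define bad where "bad = (\<Union>j\<in>UNIV - {r}. \<Union>k\<in>UNIV - {r, j}. {t. minor (?a j + t *\<^sub>R ?x j) (?a k + t *\<^sub>R ?x k) = 0})"
  have "finite bad" unfolding bad_def minor_line
    by (intro finite_UN_I finite_quadratic_zeros minorX) auto
  obtain d where d: "d > 0" "separated d A" using separated_of_not_Coll[of A] A by (auto simp: Ehat_def)
  define s where "s = min \<delta> (d / 2) / (norm X + 1)"
  have s: "s > 0" using \<delta> d by (simp add: s_def add_nonneg_pos)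
  have "infinite {0<..<s}" using s by simp
  then obtain t where t: "t \<in> {0<..<s}" "t \<notin> bad" using \<open>finite bad\<close> by (meson finite_subset subsetI)
  define A' where "A' = A + t *\<^sub>R X"
  have small: "norm (t *\<^sub>R X) < min \<delta> (d / 2)"
  proof -
    have "norm (t *\<^sub>R X) \<le> t * (norm X + 1)" using t by simp
    also have "\<dots> < s * (norm X + 1)" using t by (intro mult_strict_right_mono) (auto simp: add_nonneg_pos)
    also have "\<dots> = min \<delta> (d / 2)" unfolding s_def by (simp add: add_nonneg_eq_0_iff)
    finally show ?thesis .
  qed
  have "separated (d - 2 * norm (t *\<^sub>R X)) A'" unfolding A'_def by (rule separated_perturb[OF d(2) order_refl])
  then have "A' \<notin> Coll" by (rule separated_not_Coll) (use small in simp)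
  then have A': "A' \<in> Ehat m" using A X(1) by (auto simp: Ehat_def A'_def intro: EE_closed)
  moreover have "scattering_regular m A'"
  proof (rule independent_scattering_regular[OF d2 A', of r])
    fix j k assume jk: "j \<noteq> r" "k \<noteq> r" "j \<noteq> k"
    have "A' $ j - A' $ r = ?a j + t *\<^sub>R ?x j" for j by (simp add: A'_def algebra_simps)
    moreover have "minor (?a j + t *\<^sub>R ?x j) (?a k + t *\<^sub>R ?x k) \<noteq> 0" using t(2) jk by (auto simp: bad_def)
    ultimately show "perp (A' $ j - A' $ r) (A' $ k - A' $ r) \<noteq> 0" using minor by simp
  qed
  moreover have "dist A' A < \<delta>" using small by (simp add: A'_def dist_norm)
  ultimately show ?thesis by blast
qed

text \<open>
  Place the bodies at distinct points of a line whose direction \<open>u s\<close> is not parallel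
  to any relative velocity; each relative velocity excludes at most one \<open>s\<close>.
\<close>

lemma free_pair_exists:
  fixes A :: "('d::finite, 'n) config"
  assumes d2: "CARD('d) \<ge> 2" and A: "A \<in> Ehat m"
  obtains B where "B \<in> EE m" "free_pair A B"
proof -
  obtain k1 k2 :: 'd where k: "k1 \<noteq> k2" using two_elements[OF d2] by blast
  define u :: "real \<Rightarrow> real ^ 'd" where "u s = axis k1 1 + s *\<^sub>R axis k2 1" for s
  have u: "u s $ k1 = 1" "u s $ k2 = s" for s using k by (auto simp: u_def axis_def)
  define bad where "bad i j = {s. perp (A $ j - A $ i) (u s) = 0}" for i j
  have uniq: "s = s'" if "s \<in> bad i j" "s' \<in> bad i j" for s s' i j
  proof -
    have "perp (A $ j - A $ i) (u s) = 0" "perp (A $ j - A $ i) (u s') = 0"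
      using that by (simp_all add: bad_def)
    then obtain x y where x: "u s = x *\<^sub>R (A $ j - A $ i)" and y: "u s' = y *\<^sub>R (A $ j - A $ i)"
      unfolding perp_eq_0_iff by blast
    have "1 = x * (A $ j - A $ i) $ k1" "s = x * (A $ j - A $ i) $ k2" "1 = y * (A $ j - A $ i) $ k1"
      "s' = y * (A $ j - A $ i) $ k2"
      using arg_cong[OF x, of "\<lambda>v. v $ k1"] arg_cong[OF x, of "\<lambda>v. v $ k2"]
        arg_cong[OF y, of "\<lambda>v. v $ k1"] arg_cong[OF y, of "\<lambda>v. v $ k2"]
      by (simp_all only: u vector_scaleR_component real_scaleR_def)
    then show ?thesis by (metis mult_cancel_right mult_zero_right zero_neq_one)
  qed
  have "finite (bad i j)" for i j
  proof (cases "bad i j = {}")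
    case False
    then obtain s where "s \<in> bad i j" by blast
    then have "bad i j \<subseteq> {s}" using uniq by blast
    then show ?thesis by (rule finite_subset) simp
  qed simp
  then have "finite (\<Union>i\<in>UNIV. \<Union>j\<in>UNIV. bad i j)" by (intro finite_UN_I) auto
  then obtain s where s: "s \<notin> (\<Union>i\<in>UNIV. \<Union>j\<in>UNIV. bad i j)"
    using ex_new_if_finite[OF infinite_UNIV_char_0] by blast
  obtain f0 :: "'n \<Rightarrow> nat" where f0: "inj f0"
    using finite_imp_inj_to_nat_seg[of "UNIV :: 'n set"] by auto
  define B0 :: "('d, 'n) config" where "B0 = (\<chi> i. real (f0 i) *\<^sub>R u s)"
  have "free_pair A B0" unfolding free_pair_def
  proof (intro allI impI conjI)
    fix i j :: 'n assume ij: "i \<noteq> j"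
    show "A $ j - A $ i \<noteq> 0" using A not_CollD[of A j i] ij by (auto simp: Ehat_def)
    have "B0 $ j - B0 $ i = (real (f0 j) - real (f0 i)) *\<^sub>R u s" by (simp add: B0_def scaleR_diff_left)
    moreover have "real (f0 j) - real (f0 i) \<noteq> 0" using f0 ij by (auto dest: injD)
    moreover have "perp (A $ j - A $ i) (u s) \<noteq> 0" using s by (auto simp: bad_def)
    ultimately show "perp (A $ j - A $ i) (B0 $ j - B0 $ i) \<noteq> 0" by (simp add: linear_scale[OF linear_perp])
  qed
  moreover obtain B where "B \<in> EE m" "\<And>i j. B $ j - B $ i = B0 $ j - B0 $ i" using centred_representative by blast
  ultimately show ?thesis using that[of B] by (simp add: free_pair_def)
qed

text \<open>
  Free motion, \<open>\<epsilon> = 0\<close>, does not change the velocity.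
\<close>

lemma scatters_refl:
  fixes A :: "('d::finite, 'n) config"
  assumes d2: "CARD('d) \<ge> 2" and A: "A \<in> Ehat m"
  shows "scatters m A A"
proof -
  obtain B where B: "B \<in> EE m" "free_pair A B" using free_pair_exists[OF d2 A] by blast
  obtain c where c: "c > 0" "\<And>t. separated (c * (1 + \<bar>t\<bar>)) (t *\<^sub>R A + B)"
    using free_pair_separated[OF B(2)] by blast
  show ?thesis
  proof (rule newton_scatters[where q = "\<lambda>t. t *\<^sub>R A + B" and p = "\<lambda>t. A" and \<epsilon> = 0, OF _ _ _ _ _ _ _ _ A A])
    show "((\<lambda>t. t *\<^sub>R A + B) has_vector_derivative A) (at t)" for t by (auto intro!: derivative_eq_intros)
    show "t *\<^sub>R A + B \<notin> Coll" for t
      using separated_not_Coll[OF c(2)[of t]] c(1) by (simp add: add_pos_nonneg)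
    show "0 < minner m A A / 2 - 0 * pot m (t *\<^sub>R A + B)" for t
      using minner_pos[OF Ehat_nonzero[OF A]] by simp
  qed (use B in \<open>auto intro!: derivative_eq_intros\<close>)
qed

end

section \<open>The scattering relation\<close>

lemma rotate_config_transpose:
  assumes "orthogonal_matrix R"
  shows "rotate_config (transpose R) (rotate_config R A) = A"
proof -
  have "transpose R *v (R *v x) = x" for x
    using assms by (simp add: matrix_vector_mul_assoc orthogonal_matrix)
  then show ?thesis by (simp add: rotate_config_def)
qed

lemma point_reflection:
  shows "orthogonal_matrix (- mat 1 :: real ^ 'd ^ 'd)"
    and "rotate_config (- mat 1 :: real ^ 'd ^ 'd) A = - (A :: ('d::finite, 'n::finite) config)"
proof -
  have mult: "(- mat 1 :: real ^ 'd ^ 'd) *v x = - x" for x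
    by (simp add: vec_eq_iff matrix_vector_mult_def mat_def if_distrib if_distribR sum_negf cong: if_cong)
  have "orthogonal_transformation ((*v) (- mat 1 :: real ^ 'd ^ 'd))"
    by (simp add: orthogonal_transformation_def mult)
  then show "orthogonal_matrix (- mat 1 :: real ^ 'd ^ 'd)" by (simp add: orthogonal_transformation_matrix)
  show "rotate_config (- mat 1 :: real ^ 'd ^ 'd) A = - A" by (simp add: rotate_config_def mult vec_eq_iff)
qed

theorem theorem5p1:
  fixes m :: "'n::{finite,linorder} \<Rightarrow> real"
  assumes n_ge_2: "CARD('n) \<ge> 2"
    and d_ge_2: "CARD('d::finite) \<ge> 2"
    and mass_pos: "\<And>i. m i > 0"
  shows
    "(\<forall>A \<in> (Ehat m :: ('d, 'n) config set). \<forall>A' \<in> Ehat m.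
         scatters m A A' \<longrightarrow> mnorm m A = mnorm m A') \<and>
     (\<forall>A \<in> (Ehat m :: ('d, 'n) config set). scatters m A A) \<and>
     (\<forall>A \<in> (Ehat m :: ('d, 'n) config set). \<forall>A' \<in> Ehat m.
         scatters m A A' \<longleftrightarrow> scatters m (- A') (- A)) \<and>
     (\<forall>A \<in> (Ehat m :: ('d, 'n) config set). \<forall>A' \<in> Ehat m. \<forall>k > 0.
         scatters m A A' \<longleftrightarrow> scatters m (k *\<^sub>R A) (k *\<^sub>R A')) \<and>
     (\<forall>A \<in> (Ehat m :: ('d, 'n) config set). \<forall>A' \<in> Ehat m.
         \<forall>R :: real ^ 'd ^ 'd. orthogonal_matrix R \<longrightarrow>
           (scatters m A A' \<longleftrightarrow> scatters m (rotate_config R A) (rotate_config R A'))) \<and>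
     (\<forall>A \<in> (Ehat m :: ('d, 'n) config set). \<forall>A' \<in> Ehat m.
         scatters m A A' \<longleftrightarrow> scatters m A' A) \<and>
     (\<exists>G :: ('d, 'n) config set.
         openin (top_of_set (Ehat m)) G \<and> Ehat m \<subseteq> closure G \<and>
         (\<forall>A \<in> Ehat m. planar_noncollinear A \<longrightarrow> A \<in> G) \<and>
         (\<forall>A \<in> G. \<exists>W. W \<noteq> {} \<and> openin (top_of_set (Shat m (mnorm m A))) W \<and>
            W \<subseteq> HS m A \<and> A \<in> closure W))"
proof -
  interpret masses m
    by unfold_locales (rule mass_pos, rule n_ge_2)
  have minus: "- A \<in> Ehat m" if "A \<in> Ehat m" for A :: "('d, 'n) config"
    using Ehat_scaleR[of "-1" A] that by simp
  have reverse: "scatters m A A' \<longleftrightarrow> scatters m (- A') (- A)"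
    if "A \<in> Ehat m" "A' \<in> Ehat m" for A A' :: "('d, 'n) config"
    using scatters_reverse[OF that] scatters_reverse[OF minus[OF that(2)] minus[OF that(1)]] by auto
  have dilate: "scatters m A A' \<longleftrightarrow> scatters m (k *\<^sub>R A) (k *\<^sub>R A')"
    if "A \<in> Ehat m" "A' \<in> Ehat m" "k > 0" for A A' :: "('d, 'n) config" and k
  proof
    show "scatters m A A' \<Longrightarrow> scatters m (k *\<^sub>R A) (k *\<^sub>R A')" using scatters_dilate that by blast
    assume "scatters m (k *\<^sub>R A) (k *\<^sub>R A')"
    from scatters_dilate[OF Ehat_scaleR[OF _ that(1)] Ehat_scaleR[OF _ that(2)] this, of "inverse k"]
    show "scatters m A A'" using that(3) by simp
  qed
  have rotate: "scatters m A A' \<longleftrightarrow> scatters m (rotate_config R A) (rotate_config R A')"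
    if "A \<in> Ehat m" "A' \<in> Ehat m" "orthogonal_matrix R" for A A' :: "('d, 'n) config" and R :: "real ^ 'd ^ 'd"
  proof
    show "scatters m A A' \<Longrightarrow> scatters m (rotate_config R A) (rotate_config R A')"
      using scatters_rotate that by blast
    assume "scatters m (rotate_config R A) (rotate_config R A')"
    moreover have "orthogonal_matrix (transpose R)" using that(3) by (simp add: orthogonal_matrix_def)
    ultimately show "scatters m A A'"
      using scatters_rotate[of "transpose R", OF _ rotate_in_Ehat[OF that(3,1)] rotate_in_Ehat[OF that(3,2)]]
      by (simp add: rotate_config_transpose[OF that(3)])
  qed
  have reversible: "scatters m A A' \<longleftrightarrow> scatters m A' A"
    if "A \<in> Ehat m" "A' \<in> Ehat m" for A A' :: "('d, 'n) config"
    using reverse[OF that] rotate[OF that(2,1) point_reflection(1)] by (simp add: point_reflection(2))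
  define G :: "('d, 'n) config set" where "G = {A \<in> Ehat m. scattering_regular m A}"
  have "openin (top_of_set (Ehat m)) G"
    unfolding openin_euclidean_subtopology_iff
  proof (intro conjI ballI)
    fix A assume "A \<in> G"
    then obtain e where "e > 0" "\<And>A'. dist A' A < e \<Longrightarrow> scattering_regular m A'"
      using scattering_regular_open[of m A] by (auto simp: G_def)
    then show "\<exists>e>0. \<forall>A'\<in>Ehat m. dist A' A < e \<longrightarrow> A' \<in> G" by (auto simp: G_def)
  qed (auto simp: G_def)
  moreover have "Ehat m \<subseteq> closure G"
    using scattering_regular_dense[OF d_ge_2] by (force simp: closure_approachable G_def)
  moreover have "\<forall>A\<in>Ehat m. planar_noncollinear A \<longrightarrow> A \<in> G"
    using planar_noncollinear_scattering_regular by (auto simp: G_def)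
  moreover have "\<forall>A\<in>G. \<exists>W. W \<noteq> {} \<and> openin (top_of_set (Shat m (mnorm m A))) W \<and> W \<subseteq> HS m A \<and> A \<in> closure W"
    using scattering_image_open by (auto simp: G_def scattering_regular_def)
  ultimately show ?thesis
    using scatters_energy scatters_refl[OF d_ge_2] reverse dilate rotate reversible by blast
qed

end
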